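(* Let $n_1,n_2,n_3$ be positive integers, $\alpha:=\max\{n_2/n_3,n_3/n_2\}$, let $q\le n_1$ be an integer with $q\ge(4+5\alpha)(1+1/\alpha)$, and let $p=\lfloor q\cdot\frac{n_3}{n_2+n_3}\rfloor$. Let $a^{(\ell)}\in\mathbb{R}^{n_1}$, $b^{(\ell)}\in\mathbb{R}^{n_2}$, $c^{(\ell)}\in\mathbb{R}^{n_3}$ ($\ell\in[r]$) be generically chosen with $$ r\le (n_2+n_3)\left(1-\frac{3+\alpha}{q}\right)-\frac{q^3}{4},$$ and $T=\sum_{\ell=1}^r a^{(\ell)}\otimes b^{(\ell)}\otimes c^{(\ell)}$. Then $\bar p:=\min\{p+1,q-p\}\ge 2$ and the following conditions all hold: (i) $a^{(\ell)}_1\neq0$ for all $\ell$; (ii) the vectors $(a^{(\ell)}_1,\dots,a^{(\ell)}_{\bar p})^\top$ are pairwise linearly independent; (iii) the vectors $d^{(\ell)}\otimes b^{(\ell)}$ are linearly independent, where $d^{(\ell)}:=(a^{(\ell)}_1,\dots,a^{(\ell)}_{p+1})^\top$; (iv) the vectors $f^{(\ell)}\otimes c^{(\ell)}$ are linearly independent, where $f^{(\ell)}:=(a^{(\ell)}_1,\dots,a^{(\ell)}_{q-p})^\top$; (v) the vectors $b^{(\ell)}\otimes c^{(\ell)}$ are linearly independent; (vi) $\mathrm{rank}\,M(T;p,q)=r\binom{q-1}{p}$; (vii) $\mathrm{rank}\,M'(T;p,q)=r\binom{q-1}{p}$; (viii) $N$, (ix) $N'$, (x) $P$, (xi) $P'$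 each have full column rank.
   Context: Notation: $[q]=\{1,\dots,q\}$; $\sigma(U,i):=(-1)^{|\{j\in U:j<i\}|}$. "Generically chosen" means there is a nonidentically-zero polynomial in all coordinates of all $a^{(\ell)},b^{(\ell)},c^{(\ell)}$ such that the conclusion holds whenever it is nonzero. $M(T;p,q)$: rows $(S,j)$, $S\subseteq[q]$, $|S|=p$, $j\in[n_2]$; columns $(U,k)$, $U\subseteq[q]$, $|U|=p+1$, $k\in[n_3]$; entries $\sum_{i=1}^q\mathbf{1}_{U=S\sqcup\{i\}}\sigma(U,i)T_{ijk}$. $M'(T;p,q)$: rows $(S,k)$, $|S|=q-p-1$, $k\in[n_3]$; columns $(U,j)$, $|U|=q-p$, $j\in[n_2]$ (subsets of $[q]$); entries $\sum_{i=1}^q\mathbf{1}_{U=S\sqcup\{i\}}\sigma(U,i)T_{ijk}$. $N$: rows $(S,j)$ with $S\subseteq[q]$, $|S|=p$, $S\not\subseteq[p+1]$, $j\in[n_2]$; columns $(U,\ell)$ with $U\subseteq[q]$, $|U|=p+1$, $1\in U$, $U\neq[p+1]$, $\ell\in[r]$; entries $b^{(\ell)}_j\sum_{i=1}^q\mathbf{1}_{U=S\sqcup\{i\}}\sigma(U,i)a^{(\ell)}_i$. $N'$: rows $(S,k)$ with $|S|=q-p-1$, $S\not\subseteq[q-p]$, $k\in[n_3]$; columns $(U,\ell)$ with $|U|=q-p$, $1\in U$, $U\ne[q-p]$, $\ell\in[r]$; entries $c^{(\ell)}_k\sum_{i=1}^q\mathbf{1}_{U=S\sqcup\{i\}}\sigma(U,i)a^{(\ell)}_i$.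 $P$: rows $(i_1,i_2,j_1,j_2)$ with $1\le i_1<i_2\le p+1$, $1\le j_1<j_2\le n_2$; columns $(\ell_1,\ell_2)$, $1\le\ell_1<\ell_2\le r$; entries $a^{(\ell_1)}_{i_1}b^{(\ell_1)}_{j_1}a^{(\ell_2)}_{i_2}b^{(\ell_2)}_{j_2}+a^{(\ell_2)}_{i_1}b^{(\ell_2)}_{j_1}a^{(\ell_1)}_{i_2}b^{(\ell_1)}_{j_2}-a^{(\ell_1)}_{i_1}b^{(\ell_1)}_{j_2}a^{(\ell_2)}_{i_2}b^{(\ell_2)}_{j_1}-a^{(\ell_2)}_{i_1}b^{(\ell_2)}_{j_2}a^{(\ell_1)}_{i_2}b^{(\ell_1)}_{j_1}$. $P'$: same as $P$ with $1\le i_1<i_2\le q-p$, $1\le j_1<j_2\le n_3$ and $b$ replaced by $c$. *)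

theory Defs
  imports Complex_Main "HOL-Library.Function_Algebras" "HOL-Library.Poly_Mapping"
begin

section \<open>Vectors and matrices over arbitrary index sets\<close>

text \<open>Vectors are functions from indices to reals that vanish outside the relevant finite
  index set; matrices are given by a row index set, a column index set and an entry function.\<close>

global_interpretation fun_space: vector_space "\<lambda>(s::real) (f::'i \<Rightarrow> real) x. s * f x"
  by unfold_locales (auto simp: algebra_simps)

definition lin_indep_family :: "'l set \<Rightarrow> ('l \<Rightarrow> 'i \<Rightarrow> real) \<Rightarrow> bool" where
  "lin_indep_family L v \<longleftrightarrow> inj_on v L \<and> fun_space.independent (v ` L)"

definition pairwise_lin_indep :: "'l set \<Rightarrow> ('l \<Rightarrow> 'i \<Rightarrow> real) \<Rightarrow> bool" where
  "pairwise_lin_indep L v \<longleftrightarrow> (\<forall>l\<in>L. \<forall>m\<in>L. l \<noteq> m \<longrightarrow> lin_indep_family {l, m} v)"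

definition mat_col :: "'i set \<Rightarrow> ('i \<Rightarrow> 'j \<Rightarrow> real) \<Rightarrow> 'j \<Rightarrow> 'i \<Rightarrow> real" where
  "mat_col R A j = (\<lambda>i. if i \<in> R then A i j else 0)"

definition mat_rank :: "'i set \<Rightarrow> 'j set \<Rightarrow> ('i \<Rightarrow> 'j \<Rightarrow> real) \<Rightarrow> nat" where
  "mat_rank R C A = fun_space.dim (mat_col R A ` C)"

definition full_column_rank :: "'i set \<Rightarrow> 'j set \<Rightarrow> ('i \<Rightarrow> 'j \<Rightarrow> real) \<Rightarrow> bool" where
  "full_column_rank R C A \<longleftrightarrow> mat_rank R C A = card C"

definition first_coords :: "nat \<Rightarrow> (nat \<Rightarrow> real) \<Rightarrow> nat \<Rightarrow> real" where
  "first_coords n v = (\<lambda>i. if i \<in> {1..n} then v i else 0)"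

definition tensor2 :: "('i \<Rightarrow> real) \<Rightarrow> ('j \<Rightarrow> real) \<Rightarrow> 'i \<times> 'j \<Rightarrow> real" where
  "tensor2 u v = (\<lambda>(i, j). u i * v j)"

definition tensor_sum ::
  "nat \<Rightarrow> (nat \<Rightarrow> nat \<Rightarrow> real) \<Rightarrow> (nat \<Rightarrow> nat \<Rightarrow> real) \<Rightarrow> (nat \<Rightarrow> nat \<Rightarrow> real)
    \<Rightarrow> nat \<Rightarrow> nat \<Rightarrow> nat \<Rightarrow> real" where
  "tensor_sum r a b c i j k = (\<Sum>l=1..r. a l i * b l j * c l k)"

section \<open>Genericity\<close>

text \<open>Multivariate real polynomials: finitely supported maps from monomials
  (finitely supported exponent vectors) to coefficients.\<close>

type_synonym 'v mpolynomial = "('v \<Rightarrow>\<^sub>0 nat) \<Rightarrow>\<^sub>0 real"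

definition mp_vars :: "'v mpolynomial \<Rightarrow> 'v set" where
  "mp_vars F = (\<Union>m\<in>Poly_Mapping.keys F. Poly_Mapping.keys m)"

definition mp_eval :: "'v mpolynomial \<Rightarrow> ('v \<Rightarrow> real) \<Rightarrow> real" where
  "mp_eval F x = (\<Sum>m\<in>Poly_Mapping.keys F. Poly_Mapping.lookup F m *
     (\<Prod>v\<in>Poly_Mapping.keys m. x v ^ Poly_Mapping.lookup m v))"

text \<open>\<open>A_coord l i\<close> is the variable for the \<open>i\<close>-th coordinate of the \<open>l\<close>-th vector \<open>a\<close>,
  similarly for \<open>b\<close> and \<open>c\<close>.\<close>

datatype coord = A_coord nat nat | B_coord nat nat | C_coord nat nat

definition coords :: "nat \<Rightarrow> nat \<Rightarrow> nat \<Rightarrow> nat \<Rightarrow> coord set" where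
  "coords n1 n2 n3 r =
     {A_coord l i | l i. l \<in> {1..r} \<and> i \<in> {1..n1}} \<union>
     {B_coord l j | l j. l \<in> {1..r} \<and> j \<in> {1..n2}} \<union>
     {C_coord l k | l k. l \<in> {1..r} \<and> k \<in> {1..n3}}"

fun coord_val ::
  "(nat \<Rightarrow> nat \<Rightarrow> real) \<Rightarrow> (nat \<Rightarrow> nat \<Rightarrow> real) \<Rightarrow> (nat \<Rightarrow> nat \<Rightarrow> real) \<Rightarrow> coord \<Rightarrow> real" where
  "coord_val a b c (A_coord l i) = a l i"
| "coord_val a b c (B_coord l j) = b l j"
| "coord_val a b c (C_coord l k) = c l k"

text \<open>The vectors \<open>a l\<close> range over all functions on \<open>nat\<close>, but the polynomial only involves the
  coordinates \<open>1..n1\<close> (and \<open>1..n2\<close>, \<open>1..n3\<close>) of the vectors with index in \<open>1..r\<close>;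
  the remaining values play no role.\<close>

definition generically ::
  "nat \<Rightarrow> nat \<Rightarrow> nat \<Rightarrow> nat \<Rightarrow>
    ((nat \<Rightarrow> nat \<Rightarrow> real) \<Rightarrow> (nat \<Rightarrow> nat \<Rightarrow> real) \<Rightarrow> (nat \<Rightarrow> nat \<Rightarrow> real) \<Rightarrow> bool) \<Rightarrow> bool" where
  "generically n1 n2 n3 r Q \<longleftrightarrow>
     (\<exists>F :: coord mpolynomial. F \<noteq> 0 \<and> mp_vars F \<subseteq> coords n1 n2 n3 r \<and>
        (\<forall>a b c. mp_eval F (coord_val a b c) \<noteq> 0 \<longrightarrow> Q a b c))"

section \<open>The matrices\<close>

definition sgn_pos :: "nat set \<Rightarrow> nat \<Rightarrow> real" where
  "sgn_pos U i = (-1) ^ card {j\<in>U. j < i}"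

definition koszul_coeff :: "nat set \<Rightarrow> nat set \<Rightarrow> nat \<Rightarrow> real" where
  "koszul_coeff S U i = of_bool (i \<notin> S \<and> U = S \<union> {i}) * sgn_pos U i"

definition subset_idx :: "nat \<Rightarrow> nat \<Rightarrow> nat \<Rightarrow> (nat set \<times> nat) set" where
  "subset_idx q s n = {(S, j). S \<subseteq> {1..q} \<and> card S = s \<and> j \<in> {1..n}}"

definition M_entry :: "(nat \<Rightarrow> nat \<Rightarrow> nat \<Rightarrow> real) \<Rightarrow> nat \<Rightarrow> nat set \<times> nat \<Rightarrow> nat set \<times> nat \<Rightarrow> real" where
  "M_entry T q = (\<lambda>(S, j) (U, k). \<Sum>i=1..q. koszul_coeff S U i * T i j k)"

definition rank_M :: "nat \<Rightarrow> nat \<Rightarrow> (nat \<Rightarrow> nat \<Rightarrow> nat \<Rightarrow> real) \<Rightarrow> nat \<Rightarrow> nat \<Rightarrow> nat" where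
  "rank_M n2 n3 T p q = mat_rank (subset_idx q p n2) (subset_idx q (p + 1) n3) (M_entry T q)"

definition M'_entry :: "(nat \<Rightarrow> nat \<Rightarrow> nat \<Rightarrow> real) \<Rightarrow> nat \<Rightarrow> nat set \<times> nat \<Rightarrow> nat set \<times> nat \<Rightarrow> real" where
  "M'_entry T q = (\<lambda>(S, k) (U, j). \<Sum>i=1..q. koszul_coeff S U i * T i j k)"

definition rank_M' :: "nat \<Rightarrow> nat \<Rightarrow> (nat \<Rightarrow> nat \<Rightarrow> nat \<Rightarrow> real) \<Rightarrow> nat \<Rightarrow> nat \<Rightarrow> nat" where
  "rank_M' n2 n3 T p q =
     mat_rank (subset_idx q (q - p - 1) n3) (subset_idx q (q - p) n2) (M'_entry T q)"

text \<open>\<open>N\<close> is obtained with \<open>s = p\<close>, \<open>n = n2\<close> and the vectors \<open>b\<close>;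
  \<open>N'\<close> with \<open>s = q - p - 1\<close>, \<open>n = n3\<close> and the vectors \<open>c\<close>.\<close>

definition N_rows :: "nat \<Rightarrow> nat \<Rightarrow> nat \<Rightarrow> (nat set \<times> nat) set" where
  "N_rows q s n = {(S, j) \<in> subset_idx q s n. \<not> S \<subseteq> {1..s + 1}}"

definition N_cols :: "nat \<Rightarrow> nat \<Rightarrow> nat \<Rightarrow> (nat set \<times> nat) set" where
  "N_cols q s r = {(U, l) \<in> subset_idx q (s + 1) r. 1 \<in> U \<and> U \<noteq> {1..s + 1}}"

definition N_entry ::
  "(nat \<Rightarrow> nat \<Rightarrow> real) \<Rightarrow> (nat \<Rightarrow> nat \<Rightarrow> real) \<Rightarrow> nat \<Rightarrow> nat set \<times> nat \<Rightarrow> nat set \<times> nat \<Rightarrow> real" where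
  "N_entry a b q = (\<lambda>(S, j) (U, l). b l j * (\<Sum>i=1..q. koszul_coeff S U i * a l i))"

text \<open>\<open>P\<close> is obtained with \<open>m = p + 1\<close>, \<open>n = n2\<close> and the vectors \<open>b\<close>;
  \<open>P'\<close> with \<open>m = q - p\<close>, \<open>n = n3\<close> and the vectors \<open>c\<close>.\<close>

definition P_rows :: "nat \<Rightarrow> nat \<Rightarrow> (nat \<times> nat \<times> nat \<times> nat) set" where
  "P_rows m n = {(i1, i2, j1, j2). 1 \<le> i1 \<and> i1 < i2 \<and> i2 \<le> m \<and> 1 \<le> j1 \<and> j1 < j2 \<and> j2 \<le> n}"

definition P_cols :: "nat \<Rightarrow> (nat \<times> nat) set" where
  "P_cols r = {(l1, l2). 1 \<le> l1 \<and> l1 < l2 \<and> l2 \<le> r}"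

definition P_entry ::
  "(nat \<Rightarrow> nat \<Rightarrow> real) \<Rightarrow> (nat \<Rightarrow> nat \<Rightarrow> real) \<Rightarrow> nat \<times> nat \<times> nat \<times> nat \<Rightarrow> nat \<times> nat \<Rightarrow> real" where
  "P_entry a b = (\<lambda>(i1, i2, j1, j2) (l1, l2).
       a l1 i1 * b l1 j1 * a l2 i2 * b l2 j2
     + a l2 i1 * b l2 j1 * a l1 i2 * b l1 j2
     - a l1 i1 * b l1 j2 * a l2 i2 * b l2 j1
     - a l2 i1 * b l2 j2 * a l1 i2 * b l1 j1)"

end

theory Submission
  imports Defs "HOL-Computational_Algebra.Polynomial"
begin

text \<open>
  The rank statements (vi) and (vii) follow from (i), (iii), (iv), (viii) and (ix): \<open>M\<close> factors as a
  matrix with columns indexed by the pairs \<open>(U, l)\<close> with \<open>1 \<in> U\<close>, which is block triangular with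
  diagonal blocks \<open>N\<close> and the tensors of (iii), times a matrix that is, after complementing subsets and
  up to signs, the transpose of its analogue for \<open>M'\<close>. All other conditions are of the form ``the columns
  of a matrix with polynomial entries are independent'', so one witness suffices for each of them.

  For \<open>P\<close> and the tensors of (iii), put the \<open>a\<close>-vectors on the moment curve, group the indices \<open>l\<close> into
  blocks of size at most half of the number of coordinates of \<open>a\<close> involved, and let \<open>b\<close> map each block to
  its own coordinate plane: the vectors \<open>a\<close> of any two blocks are then independent.

  For \<open>N\<close>, blocks of \<open>q - 1\<close> indices are mapped to blocks of \<open>q - p\<close> coordinates, with both \<open>a\<close> and \<open>b\<close> on
  moment curves. Multiplication by the Koszul coefficients is contraction of a \<open>(p+1)\<close>-form by \<open>a\<close>.
  Contracting a relation among the columns by \<open>p\<close> of the vectors \<open>a\<close> and pairing with a polynomial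
  vanishing at the remaining points yields a bilinear form on polynomials of degree at most \<open>p\<close> and
  \<open>q - 1 - p\<close> which kills all products splitting over the points; such a form is a combination of
  evaluations at the diagonal points, and this forces the relation to be trivial.
\<close>

section \<open>Column independence and genericity\<close>

text \<open>The block size \<open>q - 1\<close> comes from a count. As
  \<open>(q - p) * (q choose p) = q * ((q - 1) choose p)\<close>, a run of \<open>q - p\<close>
  coordinates of \<open>b\<close> gives \<open>q * ((q - 1) choose p) - (q - p) * (p + 1)\<close>
  rows of \<open>N\<close>, while \<open>s\<close> indices give
  \<open>s * (((q - 1) choose p) - 1)\<close> columns. For \<open>s = q\<close> the rows would be
  too few by \<open>p * (q - p - 1)\<close>. The obstacle is that \<open>N\<close> omits the rows
  with \<open>S \<subseteq> {1..p+1}\<close>: a kernel vector yields sums of contractions that need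
  not vanish there. The residue turns out to be a multiple, summand by summand, of a contraction of
  the determinant form of the first \<open>p + 1\<close> coordinates, and the absence of the columns
  \<open>U = {1..p+1}\<close> is what rules such multiples out. The value of \<open>p\<close>
  balances \<open>n2 / (q - p)\<close> against \<open>n3 / (p + 1)\<close>, the numbers of blocks
  available to \<open>N\<close> and \<open>N'\<close>. Both are close to
  \<open>(n2 + n3) / q\<close>, which explains the shape of the bound on \<open>r\<close>; the term
  \<open>q ^ 3 / 4\<close> pays for rounding.\<close>

definition col_indep :: "'i set \<Rightarrow> 'j set \<Rightarrow> ('i \<Rightarrow> 'j \<Rightarrow> real) \<Rightarrow> bool" where
  "col_indep R C A \<longleftrightarrow>
     (\<forall>y. (\<forall>i\<in>R. (\<Sum>j\<in>C. A i j * y j) = 0) \<longrightarrow> (\<forall>j\<in>C. y j = 0))"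

lemma col_indepI:
  "(\<And>y j. (\<And>i. i \<in> R \<Longrightarrow> (\<Sum>j\<in>C. A i j * y j) = 0) \<Longrightarrow> j \<in> C \<Longrightarrow> y j = 0) \<Longrightarrow> col_indep R C A"
  unfolding col_indep_def by blast

lemma col_indepD:
  "col_indep R C A \<Longrightarrow> (\<And>i. i \<in> R \<Longrightarrow> (\<Sum>j\<in>C. A i j * y j) = 0) \<Longrightarrow> j \<in> C \<Longrightarrow> y j = 0"
  unfolding col_indep_def by blast

lemma sum_fun_apply: "(\<Sum>i\<in>I. f i) x = (\<Sum>i\<in>I. f i x)" for f :: "'a \<Rightarrow> 'b \<Rightarrow> real"
  by (induction I rule: infinite_finite_induct) auto

lemma lin_indep_family_mat_col:
  assumes "finite C" "col_indep R C A"
  shows "lin_indep_family C (mat_col R A)"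
proof -
  have inj: "inj_on (mat_col R A) C"
  proof (rule inj_onI, rule ccontr)
    fix k l assume kl: "k \<in> C" "l \<in> C" "mat_col R A k = mat_col R A l" "k \<noteq> l"
    define y where "y j = (if j = k then 1 else if j = l then -1 else (0::real))" for j
    have "(\<Sum>j\<in>C. A i j * y j) = 0" if "i \<in> R" for i
    proof -
      have "(\<Sum>j\<in>C. A i j * y j) = (\<Sum>j\<in>{k,l}. A i j * y j)"
        by (rule sum.mono_neutral_right) (use assms(1) kl in \<open>auto simp: y_def\<close>)
      also have "\<dots> = 0"
        using kl(4) fun_cong[OF kl(3), of i] that by (auto simp: y_def mat_col_def)
      finally show ?thesis .
    qed
    then have "y k = 0" using col_indepD[OF assms(2)] kl by blast
    then show False by (simp add: y_def)
  qed
  have "fun_space.independent (mat_col R A ` C)"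
  proof (rule fun_space.independent_if_scalars_zero)
    fix u v assume z: "(\<Sum>x\<in>mat_col R A ` C. (\<lambda>i. u x * x i)) = 0" and v: "v \<in> mat_col R A ` C"
    have "(\<Sum>j\<in>C. A i j * u (mat_col R A j)) = 0" if "i \<in> R" for i
    proof -
      have "(\<Sum>x\<in>mat_col R A ` C. u x * x i) = 0"
        using fun_cong[OF z, of i] by (simp add: sum_fun_apply)
      then have "(\<Sum>j\<in>C. u (mat_col R A j) * mat_col R A j i) = 0"
        by (simp add: sum.reindex[OF inj])
      then show ?thesis using that by (simp add: mat_col_def mult.commute)
    qed
    then show "u v = 0" using col_indepD[OF assms(2), of "\<lambda>j. u (mat_col R A j)"] v by blast
  qed (use assms in auto)
  with inj show ?thesis by (simp add: lin_indep_family_def)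
qed

lemma full_column_rank_if_col_indep:
  assumes "finite C" "col_indep R C A"
  shows "full_column_rank R C A"
  using lin_indep_family_mat_col[OF assms] fun_space.dim_eq_card_independent[of "mat_col R A ` C"]
  by (auto simp: full_column_rank_def mat_rank_def lin_indep_family_def card_image)

lemma col_indep_pivot:
  assumes "col_indep R C A" "c \<in> C" "finite C"
  obtains \<rho> where "\<rho> \<in> R" "A \<rho> c \<noteq> 0"
proof (rule ccontr)
  assume "\<not> thesis"
  with that have z: "A i c = 0" if "i \<in> R" for i using that by blast
  have "(\<Sum>j\<in>C. A i j * of_bool (j = c)) = 0" if "i \<in> R" for i
    by (rule sum.neutral) (use z[OF that] in auto)
  from col_indepD[OF assms(1) this assms(2)] show False by auto
qed

text \<open>One step of fraction-free Gaussian elimination: no division occurs, so polynomial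
  entries stay polynomial. The pivot row turns into a zero row and can therefore be kept in
  \<open>R\<close>.\<close>

lemma col_indep_eliminate:
  assumes "finite C" "c \<notin> C" "\<rho> \<in> R" "A \<rho> c \<noteq> 0"
  shows "col_indep R (insert c C) A \<longleftrightarrow>
    col_indep R C (\<lambda>i j. A \<rho> c * A i j - A i c * A \<rho> j)" (is "?l \<longleftrightarrow> ?r")
proof
  assume l: ?l
  show ?r
  proof (rule col_indepI)
    fix y k assume y: "\<And>i. i \<in> R \<Longrightarrow> (\<Sum>j\<in>C. (A \<rho> c * A i j - A i c * A \<rho> j) * y j) = 0"
      and k: "k \<in> C"
    \<comment> \<open>Scaling by the pivot avoids a division; the entry at \<open>c\<close> is what
      row \<open>\<rho>\<close> demands.\<close>
    define y' where "y' = (\<lambda>j. A \<rho> c * y j)(c := - (\<Sum>j\<in>C. A \<rho> j * y j))"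
    have "(\<Sum>j\<in>insert c C. A i j * y' j) = 0" if "i \<in> R" for i
    proof -
      have "(\<Sum>j\<in>C. A i j * y' j) = (\<Sum>j\<in>C. A \<rho> c * A i j * y j)"
        by (rule sum.cong) (use assms in \<open>auto simp: y'_def\<close>)
      then have "(\<Sum>j\<in>insert c C. A i j * y' j) =
          (\<Sum>j\<in>C. A \<rho> c * A i j * y j) - A i c * (\<Sum>j\<in>C. A \<rho> j * y j)"
        using assms by (simp add: y'_def)
      also have "\<dots> = 0"
        using y[OF that] by (simp add: left_diff_distrib sum_subtractf sum_distrib_left mult.assoc)
      finally show ?thesis .
    qed
    from col_indepD[OF l this, of k] k assms show "y k = 0" by (auto simp: y'_def split: if_splits)
  qed
next
  assume r: ?r
  show ?l
  proof (rule col_indepI)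
    fix y k assume y: "\<And>i. i \<in> R \<Longrightarrow> (\<Sum>j\<in>insert c C. A i j * y j) = 0" and k: "k \<in> insert c C"
    have s: "(\<Sum>j\<in>C. A i j * y j) = - A i c * y c" if "i \<in> R" for i
      using y[OF that] assms by simp
    have "(\<Sum>j\<in>C. (A \<rho> c * A i j - A i c * A \<rho> j) * y j) = 0" if "i \<in> R" for i
    proof -
      have "(\<Sum>j\<in>C. (A \<rho> c * A i j - A i c * A \<rho> j) * y j) =
          A \<rho> c * (\<Sum>j\<in>C. A i j * y j) - A i c * (\<Sum>j\<in>C. A \<rho> j * y j)"
        by (simp add: left_diff_distrib sum_subtractf sum_distrib_left mult.assoc)
      also have "\<dots> = 0" using s that assms(3) by simp
      finally show ?thesis .
    qed
    then have z: "y j = 0" if "j \<in> C" for j using col_indepD[OF r] that by blast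
    then have "y c = 0" using s[OF assms(3)] assms(4) by simp
    with z k show "y k = 0" by auto
  qed
qed

text \<open>Injectivity of a matrix is surjectivity of its transpose. In this dual form,
  independence on the \<open>M'\<close> side can be used to recover the columns of the first factor
  of \<open>M\<close> from those of \<open>M\<close>.\<close>

lemma col_indep_solve:
  assumes "finite R" "finite C" "col_indep R C A"
  shows "\<exists>w. \<forall>j\<in>C. (\<Sum>i\<in>R. w i * A i j) = z j"
  using assms(2,3)
proof (induction C arbitrary: A z)
  case (insert c C)
  obtain \<rho> where \<rho>: "\<rho> \<in> R" "A \<rho> c \<noteq> 0"
    using col_indep_pivot[OF insert.prems, of c] insert.hyps by auto
  let ?A = "\<lambda>i j. A \<rho> c * A i j - A i c * A \<rho> j"
  have "col_indep R C ?A" using col_indep_eliminate[of C c \<rho> R A] insert \<rho> by simp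
  \<comment> \<open>The right-hand side is what elimination makes of \<open>z\<close> when
    \<open>z\<close> is treated as a further row.\<close>
  from insert.IH[OF this, of "\<lambda>j. A \<rho> c * z j - z c * A \<rho> j"]
  obtain w where w: "\<And>j. j \<in> C \<Longrightarrow> (\<Sum>i\<in>R. w i * ?A i j) = A \<rho> c * z j - z c * A \<rho> j" by blast
  \<comment> \<open>The reduced system says nothing about column \<open>c\<close>; adding
    \<open>t\<close> times the pivot row repairs that column and turns the reduced equations into
    the original ones.\<close>
  define t where "t = (z c - (\<Sum>i\<in>R. w i * A i c)) / A \<rho> c"
  define w' where "w' i = w i + of_bool (i = \<rho>) * t" for i
  have w': "(\<Sum>i\<in>R. w' i * A i j) = (\<Sum>i\<in>R. w i * A i j) + t * A \<rho> j" for j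
  proof -
    have "(\<Sum>i\<in>R. of_bool (i = \<rho>) * t * A i j) = (\<Sum>i\<in>{\<rho>}. of_bool (i = \<rho>) * t * A i j)"
      by (rule sum.mono_neutral_right) (use assms \<rho> in auto)
    then show ?thesis by (simp add: w'_def distrib_right sum.distrib)
  qed
  have "(\<Sum>i\<in>R. w' i * A i j) = z j" if "j \<in> insert c C" for j
  proof (cases "j = c")
    case True
    then show ?thesis using \<rho> by (simp add: w' t_def)
  next
    case False
    then have "A \<rho> c * (\<Sum>i\<in>R. w i * A i j) - (\<Sum>i\<in>R. w i * A i c) * A \<rho> j = A \<rho> c * z j - z c * A \<rho> j"
      using w[of j] that
      by (simp add: right_diff_distrib sum_subtractf sum_distrib_left sum_distrib_right mult_ac)
    then have "A \<rho> c * ((\<Sum>i\<in>R. w i * A i j) + t * A \<rho> j) = A \<rho> c * z j"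
      using \<rho> by (simp add: t_def field_simps)
    then show ?thesis using \<rho> by (simp add: w')
  qed
  then show ?case by blast
qed simp

section \<open>Polynomial functions, their monomial expansions, and genericity\<close>

inductive polyfun :: "'v set \<Rightarrow> (('v \<Rightarrow> real) \<Rightarrow> real) \<Rightarrow> bool" for V where
  const: "polyfun V (\<lambda>x. c)"
| var: "v \<in> V \<Longrightarrow> polyfun V (\<lambda>x. x v)"
| add: "polyfun V f \<Longrightarrow> polyfun V g \<Longrightarrow> polyfun V (\<lambda>x. f x + g x)"
| mult: "polyfun V f \<Longrightarrow> polyfun V g \<Longrightarrow> polyfun V (\<lambda>x. f x * g x)"

lemma polyfun_diff: "polyfun V f \<Longrightarrow> polyfun V g \<Longrightarrow> polyfun V (\<lambda>x. f x - g x)"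
  using polyfun.add[OF _ polyfun.mult[OF polyfun.const[of V "-1"]], of f g] by simp

lemma polyfun_sum: "(\<And>i. i \<in> I \<Longrightarrow> polyfun V (f i)) \<Longrightarrow> polyfun V (\<lambda>x. \<Sum>i\<in>I. f i x)"
  by (induction I rule: infinite_finite_induct) (auto intro: polyfun.intros)

definition mon_eval :: "('v \<Rightarrow>\<^sub>0 nat) \<Rightarrow> ('v \<Rightarrow> real) \<Rightarrow> real" where
  "mon_eval m x = (\<Prod>v\<in>Poly_Mapping.keys m. x v ^ Poly_Mapping.lookup m v)"

lemma mon_eval_superset:
  "finite A \<Longrightarrow> Poly_Mapping.keys m \<subseteq> A \<Longrightarrow> mon_eval m x = (\<Prod>v\<in>A. x v ^ Poly_Mapping.lookup m v)"
  unfolding mon_eval_def by (rule prod.mono_neutral_left) (auto simp: in_keys_iff)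

lemma mon_eval_add: "mon_eval (m + n) x = mon_eval m x * mon_eval n x"
proof -
  let ?A = "Poly_Mapping.keys m \<union> Poly_Mapping.keys n"
  have "mon_eval (m + n) x = (\<Prod>v\<in>?A. x v ^ Poly_Mapping.lookup (m + n) v)"
    by (rule mon_eval_superset) (use keys_add[of m n] in auto)
  also have "\<dots> = mon_eval m x * mon_eval n x"
    by (simp add: mon_eval_superset[of ?A] lookup_add power_add prod.distrib)
  finally show ?thesis .
qed

lemma mp_eval_superset:
  "finite A \<Longrightarrow> Poly_Mapping.keys F \<subseteq> A \<Longrightarrow>
    mp_eval F x = (\<Sum>m\<in>A. Poly_Mapping.lookup F m * mon_eval m x)"
  unfolding mp_eval_def mon_eval_def[symmetric]
  by (rule sum.mono_neutral_left) (auto simp: in_keys_iff)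

lemma mp_eval_0 [simp]: "mp_eval 0 x = 0"
  by (simp add: mp_eval_def)

lemma mp_eval_add: "mp_eval (F + G) x = mp_eval F x + mp_eval G x"
proof -
  let ?A = "Poly_Mapping.keys F \<union> Poly_Mapping.keys G"
  have "mp_eval (F + G) x = (\<Sum>m\<in>?A. Poly_Mapping.lookup (F + G) m * mon_eval m x)"
    by (rule mp_eval_superset) (use keys_add[of F G] in auto)
  also have "\<dots> = mp_eval F x + mp_eval G x"
    by (simp add: mp_eval_superset[of ?A] lookup_add distrib_right sum.distrib)
  finally show ?thesis .
qed

lemma mp_eval_sum: "mp_eval (\<Sum>i\<in>I. F i) x = (\<Sum>i\<in>I. mp_eval (F i) x)"
  by (induction I rule: infinite_finite_induct) (auto simp: mp_eval_add)

lemma mp_eval_single: "mp_eval (Poly_Mapping.single m c) x = c * mon_eval m x"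
  by (subst mp_eval_superset[of "{m}"]) auto

lemma mpolynomial_sum_monomials:
  "F = (\<Sum>m\<in>Poly_Mapping.keys F. Poly_Mapping.single m (Poly_Mapping.lookup F m))"
proof (rule poly_mapping_eqI)
  fix k
  have "(\<Sum>m\<in>Poly_Mapping.keys F. Poly_Mapping.lookup F m when m = k) =
      (\<Sum>m\<in>Poly_Mapping.keys F. if m = k then Poly_Mapping.lookup F m else 0)"
    by (intro sum.cong) (auto simp: when_def)
  also have "\<dots> = Poly_Mapping.lookup F k"
    by (simp add: sum.delta in_keys_iff)
  finally show "Poly_Mapping.lookup F k =
    Poly_Mapping.lookup (\<Sum>m\<in>Poly_Mapping.keys F. Poly_Mapping.single m (Poly_Mapping.lookup F m)) k"
    by (simp add: lookup_sum lookup_single)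
qed

lemma mp_eval_mult: "mp_eval (F * G) x = mp_eval F x * mp_eval G x"
proof -
  let ?s = "\<lambda>F m. Poly_Mapping.single m (Poly_Mapping.lookup F m)"
  have "F * G = (\<Sum>m\<in>Poly_Mapping.keys F. \<Sum>n\<in>Poly_Mapping.keys G. ?s F m * ?s G n)"
    by (subst (1) mpolynomial_sum_monomials[of F], subst (1) mpolynomial_sum_monomials[of G])
      (rule sum_product)
  then have "mp_eval (F * G) x = (\<Sum>m\<in>Poly_Mapping.keys F. \<Sum>n\<in>Poly_Mapping.keys G.
      (Poly_Mapping.lookup F m * mon_eval m x) * (Poly_Mapping.lookup G n * mon_eval n x))"
    by (simp add: mp_eval_sum mult_single mp_eval_single mon_eval_add mult_ac)
  also have "\<dots> = mp_eval F x * mp_eval G x"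
    unfolding mp_eval_def mon_eval_def[symmetric] by (rule sum_product[symmetric])
  finally show ?thesis .
qed

lemma mp_vars_add: "mp_vars (F + G) \<subseteq> mp_vars F \<union> mp_vars G"
  unfolding mp_vars_def using keys_add[of F G] by blast

lemma mp_vars_mult: "mp_vars (F * G) \<subseteq> mp_vars F \<union> mp_vars G"
proof
  fix v assume "v \<in> mp_vars (F * G)"
  then obtain m where "m \<in> Poly_Mapping.keys (F * G)" "v \<in> Poly_Mapping.keys m"
    by (auto simp: mp_vars_def)
  then obtain m1 m2 where "m1 \<in> Poly_Mapping.keys F" "m2 \<in> Poly_Mapping.keys G"
    "v \<in> Poly_Mapping.keys (m1 + m2)" using keys_mult[of F G] by blast
  then show "v \<in> mp_vars F \<union> mp_vars G" using keys_add[of m1 m2] by (auto simp: mp_vars_def)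
qed

lemma polyfun_imp_mpolynomial:
  "polyfun V f \<Longrightarrow> \<exists>F. mp_vars F \<subseteq> V \<and> (\<forall>x. mp_eval F x = f x)"
proof (induction rule: polyfun.induct)
  case (const c)
  show ?case
    by (rule exI[of _ "Poly_Mapping.single 0 c"])
      (auto simp: mp_eval_single mon_eval_def mp_vars_def split: if_splits)
next
  case (var v)
  then show ?case
    by (intro exI[of _ "Poly_Mapping.single (Poly_Mapping.single v 1) 1"])
      (auto simp: mp_eval_single mon_eval_def mp_vars_def split: if_splits)
next
  case (add f g)
  then obtain F G where "mp_vars F \<subseteq> V" "mp_vars G \<subseteq> V" "\<And>x. mp_eval F x = f x" "\<And>x. mp_eval G x = g x"
    by blast
  then show ?case
    using mp_vars_add[of F G] by (intro exI[of _ "F + G"]) (auto simp: mp_eval_add)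
next
  case (mult f g)
  then obtain F G where "mp_vars F \<subseteq> V" "mp_vars G \<subseteq> V" "\<And>x. mp_eval F x = f x" "\<And>x. mp_eval G x = g x"
    by blast
  then show ?case
    using mp_vars_mult[of F G] by (intro exI[of _ "F * G"]) (auto simp: mp_eval_mult)
qed

lemma polyfun_on_line:
  "polyfun V f \<Longrightarrow> \<exists>P. \<forall>t. poly P t = f (\<lambda>v. u v + t * w v)"
proof (induction rule: polyfun.induct)
  case (const c)
  show ?case by (rule exI[of _ "[:c:]"]) simp
next
  case (var v)
  show ?case by (rule exI[of _ "[:u v, w v:]"]) simp
next
  case (add f g)
  then show ?case by (metis poly_add)
next
  case (mult f g)
  then show ?case by (metis poly_mult)
qed

text \<open>Nonvanishing is recorded by a point where \<open>f\<close> is nonzero, so a witness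
  proves genericity directly, and the associated \<open>mpolynomial\<close> is nonzero because its
  value there is.\<close>

definition holds_generically :: "'v set \<Rightarrow> (('v \<Rightarrow> real) \<Rightarrow> bool) \<Rightarrow> bool" where
  "holds_generically V Q \<longleftrightarrow>
     (\<exists>f. polyfun V f \<and> (\<exists>x. f x \<noteq> 0) \<and> (\<forall>x. f x \<noteq> 0 \<longrightarrow> Q x))"

lemma holds_generically_True: "holds_generically V (\<lambda>x. True)"
  unfolding holds_generically_def using polyfun.const[of V 1] by auto

text \<open>Two polynomial functions that do not vanish at \<open>u\<close> and \<open>w\<close>, respectively, restrict to nonzero
  univariate polynomials on the line through \<open>u\<close> and \<open>w\<close>, hence have a common non-zero there.\<close>

lemma holds_generically_conj:
  assumes "holds_generically V Q" "holds_generically V Q'"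
  shows "holds_generically V (\<lambda>x. Q x \<and> Q' x)"
proof -
  obtain f u where f: "polyfun V f" "f u \<noteq> 0" "\<And>x. f x \<noteq> 0 \<Longrightarrow> Q x"
    using assms(1) unfolding holds_generically_def by blast
  obtain g w where g: "polyfun V g" "g w \<noteq> 0" "\<And>x. g x \<noteq> 0 \<Longrightarrow> Q' x"
    using assms(2) unfolding holds_generically_def by blast
  let ?x = "\<lambda>t v. u v + t * (w v - u v)"
  obtain F where F: "\<And>t. poly F t = f (?x t)" using polyfun_on_line[OF f(1), of u "\<lambda>v. w v - u v"] by blast
  obtain G where G: "\<And>t. poly G t = g (?x t)" using polyfun_on_line[OF g(1), of u "\<lambda>v. w v - u v"] by blast
  have "poly F 0 \<noteq> 0" "poly G 1 \<noteq> 0" using f g by (simp_all add: F G)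
  then have "F * G \<noteq> 0" by auto
  then obtain t where "poly (F * G) t \<noteq> 0" using poly_all_0_iff_0[of "F * G"] by blast
  then have "f (?x t) * g (?x t) \<noteq> 0" by (simp add: F G)
  then show ?thesis
    unfolding holds_generically_def
    by (intro exI[of _ "\<lambda>x. f x * g x"]) (use f g in \<open>auto intro: polyfun.mult\<close>)
qed

lemma holds_generically_ball:
  "finite I \<Longrightarrow> (\<And>i. i \<in> I \<Longrightarrow> holds_generically V (Q i)) \<Longrightarrow>
    holds_generically V (\<lambda>x. \<forall>i\<in>I. Q i x)"
  by (induction I rule: finite_induct)
    (auto simp: holds_generically_True intro: holds_generically_conj)

lemma polyfun_holds_generically:
  "polyfun V f \<Longrightarrow> f u \<noteq> 0 \<Longrightarrow> holds_generically V (\<lambda>x. f x \<noteq> 0)"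
  unfolding holds_generically_def by blast

text \<open>Elimination with pivots chosen at the witness \<open>u\<close> is run on the polynomial
  entries. The product of the pivots, all nonzero at \<open>u\<close>, takes the place of a maximal
  minor, so no determinants are needed.\<close>

lemma col_indep_holds_generically:
  assumes "finite C" "\<And>i j. i \<in> R \<Longrightarrow> j \<in> C \<Longrightarrow> polyfun V (\<lambda>x. A x i j)" "col_indep R C (A u)"
  shows "holds_generically V (\<lambda>x. col_indep R C (A x))"
proof -
  have "\<exists>f. polyfun V f \<and> f u \<noteq> 0 \<and> (\<forall>x. f x \<noteq> 0 \<longrightarrow> col_indep R C (A x))"
    using assms
  proof (induction C arbitrary: A)
    case empty
    show ?case by (rule exI[of _ "\<lambda>x. 1"]) (auto simp: col_indep_def intro: polyfun.const)
  next
    case (insert c C)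
    obtain \<rho> where \<rho>: "\<rho> \<in> R" "A u \<rho> c \<noteq> 0"
      using col_indep_pivot[OF insert.prems(2), of c] insert.hyps by auto
    let ?A = "\<lambda>x i j. A x \<rho> c * A x i j - A x i c * A x \<rho> j"
    have "col_indep R C (?A u)" using col_indep_eliminate[of C c \<rho> R "A u"] insert \<rho> by simp
    moreover have "polyfun V (\<lambda>x. ?A x i j)" if "i \<in> R" "j \<in> C" for i j
      using that \<rho> by (intro polyfun_diff polyfun.mult insert.prems(1)) auto
    ultimately obtain f where f: "polyfun V f" "f u \<noteq> 0" "\<And>x. f x \<noteq> 0 \<Longrightarrow> col_indep R C (?A x)"
      using insert.IH[of ?A] by blast
    have "polyfun V (\<lambda>x. f x * A x \<rho> c)"
      using f(1) \<rho> by (intro polyfun.mult insert.prems(1)) auto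
    moreover have "col_indep R (insert c C) (A x)" if "f x * A x \<rho> c \<noteq> 0" for x
      using col_indep_eliminate[of C c \<rho> R "A x"] insert.hyps \<rho> f(3) that by simp
    ultimately show ?case using f(2) \<rho>(2)
      by (intro exI[of _ "\<lambda>x. f x * A x \<rho> c"]) auto
  qed
  then show ?thesis unfolding holds_generically_def by blast
qed

lemma generically_if_holds_generically:
  assumes "holds_generically (coords n1 n2 n3 r) Q"
    and "\<And>a b c. Q (coord_val a b c) \<Longrightarrow> Q' a b c"
  shows "generically n1 n2 n3 r Q'"
proof -
  obtain f u where f: "polyfun (coords n1 n2 n3 r) f" "f u \<noteq> 0" "\<And>x. f x \<noteq> 0 \<Longrightarrow> Q x"
    using assms(1) unfolding holds_generically_def by blast
  obtain F where F: "mp_vars F \<subseteq> coords n1 n2 n3 r" "\<And>x. mp_eval F x = f x"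
    using polyfun_imp_mpolynomial[OF f(1)] by blast
  from f(2) have "F \<noteq> 0" by (auto simp flip: F(2))
  then show ?thesis
    unfolding generically_def using F f(3) assms(2) by (intro exI[of _ F]) auto
qed

section \<open>Bilinear forms on polynomials and contractions of forms\<close>

definition root_poly :: "real set \<Rightarrow> real poly" where
  "root_poly S = (\<Prod>x\<in>S. [:- x, 1:])"

lemma root_poly_empty [simp]: "root_poly {} = 1"
  by (simp add: root_poly_def)

lemma root_poly_insert: "finite S \<Longrightarrow> x \<notin> S \<Longrightarrow> root_poly (insert x S) = [:- x, 1:] * root_poly S"
  by (simp add: root_poly_def)

lemma poly_root_poly_eq_0_iff: "finite S \<Longrightarrow> poly (root_poly S) t = 0 \<longleftrightarrow> t \<in> S"
  by (auto simp: root_poly_def poly_prod)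

lemma degree_root_poly: "finite S \<Longrightarrow> degree (root_poly S) = card S"
  unfolding root_poly_def by (subst degree_prod_eq_sum_degree) auto

lemma lead_coeff_root_poly: "finite S \<Longrightarrow> coeff (root_poly S) (card S) = 1"
  using lead_coeff_prod[of "\<lambda>x. [:- x, 1:]" S] degree_root_poly[of S] by (simp add: root_poly_def)

text \<open>The \<open>w i\<close> are the coefficients of a polynomial of degree below
  \<open>n\<close> with at least \<open>n\<close> roots.\<close>

lemma vandermonde_zero:
  fixes w :: "nat \<Rightarrow> real"
  assumes "finite Q" "n \<le> card Q" "\<And>t. t \<in> Q \<Longrightarrow> (\<Sum>i=1..n. w i * t ^ (i - 1)) = 0" "i \<in> {1..n}"
  shows "w i = 0"
proof -
  define e where "e = (\<Sum>i=1..n. monom (w i) (i - 1))"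
  have "degree e < n"
    unfolding e_def by (rule degree_sum_less) (use assms(4) in \<open>auto intro: le_less_trans[OF degree_monom_le]\<close>)
  have ce: "coeff e (i - 1) = w i"
  proof -
    have "coeff e (i - 1) = (\<Sum>j=1..n. if j = i then w j else 0)"
      unfolding e_def coeff_sum coeff_monom using assms(4) by (intro sum.cong) auto
    then show ?thesis using assms(4) by simp
  qed
  have "e = 0"
  proof (rule ccontr)
    assume "e \<noteq> 0"
    have "Q \<subseteq> {t. poly e t = 0}"
      using assms(3) by (auto simp: e_def poly_sum poly_monom)
    then have "card Q \<le> degree e"
      using card_mono[OF poly_roots_finite[OF \<open>e \<noteq> 0\<close>], of Q] card_poly_roots_bound[OF \<open>e \<noteq> 0\<close>]
      by linarith
    with \<open>degree e < n\<close> assms(2) show False by simp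
  qed
  with ce show ?thesis by simp
qed

definition bilinear_form :: "(real poly \<Rightarrow> real poly \<Rightarrow> real) \<Rightarrow> bool" where
  "bilinear_form G \<longleftrightarrow>
     (\<forall>f f' h. G (f + f') h = G f h + G f' h) \<and> (\<forall>c f h. G (smult c f) h = c * G f h) \<and>
     (\<forall>f h h'. G f (h + h') = G f h + G f h') \<and> (\<forall>c f h. G f (smult c h) = c * G f h)"

lemma bilinear_formD:
  assumes "bilinear_form G"
  shows "G (f + f') h = G f h + G f' h" "G (smult c f) h = c * G f h"
    "G f (h + h') = G f h + G f h'" "G f (smult c h) = c * G f h" "G 0 h = 0" "G f 0 = 0"
proof -
  show "G (f + f') h = G f h + G f' h" "G (smult c f) h = c * G f h"
    "G f (h + h') = G f h + G f h'" "G f (smult c h) = c * G f h"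
    using assms unfolding bilinear_form_def by blast+
  have "G (smult 0 f) h = 0 * G f h" "G f (smult 0 h) = 0 * G f h"
    using assms unfolding bilinear_form_def by blast+
  then show "G 0 h = 0" "G f 0 = 0" by simp_all
qed

lemma bilinear_form_flip: "bilinear_form G \<Longrightarrow> bilinear_form (\<lambda>f h. G h f)"
  unfolding bilinear_form_def by blast

lemma bilinear_form_mult_left: "bilinear_form G \<Longrightarrow> bilinear_form (\<lambda>f. G (e * f))"
  unfolding bilinear_form_def by (simp add: distrib_left)

text \<open>The kernel of the evaluation map on bidegree \<open>(u, v)\<close> polynomials at the diagonal points
  \<open>(x, x)\<close>, \<open>x \<in> P\<close>, is spanned by the split products; this is the dual formulation.\<close>

lemma bilinear_form_diagonal:
  assumes "finite P" "bilinear_form G" "u + v = card P"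
    and "\<And>S R. S \<union> R = P \<Longrightarrow> S \<inter> R = {} \<Longrightarrow> card S = u \<Longrightarrow> card R = v \<Longrightarrow>
      G (root_poly S) (root_poly R) = 0"
  shows "\<exists>\<theta>. \<forall>f h. degree f \<le> u \<longrightarrow> degree h \<le> v \<longrightarrow>
    G f h = (\<Sum>x\<in>P. \<theta> x * poly f x * poly h x)"
  using assms
proof (induction P arbitrary: G u v)
  case empty
  have z: "G 1 1 = 0" using empty.prems(3)[of "{}" "{}"] empty.prems by simp
  have "G f h = 0" if fh: "degree f \<le> u" "degree h \<le> v" for f h
  proof -
    obtain c d where "f = smult c 1" "h = smult d 1"
      using fh empty.prems(2) by (auto elim!: degree_eq_zeroE)
    then show ?thesis using z by (simp only: bilinear_formD[OF empty.prems(1)] mult_zero_right)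
  qed
  then show ?case by simp
next
  case (insert z P)
  have left: "\<exists>\<mu>. \<forall>f h. degree f \<le> u \<longrightarrow> poly f z = 0 \<longrightarrow> degree h \<le> v \<longrightarrow>
      G f h = (\<Sum>x\<in>P. \<mu> x * poly f x * poly h x)"
    if G: "bilinear_form G" "u + v = card (insert z P)"
      "\<And>S R. S \<union> R = insert z P \<Longrightarrow> S \<inter> R = {} \<Longrightarrow> card S = u \<Longrightarrow> card R = v \<Longrightarrow>
        G (root_poly S) (root_poly R) = 0" for G u v
  proof (cases u)
    case 0
    have "f = 0" if "degree f \<le> u" "poly f z = 0" for f
      using that 0 by (auto elim!: degree_eq_zeroE)
    then show ?thesis by (metis (no_types, lifting) bilinear_formD(5)[OF G(1)] mult_zero_left mult_zero_right poly_0 sum.neutral)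
  next
    case (Suc u')
    \<comment> \<open>Dividing \<open>x - z\<close> out of \<open>f\<close> lowers the bidegree to
      \<open>(u - 1, v)\<close> on the remaining points; a split of \<open>P\<close> becomes a split
      of \<open>insert z P\<close> by putting \<open>z\<close> into \<open>S\<close>.\<close>
    define G' where "G' f = G ([:- z, 1:] * f)" for f
    have "\<exists>\<theta>. \<forall>f h. degree f \<le> u' \<longrightarrow> degree h \<le> v \<longrightarrow> G' f h = (\<Sum>x\<in>P. \<theta> x * poly f x * poly h x)"
    proof (rule insert.IH)
      show "bilinear_form G'" unfolding G'_def by (rule bilinear_form_mult_left[OF G(1)])
      show "u' + v = card P" using G(2) Suc insert.hyps by simp
      fix S R assume SR: "S \<union> R = P" "S \<inter> R = {}" "card S = u'" "card R = v"
      then have fin: "finite S" "z \<notin> S" "z \<notin> R" using insert.hyps by auto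
      have "G (root_poly (insert z S)) (root_poly R) = 0"
        using SR fin Suc by (intro G(3)) auto
      then show "G' (root_poly S) (root_poly R) = 0"
        by (simp only: G'_def root_poly_insert[OF fin(1,2)])
    qed
    then obtain \<theta> where \<theta>: "\<And>f h. degree f \<le> u' \<Longrightarrow> degree h \<le> v \<Longrightarrow>
        G' f h = (\<Sum>x\<in>P. \<theta> x * poly f x * poly h x)" by blast
    show ?thesis
    proof (intro exI[of _ "\<lambda>x. \<theta> x / (x - z)"] allI impI)
      fix f h :: "real poly" assume fh: "degree f \<le> u" "poly f z = 0" "degree h \<le> v"
      then obtain f' where f': "f = [:- z, 1:] * f'" by (auto simp: poly_eq_0_iff_dvd)
      have "degree f' \<le> u'"
      proof (cases "f' = 0")
        case False
        then have "degree f = Suc (degree f')" unfolding f' by (subst degree_mult_eq) auto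
        then show ?thesis using fh Suc by simp
      qed simp
      then have "G f h = (\<Sum>x\<in>P. \<theta> x * poly f' x * poly h x)"
        using \<theta>[of f' h] fh by (simp only: G'_def f')
      also have "\<dots> = (\<Sum>x\<in>P. \<theta> x / (x - z) * poly f x * poly h x)"
      proof (rule sum.cong[OF refl])
        fix x assume "x \<in> P"
        then have "x - z \<noteq> 0" using insert.hyps by auto
        moreover have "poly f x = (x - z) * poly f' x" by (simp add: f' algebra_simps)
        ultimately show "\<theta> x * poly f' x * poly h x = \<theta> x / (x - z) * poly f x * poly h x"
          by simp
      qed
      finally show "G f h = (\<Sum>x\<in>P. \<theta> x / (x - z) * poly f x * poly h x)" .
    qed
  qed
  obtain \<mu> where \<mu>: "\<And>f h. degree f \<le> u \<Longrightarrow> poly f z = 0 \<Longrightarrow> degree h \<le> v \<Longrightarrow>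
      G f h = (\<Sum>x\<in>P. \<mu> x * poly f x * poly h x)"
    using left[OF insert.prems] by blast
  \<comment> \<open>The mirror statement, for \<open>h\<close> with root \<open>z\<close>, comes
    from swapping the arguments of \<open>G\<close>.\<close>
  have "\<exists>\<nu>. \<forall>h f. degree h \<le> v \<longrightarrow> poly h z = 0 \<longrightarrow> degree f \<le> u \<longrightarrow>
      G f h = (\<Sum>x\<in>P. \<nu> x * poly h x * poly f x)"
    using left[OF bilinear_form_flip[OF insert.prems(1)], of v u] insert.prems(2,3)
    by (simp add: Un_commute Int_commute add.commute)
  then obtain \<nu> where \<nu>: "\<And>f h. degree f \<le> u \<Longrightarrow> poly h z = 0 \<Longrightarrow> degree h \<le> v \<Longrightarrow>
      G f h = (\<Sum>x\<in>P. \<nu> x * poly f x * poly h x)"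
    by (auto simp: mult_ac)
  \<comment> \<open>The two representations have to be reconciled. If \<open>u\<close> or
    \<open>v\<close> is \<open>0\<close>, there is no room for a root at \<open>z\<close> in both
    factors, but a constant with root \<open>z\<close> is zero, so one representation
    suffices.\<close>
  have "\<exists>\<kappa>. \<forall>f h. degree f \<le> u \<longrightarrow> degree h \<le> v \<longrightarrow> poly f z = 0 \<or> poly h z = 0 \<longrightarrow>
      G f h = (\<Sum>x\<in>P. \<kappa> x * poly f x * poly h x)"
  proof (cases "u = 0 \<or> v = 0")
    case True
    have zero: "f = 0" if "degree f = 0" "poly f z = 0" for f :: "real poly"
      using that by (auto elim!: degree_eq_zeroE)
    from True show ?thesis
    proof
      assume "u = 0"
      show ?thesis
      proof (intro exI[of _ \<nu>] allI impI)
        fix f h :: "real poly"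
        assume fh: "degree f \<le> u" "degree h \<le> v" "poly f z = 0 \<or> poly h z = 0"
        show "G f h = (\<Sum>x\<in>P. \<nu> x * poly f x * poly h x)"
        proof (cases "poly h z = 0")
          case True
          with fh show ?thesis by (intro \<nu>)
        next
          case False
          then have "f = 0" using zero fh \<open>u = 0\<close> by simp
          then show ?thesis by (simp add: bilinear_formD[OF insert.prems(1)])
        qed
      qed
    next
      assume "v = 0"
      show ?thesis
      proof (intro exI[of _ \<mu>] allI impI)
        fix f h :: "real poly"
        assume fh: "degree f \<le> u" "degree h \<le> v" "poly f z = 0 \<or> poly h z = 0"
        show "G f h = (\<Sum>x\<in>P. \<mu> x * poly f x * poly h x)"
        proof (cases "poly f z = 0")
          case True
          with fh show ?thesis by (intro \<mu>)
        next
          case False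
          then have "h = 0" using zero fh \<open>v = 0\<close> by simp
          then show ?thesis by (simp add: bilinear_formD[OF insert.prems(1)])
        qed
      qed
    qed
  next
    case False
    \<comment> \<open>A pair with a common root at \<open>z\<close> is covered by both
      representations. Distributing the points of \<open>P - {y}\<close> over \<open>f\<close> and
      \<open>h\<close> uses up the degrees exactly and leaves only the term at
      \<open>y\<close>.\<close>
    have "\<nu> y = \<mu> y" if y: "y \<in> P" for y
    proof -
      have "card (P - {y}) = (u - 1) + (v - 1)" using insert.prems(2) insert.hyps y False by simp
      then obtain S where S: "S \<subseteq> P - {y}" "card S = u - 1"
        using obtain_subset_with_card_n[of "u - 1" "P - {y}"] by auto
      define R where "R = P - {y} - S"
      have fin: "finite S" "finite R" "z \<notin> S" "z \<notin> R" "y \<noteq> z"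
        using S insert.hyps y by (auto simp: R_def intro: finite_subset)
      have cR: "card R = v - 1"
        unfolding R_def using S fin \<open>card (P - {y}) = _\<close> by (simp add: card_Diff_subset)
      define f h where "f = root_poly (insert z S)" and "h = root_poly (insert z R)"
      have deg: "degree f \<le> u" "degree h \<le> v" and z0: "poly f z = 0" "poly h z = 0"
        using fin S cR False by (auto simp: f_def h_def degree_root_poly poly_root_poly_eq_0_iff)
      have nz: "poly f y * poly h y \<noteq> 0"
        using fin S by (auto simp: f_def h_def poly_root_poly_eq_0_iff R_def)
      have red: "(\<Sum>x\<in>P. \<kappa> x * poly f x * poly h x) = \<kappa> y * (poly f y * poly h y)" for \<kappa>
      proof -
        have "poly f x * poly h x = 0" if "x \<in> P - {y}" for x
          using that fin by (auto simp: f_def h_def poly_root_poly_eq_0_iff R_def)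
        then have "(\<Sum>x\<in>P. \<kappa> x * (poly f x * poly h x)) = (\<Sum>x\<in>{y}. \<kappa> x * (poly f x * poly h x))"
          using insert.hyps y by (intro sum.mono_neutral_right) auto
        then show ?thesis by (simp add: mult.assoc)
      qed
      show ?thesis using \<mu>[OF deg(1) z0(1) deg(2)] \<nu>[OF deg(1) z0(2) deg(2)] nz by (simp add: red)
    qed
    then have "(\<Sum>x\<in>P. \<nu> x * poly f x * poly h x) = (\<Sum>x\<in>P. \<mu> x * poly f x * poly h x)" for f h
      by simp
    with \<mu> \<nu> show ?thesis by (intro exI[of _ \<mu>]) auto
  qed
  then obtain \<kappa> where \<kappa>: "\<And>f h. degree f \<le> u \<Longrightarrow> degree h \<le> v \<Longrightarrow> poly f z = 0 \<or> poly h z = 0 \<Longrightarrow>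
      G f h = (\<Sum>x\<in>P. \<kappa> x * poly f x * poly h x)" by blast
  \<comment> \<open>Modulo pairs in which one factor has root \<open>z\<close>, only
    \<open>G 1 1\<close> remains; the weight at \<open>z\<close> is fitted to it.\<close>
  define \<kappa>' where "\<kappa>' = \<kappa>(z := G 1 1 - (\<Sum>x\<in>P. \<kappa> x))"
  have "G f h = (\<Sum>x\<in>insert z P. \<kappa>' x * poly f x * poly h x)" if fh: "degree f \<le> u" "degree h \<le> v" for f h
  proof -
    define f0 h0 where "f0 = f - [:poly f z:]" and "h0 = h - [:poly h z:]"
    have deg: "degree f0 \<le> u" "degree h0 \<le> v" "poly f0 z = 0" "poly h0 z = 0"
      using fh by (auto simp: f0_def h0_def intro!: degree_diff_le)
    have f: "f = smult (poly f z) 1 + f0" and h: "h = smult (poly h z) 1 + h0"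
      by (simp_all add: f0_def h0_def)
    have "G f h = poly f z * G 1 h + G f0 h"
      by (subst f, simp only: bilinear_formD[OF insert.prems(1)])
    also have "G 1 h = poly h z * G 1 1 + G 1 h0"
      by (subst h, simp only: bilinear_formD[OF insert.prems(1)])
    also have "G 1 h0 = (\<Sum>x\<in>P. \<kappa> x * poly h0 x)" using \<kappa>[of 1 h0] deg by simp
    also have "G f0 h = (\<Sum>x\<in>P. \<kappa> x * poly f0 x * poly h x)" using \<kappa>[of f0 h] deg fh by simp
    finally have "G f h = poly f z * poly h z * (G 1 1 - (\<Sum>x\<in>P. \<kappa> x)) +
        (\<Sum>x\<in>P. \<kappa> x * (poly f z * poly h z + poly f z * poly h0 x + poly f0 x * poly h x))"
      by (simp add: algebra_simps sum.distrib sum_distrib_left)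
    also have "(\<Sum>x\<in>P. \<kappa> x * (poly f z * poly h z + poly f z * poly h0 x + poly f0 x * poly h x)) =
        (\<Sum>x\<in>P. \<kappa>' x * poly f x * poly h x)"
      by (rule sum.cong) (use insert.hyps in \<open>auto simp: \<kappa>'_def f0_def h0_def algebra_simps\<close>)
    finally show ?thesis using insert.hyps by (simp add: \<kappa>'_def)
  qed
  then show ?case by blast
qed

section \<open>Exterior forms as functions on finite sets, and their interior products with
  vectors\<close>

definition contr :: "nat \<Rightarrow> (nat \<Rightarrow> real) \<Rightarrow> (nat set \<Rightarrow> real) \<Rightarrow> nat set \<Rightarrow> real" where
  "contr q a x S = (\<Sum>i\<in>{1..q} - S. sgn_pos S i * a i * x (insert i S))"

lemma sgn_pos_insert: "i \<notin> S \<Longrightarrow> sgn_pos (insert i S) j = (if i < j then - sgn_pos S j else sgn_pos S j)"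
proof -
  assume "i \<notin> S"
  have "{k \<in> insert i S. k < j} = (if i < j then insert i {k \<in> S. k < j} else {k \<in> S. k < j})" by auto
  then show ?thesis using \<open>i \<notin> S\<close> by (simp add: sgn_pos_def)
qed

lemma sgn_pos_self [simp]: "sgn_pos (insert i S) i = sgn_pos S i"
proof -
  have "{j \<in> insert i S. j < i} = {j \<in> S. j < i}" by auto
  then show ?thesis by (simp add: sgn_pos_def)
qed

lemma sgn_pos_square [simp]: "sgn_pos S i * sgn_pos S i = 1"
  by (simp add: sgn_pos_def flip: power_add mult_2)

lemma sgn_pos_nonzero [simp]: "sgn_pos S i \<noteq> 0"
  by (simp add: sgn_pos_def)

lemma contr_sum:
  "contr q a (\<lambda>S. \<Sum>k\<in>K. c k * x k S) = (\<lambda>S. \<Sum>k\<in>K. c k * contr q a (x k) S)"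
proof
  fix S
  show "contr q a (\<lambda>S. \<Sum>k\<in>K. c k * x k S) S = (\<Sum>k\<in>K. c k * contr q a (x k) S)"
    unfolding contr_def sum_distrib_left
    by (subst (2) sum.swap) (intro sum.cong refl, simp add: mult_ac)
qed

lemma contr_zero [simp]: "contr q a (\<lambda>S. 0) = (\<lambda>S. 0)"
  by (simp add: contr_def fun_eq_iff)

lemma contr_scale: "contr q a (\<lambda>S. c * x S) = (\<lambda>S. c * contr q a x S)"
  by (simp add: contr_def fun_eq_iff sum_distrib_left mult_ac)

lemma contr_minus: "contr q a (\<lambda>S. - x S) = (\<lambda>S. - contr q a x S)"
  using contr_scale[of q a "-1" x] by simp

lemma contr_diff: "contr q a (\<lambda>S. x S - y S) = (\<lambda>S. contr q a x S - contr q a y S)"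
  by (simp add: contr_def fun_eq_iff right_diff_distrib sum_subtractf)

text \<open>Of the two orders of removing \<open>i\<close> and \<open>j\<close>, exactly one flips a
  sign, because exactly one of the two indices lies below the other.\<close>

lemma contr_anticommute: "contr q a (contr q b x) = (\<lambda>S. - contr q b (contr q a x) S)"
proof
  fix S
  let ?J = "{1..q} - S"
  \<comment> \<open>Terms with \<open>i = j\<close> are padded by \<open>0\<close>, so that both
    orders sum over the same square.\<close>
  have expand: "contr q a (contr q b x) S = (\<Sum>i\<in>?J. \<Sum>j\<in>?J. if i = j then 0 else
      sgn_pos S i * sgn_pos (insert i S) j * (a i * b j) * x (insert i (insert j S)))" for a b
  proof -
    have "contr q a (contr q b x) S = (\<Sum>i\<in>?J. \<Sum>j\<in>{1..q} - insert i S.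
        sgn_pos S i * sgn_pos (insert i S) j * (a i * b j) * x (insert i (insert j S)))"
      unfolding contr_def sum_distrib_left
      by (intro sum.cong refl) (simp add: mult_ac insert_commute)
    also have "\<dots> = (\<Sum>i\<in>?J. \<Sum>j\<in>?J. if i = j then 0 else
      sgn_pos S i * sgn_pos (insert i S) j * (a i * b j) * x (insert i (insert j S)))"
      by (intro sum.cong refl sum.mono_neutral_cong_left) auto
    finally show ?thesis .
  qed
  have "contr q b (contr q a x) S = (\<Sum>i\<in>?J. \<Sum>j\<in>?J. if j = i then 0 else
      sgn_pos S j * sgn_pos (insert j S) i * (b j * a i) * x (insert j (insert i S)))"
    by (subst expand) (rule sum.swap)
  moreover have "contr q a (contr q b x) S = (\<Sum>i\<in>?J. \<Sum>j\<in>?J. - (if j = i then 0 else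
      sgn_pos S j * sgn_pos (insert j S) i * (b j * a i) * x (insert j (insert i S))))"
    unfolding expand
    by (intro sum.cong refl) (auto simp: sgn_pos_insert insert_commute mult_ac)
  ultimately show "contr q a (contr q b x) S = - contr q b (contr q a x) S"
    by (simp add: sum_negf)
qed

lemma contr_self: "contr q a (contr q a x) = (\<lambda>S. 0)"
proof
  fix S show "contr q a (contr q a x) S = 0"
    using fun_cong[OF contr_anticommute[of q a a x], of S] by simp
qed

definition form :: "nat \<Rightarrow> nat \<Rightarrow> (nat set \<Rightarrow> real) \<Rightarrow> bool" where
  "form q k x \<longleftrightarrow> (\<forall>S. x S \<noteq> 0 \<longrightarrow> S \<subseteq> {1..q} \<and> card S = k)"

lemma form_contr: assumes "form q (Suc k) x" shows "form q k (contr q a x)"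
  unfolding form_def
proof (intro allI impI)
  fix S assume "contr q a x S \<noteq> 0"
  then have "\<exists>i\<in>{1..q} - S. x (insert i S) \<noteq> 0"
    by (rule contrapos_np) (simp add: contr_def)
  then obtain i where i: "i \<in> {1..q} - S" "x (insert i S) \<noteq> 0" by blast
  then have "insert i S \<subseteq> {1..q}" "card (insert i S) = Suc k"
    using assms unfolding form_def by blast+
  then show "S \<subseteq> {1..q} \<and> card S = k"
    using i finite_subset[of S "{1..q}"] by auto
qed

section \<open>Iterated contractions along the moment curve\<close>

definition mom :: "real \<Rightarrow> nat \<Rightarrow> real" where
  "mom t i = t ^ (i - 1)"

definition contrs :: "nat \<Rightarrow> real list \<Rightarrow> (nat set \<Rightarrow> real) \<Rightarrow> nat set \<Rightarrow> real" where
  "contrs q ts x = foldr (\<lambda>t. contr q (mom t)) ts x"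

lemma contrs_simps [simp]:
  "contrs q [] x = x" "contrs q (t # ts) x = contr q (mom t) (contrs q ts x)"
  by (simp_all add: contrs_def)

lemma contrs_snoc: "contrs q (ts @ [t]) x = contrs q ts (contr q (mom t) x)"
  by (simp add: contrs_def)

lemma contrs_sum:
  "contrs q ts (\<lambda>S. \<Sum>k\<in>K. c k * x k S) = (\<lambda>S. \<Sum>k\<in>K. c k * contrs q ts (x k) S)"
  by (induction ts) (simp_all add: contr_sum)

lemma contrs_scale: "contrs q ts (\<lambda>S. c * x S) = (\<lambda>S. c * contrs q ts x S)"
  by (induction ts) (simp_all add: contr_scale)

lemma contrs_zero [simp]: "contrs q ts (\<lambda>S. 0) = (\<lambda>S. 0)"
  by (induction ts) simp_all

lemma contrs_contr: "contrs q ts (contr q a x) = (\<lambda>S. (-1) ^ length ts * contr q a (contrs q ts x) S)"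
proof (induction ts)
  case (Cons t ts)
  then show ?case
    using contr_anticommute[of q "mom t" a "contrs q ts x"] by (simp add: contr_scale contr_minus)
qed simp

lemma contr_contrs_mem: "t \<in> set ts \<Longrightarrow> contr q (mom t) (contrs q ts x) = (\<lambda>S. 0)"
proof (induction ts)
  case (Cons s ts)
  show ?case
  proof (cases "t = s")
    case True
    then show ?thesis by (simp add: contr_self)
  next
    case False
    then show ?thesis using Cons contr_anticommute[of q "mom t" "mom s" "contrs q ts x"] by simp
  qed
qed simp

lemma contrs_contr_mem: "t \<in> set ts \<Longrightarrow> contrs q ts (contr q (mom t) x) = (\<lambda>S. 0)"
  by (simp add: contrs_contr contr_contrs_mem)

lemma contrs_not_distinct: "\<not> distinct ts \<Longrightarrow> contrs q ts x = (\<lambda>S. 0)"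
  by (induction ts) (auto simp: contr_contrs_mem)

text \<open>Any \<open>q\<close> distinct points of the moment curve give a basis, and a
  \<open>k\<close>-form is determined by its values on basis vectors.\<close>

lemma form_zero_if_contrs_zero:
  assumes "form q k x" "finite Q" "card Q = q"
    and "\<And>ts. set ts \<subseteq> Q \<Longrightarrow> length ts = k \<Longrightarrow> contrs q ts x {} = 0"
  shows "x S = 0"
  using assms(1,4)
proof (induction k arbitrary: x S)
  case 0
  then have "x {} = 0" using 0(2)[of "[]"] by simp
  then show ?case using 0(1) finite_subset[of S "{1..q}"] unfolding form_def by (metis card_0_eq finite_atLeastAtMost)
next
  case (Suc k)
  have z: "contr q (mom t) x T = 0" if t: "t \<in> Q" for t T
  proof (rule Suc.IH)
    show "form q k (contr q (mom t) x)" using Suc.prems(1) by (rule form_contr)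
    show "contrs q ts (contr q (mom t) x) {} = 0" if "set ts \<subseteq> Q" "length ts = k" for ts
      using Suc.prems(2)[of "ts @ [t]"] that t by (simp add: contrs_snoc)
  qed
  show ?case
  proof (rule ccontr)
    assume nz: "x S \<noteq> 0"
    then have S: "S \<subseteq> {1..q}" "card S = Suc k" using Suc.prems(1) unfolding form_def by blast+
    then obtain i where i: "i \<in> S" by fastforce
    define T where "T = S - {i}"
    \<comment> \<open>For fixed \<open>T\<close>, the contraction by \<open>mom t\<close> evaluated
      at \<open>T\<close> is a polynomial in \<open>t\<close> with coefficients \<open>w j\<close>,
      and all points of \<open>Q\<close> are roots.\<close>
    define w where "w j = (if j \<in> T then 0 else sgn_pos T j * x (insert j T))" for j
    have "w i = 0"
    proof (rule vandermonde_zero[OF assms(2)])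
      show "q \<le> card Q" using assms(3) by simp
      show "i \<in> {1..q}" using i S by blast
      fix t assume "t \<in> Q"
      have "(\<Sum>j=1..q. w j * t ^ (j - 1)) = contr q (mom t) x T"
        unfolding contr_def by (rule sum.mono_neutral_cong_right) (auto simp: w_def mom_def mult_ac)
      then show "(\<Sum>j=1..q. w j * t ^ (j - 1)) = 0" using z[OF \<open>t \<in> Q\<close>] by simp
    qed
    then show False using i nz by (simp add: w_def T_def insert_absorb)
  qed
qed

text \<open>The wedge of the first \<open>k\<close> coordinate functionals, that is, the determinant
  of the first \<open>k\<close> coordinates.\<close>

definition top_form :: "nat \<Rightarrow> nat set \<Rightarrow> real" where
  "top_form k S = of_bool (S = {1..k})"

definition unit_vec :: "nat \<Rightarrow> nat \<Rightarrow> real" where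
  "unit_vec i j = of_bool (j = i)"

lemma contr_unit_vec:
  "contr q (unit_vec i) x S = (if i \<in> {1..q} - S then sgn_pos S i * x (insert i S) else 0)"
proof -
  have "contr q (unit_vec i) x S = (\<Sum>j\<in>{1..q} - S. if j = i then sgn_pos S i * x (insert i S) else 0)"
    unfolding contr_def by (rule sum.cong) (auto simp: unit_vec_def)
  then show ?thesis by simp
qed

lemma contr_top_form_expand:
  assumes "k \<le> q"
  shows "contr q w (top_form k) = (\<lambda>S. \<Sum>i=1..k. w i * contr q (unit_vec i) (top_form k) S)"
proof
  fix S
  have "contr q w (top_form k) S = (\<Sum>i=1..q. w i * contr q (unit_vec i) (top_form k) S)"
    unfolding contr_unit_vec unfolding contr_def
    by (rule sum.mono_neutral_cong_left) (auto simp: mult_ac)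
  also have "\<dots> = (\<Sum>i=1..k. w i * contr q (unit_vec i) (top_form k) S)"
    by (rule sum.mono_neutral_right) (use assms in \<open>auto simp: contr_unit_vec top_form_def\<close>)
  finally show "contr q w (top_form k) S = (\<Sum>i=1..k. w i * contr q (unit_vec i) (top_form k) S)" .
qed

lemma contrs_contr_top_form:
  "k \<le> q \<Longrightarrow> contrs q ts (contr q w (top_form k)) {} =
    (\<Sum>i=1..k. w i * contrs q ts (contr q (unit_vec i) (top_form k)) {})"
  by (subst contr_top_form_expand) (simp_all add: contrs_sum)

lemma contr_unit_vec_top_form:
  assumes "Suc k \<le> q"
  shows "contr q (unit_vec (Suc k)) (top_form (Suc k)) = (\<lambda>S. sgn_pos {1..k} (Suc k) * top_form k S)"
proof
  fix S
  have "Suc k \<notin> S \<Longrightarrow> insert (Suc k) S = {1..Suc k} \<longleftrightarrow> S = {1..k}"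
    by (auto simp: atLeastAtMostSuc_conv insert_eq_iff)
  then show "contr q (unit_vec (Suc k)) (top_form (Suc k)) S = sgn_pos {1..k} (Suc k) * top_form k S"
    using assms by (auto simp: contr_unit_vec top_form_def)
qed

text \<open>Up to sign this is a Vandermonde determinant. If it vanished, replacing \<open>t\<close>
  by a variable \<open>s\<close> would give a polynomial of degree below \<open>k\<close> with the
  \<open>k\<close> roots \<open>t # ts\<close>, so its top coefficient, up to sign the value for
  \<open>ts\<close>, would vanish too.\<close>

lemma contrs_top_form_nonzero:
  "distinct ts \<Longrightarrow> length ts = k \<Longrightarrow> k \<le> q \<Longrightarrow> contrs q ts (top_form k) {} \<noteq> 0"
proof (induction ts arbitrary: k)
  case Nil
  then show ?case by (simp add: top_form_def)
next
  case (Cons t ts)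
  then obtain k' where k': "k = Suc k'" "length ts = k'" by auto
  let ?E = "\<lambda>i. contrs q ts (contr q (unit_vec i) (top_form k)) {}"
  have IH: "contrs q ts (top_form k') {} \<noteq> 0" using Cons k' by auto
  show ?case
  proof
    assume "contrs q (t # ts) (top_form k) {} = 0"
    then have t0: "contrs q ts (contr q (mom t) (top_form k)) {} = 0" by (simp add: contrs_contr)
    have "?E k = 0"
    proof (rule vandermonde_zero[where w = ?E and Q = "set (t # ts)" and n = k])
      show "k \<le> card (set (t # ts))" using Cons.prems by (simp add: distinct_card)
      show "k \<in> {1..k}" using k' by simp
      fix s assume "s \<in> set (t # ts)"
      then have "contrs q ts (contr q (mom s) (top_form k)) {} = 0"
        using t0 contrs_contr_mem[of s ts q "top_form k"] by auto
      then show "(\<Sum>i=1..k. ?E i * s ^ (i - 1)) = 0"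
        using contrs_contr_top_form[OF Cons.prems(3), of ts "mom s"] by (simp add: mom_def mult.commute)
    qed simp
    moreover have "?E k = sgn_pos {1..k'} k * contrs q ts (top_form k') {}"
      using contr_unit_vec_top_form[of k' q] Cons.prems(3) k'(1) by (simp add: contrs_scale)
    ultimately show False using IH by simp
  qed
qed

section \<open>The matrix N\<close>

lemma form_top_form: "k \<le> q \<Longrightarrow> form q k (top_form k)"
  by (auto simp: form_def top_form_def)

lemma form_diff_scale: "form q k x \<Longrightarrow> form q k y \<Longrightarrow> form q k (\<lambda>S. x S - c * y S)"
  unfolding form_def by (metis diff_self mult_zero_right)

lemma poly_eq_sum_le: "degree f \<le> d \<Longrightarrow> poly f t = (\<Sum>j\<le>d. coeff f j * t ^ j)" for f :: "real poly"
  unfolding poly_altdef by (rule sum.mono_neutral_left) (auto simp: coeff_eq_0)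

lemma sum_shift_pred: "(\<Sum>i=1..p+1. f (i - 1)) = (\<Sum>j\<le>p. f j)" for f :: "nat \<Rightarrow> real"
  by (rule sum.reindex_bij_witness[of _ Suc "\<lambda>i. i - 1"]) auto

text \<open>If the columns with indices in a block combine to a vector of \<open>p\<close>-forms supported on the
  subsets of \<open>{1..p+1}\<close>, then pairing with products of contractions shows that the associated bilinear
  form kills all split products, so it is diagonal; subtracting the diagonal part, nondegeneracy
  of the contractions along the moment curve forces every summand to vanish.\<close>

lemma block_core:
  assumes "p < q" "finite P" "card P = q - 1"
    and form: "\<And>t. t \<in> P \<Longrightarrow> form q (Suc p) (\<eta> t)"
    and eq: "\<And>j S. j < q - p \<Longrightarrow> S \<subseteq> {1..q} \<Longrightarrow> card S = p \<Longrightarrow> \<not> S \<subseteq> {1..p + 1} \<Longrightarrow>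
      (\<Sum>t\<in>P. t ^ j * contr q (mom t) (\<eta> t) S) = 0"
  shows "\<exists>\<theta>. \<forall>t\<in>P. \<forall>S. contr q (mom t) (\<eta> t) S = \<theta> t * contr q (mom t) (top_form (p + 1)) S"
proof -
  define \<xi> where "\<xi> t = contr q (mom t) (\<eta> t)" for t
  define g where "g h S = (\<Sum>t\<in>P. poly h t * \<xi> t S)" for h S
  \<comment> \<open>A \<open>p\<close>-form living on \<open>{1..p+1}\<close> is a contraction of
    the top form by a vector whose entries are its coefficients up to sign; \<open>w h\<close> is
    that vector for \<open>g h\<close>.\<close>
  define w where "w h i = sgn_pos ({1..p+1} - {i}) i * g h ({1..p+1} - {i})" for h i
  define G where "G f h = (\<Sum>i=1..p+1. coeff f (i - 1) * w h i)" for f h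
  have le: "p + 1 \<le> q" using assms(1) by simp
  have form_xi: "form q p (\<xi> t)" if "t \<in> P" for t
    unfolding \<xi>_def by (rule form_contr[OF form[OF that]])
  \<comment> \<open>The rows supply the powers \<open>t ^ j\<close> with \<open>j < q - p\<close>,
    hence every \<open>h\<close> of degree at most \<open>q - 1 - p\<close>.\<close>
  have g_zero: "g h S = 0" if h: "degree h \<le> q - 1 - p" and S: "\<not> (S \<subseteq> {1..p+1} \<and> card S = p)" for h S
  proof (cases "S \<subseteq> {1..q} \<and> card S = p")
    case True
    have "g h S = (\<Sum>t\<in>P. \<Sum>j\<le>q - 1 - p. coeff h j * (t ^ j * \<xi> t S))"
      unfolding g_def by (simp add: poly_eq_sum_le[OF h] sum_distrib_right mult.assoc)
    also have "\<dots> = (\<Sum>j\<le>q - 1 - p. coeff h j * (\<Sum>t\<in>P. t ^ j * \<xi> t S))"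
      by (subst sum.swap) (simp add: sum_distrib_left)
    also have "\<dots> = 0"
      using eq[of _ S] True S assms(1) by (intro sum.neutral) (auto simp: \<xi>_def)
    finally show ?thesis .
  next
    case False
    then have "\<xi> t S = 0" if "t \<in> P" for t using form_xi[OF that] unfolding form_def by blast
    then show ?thesis by (simp add: g_def)
  qed
  have g_contr: "g h S = contr q (w h) (top_form (p + 1)) S" if h: "degree h \<le> q - 1 - p" for h S
  proof (cases "\<exists>i\<in>{1..p+1}. S = {1..p+1} - {i}")
    case True
    then obtain i where i: "i \<in> {1..p+1}" "S = {1..p+1} - {i}" by blast
    have ins: "insert j S = {1..p+1} \<longleftrightarrow> j = i" if "j \<notin> S" for j using i that by blast
    have "contr q (w h) (top_form (p + 1)) S = (\<Sum>j\<in>{1..q} - S. if j = i then sgn_pos S i * w h i else 0)"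
      unfolding contr_def top_form_def by (rule sum.cong) (simp_all add: ins del: One_nat_def)
    also have "\<dots> = sgn_pos S i * w h i"
    proof -
      have "i \<in> {1..q} - S" using i le by auto
      then show ?thesis by simp
    qed
    also have "\<dots> = (sgn_pos S i * sgn_pos S i) * g h S" by (simp only: w_def i(2) mult.assoc)
    finally show ?thesis by simp
  next
    case False
    have "\<not> (S \<subseteq> {1..p+1} \<and> card S = p)"
    proof
      assume S: "S \<subseteq> {1..p+1} \<and> card S = p"
      then have "card ({1..p+1} - S) = 1" using card_Diff_subset[of S "{1..p+1}"] finite_subset[of S "{1..p+1}"] by simp
      then obtain i where "{1..p+1} - S = {i}" by (auto simp: card_1_singleton_iff)
      with S have "i \<in> {1..p+1}" "S = {1..p+1} - {i}" by blast+
      with False show False by blast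
    qed
    then have "g h S = 0" by (rule g_zero[OF h])
    moreover have "contr q (w h) (top_form (p + 1)) S = 0"
      unfolding contr_def
    proof (rule sum.neutral, rule ballI)
      fix i assume i: "i \<in> {1..q} - S"
      have "insert i S \<noteq> {1..p+1}"
      proof
        assume e: "insert i S = {1..p+1}"
        then have "S = {1..p+1} - {i}" "i \<in> {1..p+1}" using i by blast+
        with False show False by blast
      qed
      then show "sgn_pos S i * w h i * top_form (p + 1) (insert i S) = 0" by (simp add: top_form_def)
    qed
    ultimately show ?thesis by simp
  qed
  have g_add: "g (h + h') S = g h S + g h' S" and g_smult: "g (smult c h) S = c * g h S" for h h' c S
    by (simp_all add: g_def distrib_right sum.distrib sum_distrib_left mult.assoc)
  have bil: "bilinear_form G"
    unfolding bilinear_form_def G_def w_def g_add g_smult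
    by (simp add: algebra_simps sum.distrib sum_distrib_left)
  \<comment> \<open>The points of \<open>S\<close> are contracted away and those of \<open>R\<close>
    are roots of \<open>h\<close>; together they exhaust \<open>P\<close>.\<close>
  have split: "G (root_poly S) (root_poly R) = 0"
    if SR: "S \<union> R = P" "S \<inter> R = {}" "card S = p" "card R = q - 1 - p" for S R
  proof -
    have fin: "finite S" "finite R" using SR(1) assms(2) by auto
    obtain ts where ts: "set ts = S" "distinct ts" using finite_distinct_list[OF fin(1)] by blast
    then have len: "length ts = p" using SR(3) by (metis distinct_card)
    define E where "E i = contrs q ts (contr q (unit_vec i) (top_form (p + 1))) {}" for i
    define c where "c = E (p + 1)"
    have "c = sgn_pos {1..p} (Suc p) * contrs q ts (top_form p) {}"
      using contr_unit_vec_top_form[of p q] le by (simp add: c_def E_def contrs_scale)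
    then have "c \<noteq> 0" using contrs_top_form_nonzero[OF ts(2) len, of q] le by simp
    have top: "coeff (root_poly S) p = 1" using lead_coeff_root_poly[OF fin(1)] SR(3) by simp
    \<comment> \<open>The \<open>E i\<close> are the coefficients of the polynomial \<open>t
      \<mapsto> contrs q ts (contr q (mom t) (top_form (p + 1))) {}\<close>. It has degree at most
      \<open>p\<close> and vanishes on \<open>S\<close>, so it is a multiple of
      \<open>root_poly S\<close>, with leading coefficient \<open>c\<close>.\<close>
    have "E i = c * coeff (root_poly S) (i - 1)" if i: "i \<in> {1..p}" for i
    proof -
      let ?v = "\<lambda>i. E i - c * coeff (root_poly S) (i - 1)"
      have "?v i = 0"
      proof (rule vandermonde_zero[where w = ?v and Q = S and n = p])
        fix t assume t: "t \<in> S"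
        have "(\<Sum>i=1..p+1. ?v i * t ^ (i - 1)) =
            (\<Sum>i=1..p+1. mom t i * E i) - c * (\<Sum>i=1..p+1. coeff (root_poly S) (i - 1) * t ^ (i - 1))"
          unfolding sum_distrib_left sum_subtractf[symmetric]
          by (rule sum.cong[OF refl]) (simp add: mom_def left_diff_distrib)
        also have "(\<Sum>i=1..p+1. mom t i * E i) = 0"
          using contrs_contr_top_form[OF le, of ts "mom t"] contrs_contr_mem[of t ts q] t ts
          by (simp add: E_def)
        also have "(\<Sum>i=1..p+1. coeff (root_poly S) (i - 1) * t ^ (i - 1)) = poly (root_poly S) t"
          using poly_eq_sum_le[of "root_poly S" p t] degree_root_poly[OF fin(1)] SR(3)
            sum_shift_pred[of "\<lambda>j. coeff (root_poly S) j * t ^ j" p] by (simp only: order_refl)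
        also have "\<dots> = 0" using t by (simp add: poly_root_poly_eq_0_iff[OF fin(1)])
        finally show "(\<Sum>i=1..p. ?v i * t ^ (i - 1)) = 0"
          by (simp add: c_def top)
      qed (use i fin SR in auto)
      then show ?thesis by simp
    qed
    then have E: "E i = c * coeff (root_poly S) (i - 1)" if "i \<in> {1..p+1}" for i
      using that top by (cases "i = p + 1") (auto simp: c_def)
    have "g (root_poly R) = contr q (w (root_poly R)) (top_form (p + 1))"
      by (rule ext, rule g_contr) (simp add: degree_root_poly[OF fin(2)] SR(4))
    then have "contrs q ts (g (root_poly R)) {} = (\<Sum>i=1..p+1. w (root_poly R) i * E i)"
      using contrs_contr_top_form[OF le, of ts "w (root_poly R)"] by (simp only: E_def)
    also have "\<dots> = c * G (root_poly S) (root_poly R)"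
      unfolding G_def sum_distrib_left by (rule sum.cong) (auto simp: E)
    finally have "c * G (root_poly S) (root_poly R) = contrs q ts (g (root_poly R)) {}" by simp
    also have "\<dots> = (\<Sum>t\<in>P. poly (root_poly R) t * contrs q ts (\<xi> t) {})"
      unfolding g_def by (simp add: contrs_sum)
    also have "\<dots> = 0"
    proof (rule sum.neutral, rule ballI)
      fix t assume "t \<in> P"
      then consider "t \<in> S" | "t \<in> R" using SR by blast
      then show "poly (root_poly R) t * contrs q ts (\<xi> t) {} = 0"
      proof cases
        case 1
        then show ?thesis using contrs_contr_mem[of t ts q "\<eta> t"] ts by (simp add: \<xi>_def)
      next
        case 2
        then show ?thesis by (simp add: poly_root_poly_eq_0_iff[OF fin(2)])
      qed
    qed
    finally show ?thesis using \<open>c \<noteq> 0\<close> by simp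
  qed
  obtain \<theta> where \<theta>: "\<And>f h. degree f \<le> p \<Longrightarrow> degree h \<le> q - 1 - p \<Longrightarrow>
      G f h = (\<Sum>x\<in>P. \<theta> x * poly f x * poly h x)"
    using bilinear_form_diagonal[OF assms(2) bil, of p "q - 1 - p"] split assms(1,3) by auto
  \<comment> \<open>Testing \<open>G\<close> on monomials recovers \<open>w h\<close> itself as a
    combination of moment-curve vectors.\<close>
  have w: "w h i = (\<Sum>t\<in>P. (\<theta> t * poly h t) * mom t i)" if h: "degree h \<le> q - 1 - p" and i: "i \<in> {1..p+1}" for h i
  proof -
    have "G (monom 1 (i - 1)) h = (\<Sum>j=1..p+1. if j = i then w h i else 0)"
      unfolding G_def by (rule sum.cong) (use i in \<open>auto simp: coeff_monom\<close>)
    then have "w h i = G (monom 1 (i - 1)) h" using i by simp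
    also have "\<dots> = (\<Sum>t\<in>P. \<theta> t * poly (monom 1 (i - 1)) t * poly h t)"
      using i h by (intro \<theta>) (auto intro: order_trans[OF degree_monom_le])
    finally show ?thesis by (simp add: poly_monom mom_def mult_ac)
  qed
  \<comment> \<open>After subtracting the diagonal part the weighted sums vanish at every
    \<open>S\<close>, also inside \<open>{1..p+1}\<close>; and \<open>\<zeta> t\<close> is still a
    contraction by \<open>mom t\<close>, so a second contraction by \<open>mom t\<close> kills
    it.\<close>
  define \<zeta> where "\<zeta> t = contr q (mom t) (\<lambda>S. \<eta> t S - \<theta> t * top_form (p + 1) S)" for t
  have \<zeta>: "\<zeta> t S = \<xi> t S - \<theta> t * contr q (mom t) (top_form (p + 1)) S" for t S
    by (simp add: \<zeta>_def \<xi>_def contr_diff contr_scale)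
  have \<zeta>_sum: "(\<Sum>t\<in>P. poly h t * \<zeta> t S) = 0" if h: "degree h \<le> q - 1 - p" for h S
  proof -
    let ?u = "\<lambda>i. contr q (unit_vec i) (top_form (p + 1)) S"
    have "g h S = (\<Sum>i=1..p+1. w h i * ?u i)"
      using g_contr[OF h, of S] contr_top_form_expand[OF le, of "w h"] by simp
    also have "\<dots> = (\<Sum>i=1..p+1. \<Sum>t\<in>P. \<theta> t * poly h t * (mom t i * ?u i))"
      by (rule sum.cong[OF refl]) (simp only: w[OF h] sum_distrib_right mult.assoc)
    also have "\<dots> = (\<Sum>t\<in>P. \<theta> t * poly h t * (\<Sum>i=1..p+1. mom t i * ?u i))"
      by (subst sum.swap) (simp only: sum_distrib_left)
    also have "\<dots> = (\<Sum>t\<in>P. \<theta> t * poly h t * contr q (mom t) (top_form (p + 1)) S)"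
      using contr_top_form_expand[OF le] by metis
    finally show ?thesis
      by (simp add: \<zeta> g_def right_diff_distrib sum_subtractf mult_ac)
  qed
  \<comment> \<open>\<open>P\<close> is one point short of a basis; an auxiliary point completes
    it.\<close>
  obtain t0 where t0: "t0 \<notin> P" using ex_new_if_finite[OF infinite_UNIV_char_0 assms(2)] by blast
  have cardQ: "card (insert t0 P) = q" using t0 assms by simp
  have "\<zeta> t S = 0" if t: "t \<in> P" for t S
  proof (rule form_zero_if_contrs_zero[OF _ _ cardQ])
    show "form q p (\<zeta> t)" unfolding \<zeta>_def
      using form[OF t] form_top_form[OF le] by (intro form_contr form_diff_scale) auto
    show "finite (insert t0 P)" using assms by simp
    fix ts assume ts: "set ts \<subseteq> insert t0 P" "length ts = p"
    show "contrs q ts (\<zeta> t) {} = 0"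
    proof (cases "distinct ts \<and> t \<notin> set ts")
      case True
      \<comment> \<open>Besides \<open>t\<close>, exactly the points of \<open>R\<close> survive the
        contractions. There are few enough of them for a polynomial of admissible degree to vanish
        on all of \<open>R\<close>, which isolates \<open>\<zeta> t\<close>.\<close>
      define R where "R = P - set ts - {t}"
      have "card (insert t0 P - set ts) = q - p"
        using ts True cardQ by (simp add: card_Diff_subset distinct_card)
      then have "card (insert t0 P - set ts - {t}) = q - 1 - p"
        using t True by simp
      moreover have "R \<subseteq> insert t0 P - set ts - {t}" by (auto simp: R_def)
      ultimately have cR: "card R \<le> q - 1 - p"
        using card_mono[of "insert t0 P - set ts - {t}" R] assms(2) by simp
      have fR: "finite R" using assms by (simp add: R_def)
      have "contrs q ts (\<lambda>S. \<Sum>s\<in>P. poly (root_poly R) s * \<zeta> s S) {} = 0"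
        using \<zeta>_sum[of "root_poly R"] degree_root_poly[OF fR] cR by simp
      then have "(\<Sum>s\<in>P. poly (root_poly R) s * contrs q ts (\<zeta> s) {}) = 0" by (simp add: contrs_sum)
      also have "(\<Sum>s\<in>P. poly (root_poly R) s * contrs q ts (\<zeta> s) {}) =
          (\<Sum>s\<in>{t}. poly (root_poly R) s * contrs q ts (\<zeta> s) {})"
      proof (rule sum.mono_neutral_right)
        show "\<forall>s\<in>P - {t}. poly (root_poly R) s * contrs q ts (\<zeta> s) {} = 0"
        proof
          fix s assume "s \<in> P - {t}"
          then consider "s \<in> R" | "s \<in> set ts" by (auto simp: R_def)
          then show "poly (root_poly R) s * contrs q ts (\<zeta> s) {} = 0"
            by cases (simp_all add: poly_root_poly_eq_0_iff[OF fR] \<zeta>_def contrs_contr_mem)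
        qed
      qed (use assms t in auto)
      finally show ?thesis
        using poly_root_poly_eq_0_iff[OF fR, of t] by (simp add: R_def)
    next
      case False
      then show ?thesis using contrs_not_distinct[of ts q "\<zeta> t"] by (auto simp: \<zeta>_def contrs_contr_mem)
    qed
  qed
  then have "\<forall>t\<in>P. \<forall>S. contr q (mom t) (\<eta> t) S = \<theta> t * contr q (mom t) (top_form (p + 1)) S"
    by (simp add: \<zeta> \<xi>_def)
  then show ?thesis by blast
qed

text \<open>Contraction is injective on forms divisible by the first coordinate functional: at
  \<open>U - {1}\<close> only the index \<open>1\<close> contributes.\<close>

lemma contr_zero_imp_zero:
  assumes "contr q a x (U - {1}) = 0" "a 1 \<noteq> 0" "1 \<le> q" "1 \<in> U" "\<And>V. x V \<noteq> 0 \<Longrightarrow> 1 \<in> V"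
  shows "x U = 0"
proof -
  have "contr q a x (U - {1}) = (\<Sum>i\<in>{1}. sgn_pos (U - {1}) i * a i * x (insert i (U - {1})))"
    unfolding contr_def by (rule sum.mono_neutral_right) (use assms in auto)
  then show ?thesis using assms by (simp add: insert_absorb)
qed

lemma block_zero:
  assumes "p < q" "finite P" "card P = q - 1"
    and form: "\<And>t. t \<in> P \<Longrightarrow> form q (Suc p) (\<eta> t)"
    and eq: "\<And>j S. j < q - p \<Longrightarrow> S \<subseteq> {1..q} \<Longrightarrow> card S = p \<Longrightarrow> \<not> S \<subseteq> {1..p + 1} \<Longrightarrow>
      (\<Sum>t\<in>P. t ^ j * contr q (mom t) (\<eta> t) S) = 0"
    and supp: "\<And>t U. t \<in> P \<Longrightarrow> \<eta> t U \<noteq> 0 \<Longrightarrow> 1 \<in> U \<and> U \<noteq> {1..p + 1}"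
    and t: "t \<in> P"
  shows "\<eta> t U = 0"
proof (rule ccontr)
  assume nz: "\<eta> t U \<noteq> 0"
  obtain \<theta> where \<theta>: "\<And>S. contr q (mom t) (\<eta> t) S = \<theta> t * contr q (mom t) (top_form (p + 1)) S"
    using block_core[OF assms(1-5)] t by blast
  \<comment> \<open>The top form is also supported on a set containing \<open>1\<close>, so
    injectivity applies to the difference; away from \<open>{1..p+1}\<close> the difference is
    \<open>\<eta> t\<close>.\<close>
  define x where "x S = \<eta> t S - \<theta> t * top_form (p + 1) S" for S
  have zero: "contr q (mom t) x S = 0" for S
    unfolding x_def by (simp add: contr_diff contr_scale \<theta>)
  have one: "1 \<in> V" if "x V \<noteq> 0" for V
    using that supp[OF t, of V] by (cases "V = {1..p+1}") (auto simp: x_def top_form_def)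
  have "1 \<le> q" "mom t 1 \<noteq> 0" using assms(1) by (simp_all add: mom_def)
  then have "x U = 0"
    using contr_zero_imp_zero[OF zero _ _ conjunct1[OF supp[OF t nz]] one] by blast
  then show False using supp[OF t nz] nz by (simp add: x_def top_form_def)
qed

lemma contr_koszul:
  assumes "\<And>U. x U \<noteq> 0 \<Longrightarrow> U \<subseteq> {1..q}"
  shows "contr q a x S = (\<Sum>U\<in>Pow {1..q}. (\<Sum>i=1..q. koszul_coeff S U i * a i) * x U)"
proof -
  have inner: "(\<Sum>U\<in>Pow {1..q}. koszul_coeff S U i * a i * x U) =
      (if i \<in> S then 0 else sgn_pos S i * a i * x (insert i S))" for i
  proof -
    have "(\<Sum>U\<in>Pow {1..q}. koszul_coeff S U i * a i * x U) =
        (\<Sum>U\<in>Pow {1..q}. if U = insert i S then (if i \<in> S then 0 else sgn_pos S i * a i * x (insert i S)) else 0)"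
      by (rule sum.cong) (auto simp: koszul_coeff_def)
    then show ?thesis using assms[of "insert i S"] by auto
  qed
  have "(\<Sum>U\<in>Pow {1..q}. (\<Sum>i=1..q. koszul_coeff S U i * a i) * x U) =
      (\<Sum>i=1..q. \<Sum>U\<in>Pow {1..q}. koszul_coeff S U i * a i * x U)"
    unfolding sum_distrib_right by (rule sum.swap)
  also have "\<dots> = contr q a x S"
    unfolding inner contr_def by (rule sum.mono_neutral_cong_right) auto
  finally show ?thesis by simp
qed

text \<open>A coefficient vector \<open>y\<close> is read as one form per index \<open>l\<close>;
  the matrix contracts that form by \<open>a l\<close> and tensors the result with
  \<open>b l\<close>.\<close>

lemma N_entry_sum:
  assumes "C \<subseteq> Pow {1..q} \<times> {1..r}"
  shows "(\<Sum>c\<in>C. N_entry a b q (S, j) c * y c) =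
    (\<Sum>l=1..r. b l j * contr q (a l) (\<lambda>U. if (U, l) \<in> C then y (U, l) else 0) S)"
proof -
  have "(\<Sum>c\<in>C. N_entry a b q (S, j) c * y c) =
      (\<Sum>c\<in>Pow {1..q} \<times> {1..r}. N_entry a b q (S, j) c * (if c \<in> C then y c else 0))"
    by (rule sum.mono_neutral_cong_left) (use assms in auto)
  also have "\<dots> = (\<Sum>U\<in>Pow {1..q}. \<Sum>l=1..r. N_entry a b q (S, j) (U, l) * (if (U, l) \<in> C then y (U, l) else 0))"
    by (simp only: sum.cartesian_product) (rule sum.cong, auto)
  also have "\<dots> = (\<Sum>l=1..r. \<Sum>U\<in>Pow {1..q}. N_entry a b q (S, j) (U, l) * (if (U, l) \<in> C then y (U, l) else 0))"
    by (rule sum.swap)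
  also have "\<dots> = (\<Sum>l=1..r. b l j * contr q (a l) (\<lambda>U. if (U, l) \<in> C then y (U, l) else 0) S)"
  proof (rule sum.cong[OF refl])
    fix l
    show "(\<Sum>U\<in>Pow {1..q}. N_entry a b q (S, j) (U, l) * (if (U, l) \<in> C then y (U, l) else 0)) =
        b l j * contr q (a l) (\<lambda>U. if (U, l) \<in> C then y (U, l) else 0) S"
      by (subst contr_koszul) (use assms in \<open>auto simp: N_entry_def sum_distrib_left mult.assoc split: if_splits intro!: sum.cong\<close>)
  qed
  finally show ?thesis .
qed

text \<open>Coordinates are cut into runs of \<open>m\<close> and indices into runs of
  \<open>s\<close>; inside its own run, \<open>l\<close> sits at the moment-curve point of
  \<open>real l\<close>. Rows are later picked only from complete runs, whence the conditions
  \<open>g < n div m\<close>.\<close>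

definition block_vec :: "nat \<Rightarrow> nat \<Rightarrow> nat \<Rightarrow> nat \<Rightarrow> real" where
  "block_vec m s l j = (if (j - 1) div m = (l - 1) div s then real l ^ ((j - 1) mod m) else 0)"

lemma block_vec_row:
  assumes "t < m" "g < n div m"
  shows "g * m + t + 1 \<in> {1..n}"
    "block_vec m s l (g * m + t + 1) = (if (l - 1) div s = g then real l ^ t else 0)"
proof -
  have "Suc g * m \<le> n div m * m" using assms(2) by (intro mult_le_mono1) simp
  also have "\<dots> \<le> n" by (rule div_times_less_eq_dividend)
  finally show "g * m + t + 1 \<in> {1..n}" using assms(1) by simp
  have "(g * m + t) div m = g" "(g * m + t) mod m = t" using assms(1) by auto
  then show "block_vec m s l (g * m + t + 1) = (if (l - 1) div s = g then real l ^ t else 0)"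
    by (auto simp: block_vec_def)
qed

lemma block_index_less: "l \<in> {1..r} \<Longrightarrow> r \<le> s * k \<Longrightarrow> (l - 1) div s < k" for l :: nat
  by (rule less_mult_imp_div_less) (auto simp: mult.commute)

lemma card_block_le: "0 < s \<Longrightarrow> card {l\<in>{1..r}. (l - 1) div s = g} \<le> s" for r :: nat
proof -
  assume "0 < s"
  have "l \<in> {g * s + 1..g * s + s}" if l: "1 \<le> l" "(l - 1) div s = g" for l
  proof -
    have "g * s + (l - 1) mod s = l - 1" using div_mult_mod_eq[of "l - 1" s] unfolding l(2) .
    then show ?thesis
      using l(1) mod_less_divisor[OF \<open>0 < s\<close>, of "l - 1"] unfolding atLeastAtMost_iff by linarith
  qed
  then have "{l\<in>{1..r}. (l - 1) div s = g} \<subseteq> {g * s + 1..g * s + s}" by fastforce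
  from card_mono[OF _ this] show ?thesis by simp
qed

lemma N_col_indep:
  assumes "p < q" "2 \<le> q" "r \<le> (q - 1) * (n div (q - p))"
  shows "col_indep (N_rows q p n) (N_cols q p r)
    (N_entry (\<lambda>l. mom (real l)) (block_vec (q - p) (q - 1)) q)"
proof (rule col_indepI)
  let ?C = "N_cols q p r" and ?a = "\<lambda>l. mom (real l)" and ?b = "block_vec (q - p) (q - 1)"
  fix y c
  assume rows: "\<And>i. i \<in> N_rows q p n \<Longrightarrow> (\<Sum>j\<in>?C. N_entry ?a ?b q i j * y j) = 0" and c: "c \<in> ?C"
  obtain U0 l0 where c_eq: "c = (U0, l0)" by (cases c)
  have C: "?C \<subseteq> Pow {1..q} \<times> {1..r}" by (auto simp: N_cols_def subset_idx_def)
  have l0: "l0 \<in> {1..r}" using c C c_eq by auto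
  define g where "g = (l0 - 1) div (q - 1)"
  have g: "g < n div (q - p)" unfolding g_def using l0 assms(3) by (rule block_index_less)
  define L where "L = {l\<in>{1..r}. (l - 1) div (q - 1) = g}"
  have L: "finite (real ` L)" "card (real ` L) \<le> q - 1"
    using card_block_le[of "q - 1" r g] assms(2) by (auto simp: L_def card_image)
  \<comment> \<open>The last block of indices may be short; additional points carrying the zero form
    bring it to \<open>q - 1\<close> points.\<close>
  obtain X where X: "finite X" "card X = q - 1 - card (real ` L)" "X \<subseteq> - real ` L"
    using infinite_arbitrarily_large[of "- real ` L" "q - 1 - card (real ` L)"] L(1)
    by (auto simp: finite_compl infinite_UNIV_char_0)
  define P where "P = real ` L \<union> X"
  have "real ` L \<inter> X = {}" using X(3) by blast
  then have "card P = card (real ` L) + card X"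
    unfolding P_def using X(1) L(1) by (intro card_Un_disjoint)
  then have P: "finite P" "card P = q - 1" "real ` L \<subseteq> P"
    using X L by (simp_all add: P_def)
  \<comment> \<open>\<open>block_zero\<close> is indexed by points of the curve;
    \<open>nat \<lfloor>t\<rfloor>\<close> recovers \<open>l\<close> from \<open>real l\<close>, and
    the guard gives the padding points the zero form.\<close>
  define \<eta> where "\<eta> t U = (if t \<in> real ` L \<and> (U, nat \<lfloor>t\<rfloor>) \<in> ?C then y (U, nat \<lfloor>t\<rfloor>) else 0)" for t U
  have "\<eta> (real l0) U0 = 0"
  proof (rule block_zero[where \<eta> = \<eta> and t = "real l0", OF assms(1) P(1,2)])
    show "real l0 \<in> P" using P(3) l0 by (auto simp: L_def g_def)
    show "form q (Suc p) (\<eta> t)" for t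
      by (auto simp: form_def \<eta>_def N_cols_def subset_idx_def split: if_splits)
    show "1 \<in> U \<and> U \<noteq> {1..p + 1}" if "\<eta> t U \<noteq> 0" for t U
      using that by (auto simp: \<eta>_def N_cols_def split: if_splits)
    fix j S assume j: "j < q - p" and S: "S \<subseteq> {1..q}" "card S = p" "\<not> S \<subseteq> {1..p + 1}"
    \<comment> \<open>The coordinate at offset \<open>j\<close> in run \<open>g\<close>, where all
      indices outside \<open>L\<close> have entry zero.\<close>
    let ?J = "g * (q - p) + j + 1"
    have "(S, ?J) \<in> N_rows q p n"
      using block_vec_row(1)[OF j g] S by (auto simp: N_rows_def subset_idx_def)
    from rows[OF this] have "0 = (\<Sum>l=1..r. ?b l ?J * contr q (?a l) (\<lambda>U. if (U, l) \<in> ?C then y (U, l) else 0) S)"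
      by (simp only: N_entry_sum[OF C])
    also have "\<dots> = (\<Sum>l\<in>L. real l ^ j * contr q (?a l) (\<eta> (real l)) S)"
    proof (rule sum.mono_neutral_cong_right)
      show "\<forall>l\<in>{1..r} - L. ?b l ?J * contr q (?a l) (\<lambda>U. if (U, l) \<in> ?C then y (U, l) else 0) S = 0"
        using block_vec_row(2)[OF j g] by (auto simp: L_def)
      fix l assume l: "l \<in> L"
      have "\<eta> (real l) = (\<lambda>U. if (U, l) \<in> ?C then y (U, l) else 0)"
        using l by (auto simp: \<eta>_def)
      then show "?b l ?J * contr q (?a l) (\<lambda>U. if (U, l) \<in> ?C then y (U, l) else 0) S =
          real l ^ j * contr q (?a l) (\<eta> (real l)) S"
        using block_vec_row(2)[OF j g, of "q - 1" l] l by (simp add: L_def)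
    qed (auto simp: L_def)
    also have "\<dots> = (\<Sum>t\<in>real ` L. t ^ j * contr q (mom t) (\<eta> t) S)"
      by (simp add: sum.reindex)
    also have "\<dots> = (\<Sum>t\<in>P. t ^ j * contr q (mom t) (\<eta> t) S)"
    proof (rule sum.mono_neutral_left[OF P(1,3)], rule ballI)
      fix t assume "t \<in> P - real ` L"
      then have "\<eta> t = (\<lambda>U. 0)" by (auto simp: \<eta>_def)
      then show "t ^ j * contr q (mom t) (\<eta> t) S = 0" by simp
    qed
    finally show "(\<Sum>t\<in>P. t ^ j * contr q (mom t) (\<eta> t) S) = 0" by simp
  qed
  moreover have "l0 \<in> L" using l0 by (simp add: L_def g_def)
  ultimately show "y c = 0" using c by (simp add: \<eta>_def c_eq)
qed

section \<open>The rank of the Koszul flattening\<close>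

text \<open>For \<open>q \<ge> 1\<close> these are \<open>r * ((q - 1) choose s)\<close> columns;
  they span all columns \<open>(U, l)\<close> as soon as every \<open>a l 1\<close> is
  nonzero.\<close>

definition pivot_cols :: "nat \<Rightarrow> nat \<Rightarrow> nat \<Rightarrow> (nat set \<times> nat) set" where
  "pivot_cols q s r = {(U, l) \<in> subset_idx q (s + 1) r. 1 \<in> U}"

lemma finite_subset_idx [simp]: "finite (subset_idx q s n)"
  by (rule finite_subset[of _ "Pow {1..q} \<times> {1..n}"]) (auto simp: subset_idx_def)

lemma finite_pivot_cols [simp]: "finite (pivot_cols q s r)"
  by (rule finite_subset[OF _ finite_subset_idx[of q "s + 1" r]]) (auto simp: pivot_cols_def)

lemma koszul_coeff_sum:
  assumes "i \<in> {1..q}" "i \<notin> S"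
  shows "(\<Sum>k=1..q. koszul_coeff S (insert i S) k * a k) = sgn_pos S i * a i"
proof -
  have "koszul_coeff S (insert i S) k * a k = (if k = i then sgn_pos S i * a i else 0)" for k
    using assms(2) by (auto simp: koszul_coeff_def)
  then show ?thesis using assms(1) by simp
qed

lemma koszul_coeff_eq_0: "\<not> S \<subseteq> U \<Longrightarrow> koszul_coeff S U i = 0"
  by (auto simp: koszul_coeff_def)

lemma pivot_col_indep:
  assumes "p < q"
    and N: "col_indep (N_rows q p n) (N_cols q p r) (N_entry a b q)"
    and T: "col_indep ({1..p+1} \<times> {1..n}) {1..r} (\<lambda>(i, j) l. a l i * b l j)"
  shows "col_indep (subset_idx q p n) (pivot_cols q p r) (N_entry a b q)"
proof (rule col_indepI)
  fix y c
  assume rows: "\<And>i. i \<in> subset_idx q p n \<Longrightarrow> (\<Sum>c\<in>pivot_cols q p r. N_entry a b q i c * y c) = 0"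
    and c: "c \<in> pivot_cols q p r"
  have sub: "N_cols q p r \<subseteq> pivot_cols q p r" by (auto simp: N_cols_def pivot_cols_def)
  have diff: "c \<in> pivot_cols q p r - N_cols q p r \<longleftrightarrow> (\<exists>l\<in>{1..r}. c = ({1..p+1}, l))" for c
    using assms(1) by (auto simp: N_cols_def pivot_cols_def subset_idx_def)
  have yN: "y c = 0" if "c \<in> N_cols q p r" for c
  proof (rule col_indepD[OF N _ that])
    fix i assume i: "i \<in> N_rows q p n"
    then obtain S j where Sj: "i = (S, j)" "\<not> S \<subseteq> {1..p+1}" "i \<in> subset_idx q p n"
      by (auto simp: N_rows_def)
    \<comment> \<open>A nonzero entry needs \<open>S \<subseteq> U\<close>, so the columns with
      \<open>U = {1..p+1}\<close> are invisible in the rows of \<open>N\<close>.\<close>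
    have "(\<Sum>c\<in>N_cols q p r. N_entry a b q i c * y c) = (\<Sum>c\<in>pivot_cols q p r. N_entry a b q i c * y c)"
    proof (rule sum.mono_neutral_left[OF finite_pivot_cols sub], rule ballI)
      fix c assume "c \<in> pivot_cols q p r - N_cols q p r"
      then obtain l where "c = ({1..p+1}, l)" unfolding diff by blast
      then show "N_entry a b q i c * y c = 0"
        using koszul_coeff_eq_0[OF Sj(2)] by (simp add: N_entry_def Sj(1))
    qed
    then show "(\<Sum>c\<in>N_cols q p r. N_entry a b q i c * y c) = 0" using rows[OF Sj(3)] by simp
  qed
  have yT: "y ({1..p+1}, l) = 0" if "l \<in> {1..r}" for l
  proof (rule col_indepD[OF T _ that, where y = "\<lambda>l. y ({1..p+1}, l)"])
    fix ij assume "ij \<in> {1..p+1} \<times> {1..n}"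
    then obtain i j where ij: "ij = (i, j)" "i \<in> {1..p+1}" "j \<in> {1..n}" by blast
    \<comment> \<open>For this row and \<open>U = {1..p+1}\<close> only the index \<open>i\<close>
      contributes, leaving the entry \<open>a l i * b l j\<close> up to a sign common to all
      \<open>l\<close>.\<close>
    define S where "S = {1..p+1} - {i}"
    have ins: "insert i S = {1..p+1}" "i \<notin> S" "i \<in> {1..q}" using ij assms(1) by (auto simp: S_def)
    have "(S, j) \<in> subset_idx q p n" using ij assms(1) by (auto simp: subset_idx_def S_def)
    from rows[OF this] have "0 = (\<Sum>c\<in>pivot_cols q p r. N_entry a b q (S, j) c * y c)" by simp
    also have "\<dots> = (\<Sum>c\<in>pivot_cols q p r - N_cols q p r. N_entry a b q (S, j) c * y c)"
      by (rule sum.mono_neutral_right) (auto simp: yN)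
    also have "pivot_cols q p r - N_cols q p r = (\<lambda>l. ({1..p+1}, l)) ` {1..r}"
      using diff by blast
    also have "(\<Sum>c\<in>(\<lambda>l. ({1..p+1}, l)) ` {1..r}. N_entry a b q (S, j) c * y c) =
        (\<Sum>l=1..r. N_entry a b q (S, j) ({1..p+1}, l) * y ({1..p+1}, l))"
      by (subst sum.reindex) (auto simp: inj_on_def)
    also have "\<dots> = (\<Sum>l=1..r. sgn_pos S i * (a l i * b l j * y ({1..p+1}, l)))"
      using koszul_coeff_sum[OF ins(3,2)]
      by (intro sum.cong refl) (simp add: N_entry_def ins(1) del: One_nat_def)
    also have "\<dots> = sgn_pos S i * (\<Sum>l=1..r. a l i * b l j * y ({1..p+1}, l))"
      by (simp only: sum_distrib_left)
    finally show "(\<Sum>l=1..r. (case ij of (i, j) \<Rightarrow> \<lambda>l. a l i * b l j) l * y ({1..p+1}, l)) = 0"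
      by (simp add: ij(1))
  qed
  show "y c = 0"
  proof (cases "c \<in> N_cols q p r")
    case False
    then have "\<exists>l\<in>{1..r}. c = ({1..p+1}, l)" using diff[of c] c by blast
    then show ?thesis using yT by blast
  qed (rule yN)
qed

section \<open>Basis forms, signs, and the passage to complementary subsets\<close>

lemma sgn_pos_one: "U \<subseteq> {1..q} \<Longrightarrow> sgn_pos U 1 = 1"
proof -
  assume "U \<subseteq> {1..q}"
  then have "{j \<in> U. j < 1} = {}" by auto
  then show ?thesis by (simp only: sgn_pos_def card.empty power_0)
qed

definition delta :: "nat set \<Rightarrow> nat set \<Rightarrow> real" where
  "delta U V = of_bool (V = U)"

lemma contr_delta_eq_koszul:
  "U \<subseteq> {1..q} \<Longrightarrow> contr q a (delta U) S = (\<Sum>i=1..q. koszul_coeff S U i * a i)"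
proof -
  assume U: "U \<subseteq> {1..q}"
  have "contr q a (delta U) S = (\<Sum>V\<in>Pow {1..q}. (\<Sum>i=1..q. koszul_coeff S V i * a i) * delta U V)"
    by (rule contr_koszul) (use U in \<open>auto simp: delta_def\<close>)
  also have "\<dots> = (\<Sum>V\<in>{U}. (\<Sum>i=1..q. koszul_coeff S V i * a i) * delta U V)"
    by (rule sum.mono_neutral_right) (use U in \<open>auto simp: delta_def\<close>)
  finally show ?thesis by (simp add: delta_def)
qed

lemma contr_delta:
  assumes "W \<subseteq> {1..q}"
  shows "contr q a (delta W) = (\<lambda>T. \<Sum>i\<in>W. (sgn_pos W i * a i) * delta (W - {i}) T)"
proof
  fix T
  have eq: "sgn_pos (W - {i}) i = sgn_pos W i" if "i \<in> W" for i
    using that sgn_pos_self[of i "W - {i}"] by (simp add: insert_absorb)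
  have "contr q a (delta W) T = (\<Sum>i\<in>{1..q} - T. sgn_pos T i * a i * delta W (insert i T))"
    by (simp add: contr_def)
  also have "\<dots> = (\<Sum>i\<in>{i\<in>W. T = W - {i}}. sgn_pos T i * a i * delta W (insert i T))"
    by (rule sum.mono_neutral_right) (use assms in \<open>auto simp: delta_def\<close>)
  also have "\<dots> = (\<Sum>i\<in>{i\<in>W. T = W - {i}}. (sgn_pos W i * a i) * delta (W - {i}) T)"
    by (rule sum.cong) (auto simp: delta_def eq insert_absorb)
  also have "\<dots> = (\<Sum>i\<in>W. (sgn_pos W i * a i) * delta (W - {i}) T)"
    by (rule sum.mono_neutral_left) (use assms finite_subset[of W "{1..q}"] in \<open>auto simp: delta_def\<close>)
  finally show "contr q a (delta W) T = (\<Sum>i\<in>W. (sgn_pos W i * a i) * delta (W - {i}) T)" .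
qed

text \<open>Contracting the basis form of \<open>insert 1 U\<close> twice by \<open>a\<close> gives
  zero; expanding this expresses a column without \<open>1\<close> through columns with
  \<open>1\<close>.\<close>

lemma contr_delta_relation:
  assumes "U \<subseteq> {1..q}" "1 \<le> q" "1 \<notin> U"
  shows "a 1 * contr q a (delta U) S =
    (\<Sum>i\<in>U. - (sgn_pos (insert 1 U) i * a i) * contr q a (delta (insert 1 U - {i})) S)"
proof -
  have fin: "finite U" using assms(1) finite_subset by blast
  have s1: "sgn_pos (insert 1 U) 1 = 1" using sgn_pos_one[OF assms(1)] by (simp del: One_nat_def)
  have "0 = contr q a (contr q a (delta (insert 1 U))) S" by (simp add: contr_self)
  also have "\<dots> = (\<Sum>i\<in>insert 1 U. (sgn_pos (insert 1 U) i * a i) * contr q a (delta (insert 1 U - {i})) S)"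
    using assms by (subst contr_delta) (auto simp: contr_sum)
  also have "\<dots> = a 1 * contr q a (delta U) S +
      (\<Sum>i\<in>U. (sgn_pos (insert 1 U) i * a i) * contr q a (delta (insert 1 U - {i})) S)"
    using assms(3) fin s1 by simp
  finally show ?thesis by (simp add: sum_negf)
qed

text \<open>On sets of a fixed size this is the sign of the Hodge star, up to a constant factor; it
  converts exterior multiplication into contraction on complements.\<close>

definition sum_sign :: "nat set \<Rightarrow> real" where
  "sum_sign U = (-1) ^ (\<Sum>U)"

lemma sum_sign_square [simp]: "sum_sign U * sum_sign U = 1"
  by (simp add: sum_sign_def flip: power_add mult_2)

lemma sum_sign_exchange:
  assumes "finite V" "1 \<in> V" "i \<notin> V" "1 \<le> i"
  shows "sum_sign (insert i V - {1}) = sum_sign V * (-1) ^ (i - 1)"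
proof -
  have V: "\<Sum>V = 1 + \<Sum>(V - {1})" using assms by (simp add: sum.remove)
  have "insert i V - {1} = insert i (V - {1})" using assms by auto
  then have "\<Sum>(insert i V - {1}) = i + \<Sum>(V - {1})" using assms by simp
  then have "\<Sum>(insert i V - {1}) = \<Sum>V + (i - 1)" using V assms(4) by simp
  then show ?thesis by (simp add: sum_sign_def power_add)
qed

text \<open>\<open>V\<close> and \<open>insert 1 ({1..q} - V)\<close> together cover the numbers
  below \<open>i\<close>, with \<open>1\<close> counted twice; this extra count is the minus
  sign.\<close>

lemma sgn_pos_complement:
  assumes "V \<subseteq> {1..q}" "1 \<in> V" "i \<in> {1..q} - V"
  shows "sgn_pos (insert 1 ({1..q} - V)) i * (-1) ^ (i - 1) = - sgn_pos V i"
proof -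
  let ?A = "{j \<in> insert 1 ({1..q} - V). j < i}" and ?B = "{j \<in> V. j < i}"
  have i: "2 \<le> i" using assms by (cases "i = 1") auto
  have "?A \<union> ?B = {1..<i}" "?A \<inter> ?B = {1}" using assms i by auto
  moreover have "card ?A + card ?B = card (?A \<union> ?B) + card (?A \<inter> ?B)"
    by (rule card_Un_Int) auto
  ultimately have "card ?A + card ?B = (i - 1) + 1" by simp
  then have "sgn_pos (insert 1 ({1..q} - V)) i * sgn_pos V i = - ((-1) ^ (i - 1))"
    by (simp add: sgn_pos_def flip: power_add)
  moreover have "((-1::real) ^ (i - 1)) * (-1) ^ (i - 1) = 1" by (simp flip: power_add mult_2)
  moreover have "s * e = - t" if "s * t = - e" "e * e = 1" "t * t = 1" for s t e :: real
    using that by algebra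
  ultimately show ?thesis using sgn_pos_square by blast
qed

text \<open>The hypothesis says that \<open>a 1 \<cdot> Z\<close> is the contraction of \<open>e\<^sub>1 \<and> Z\<close> by \<open>a\<close>.\<close>

lemma contr_zero_if_reduced_zero:
  assumes Z: "form q k Z" and "a 1 \<noteq> 0" "1 \<le> q"
    and red: "\<And>V. V \<subseteq> {1..q} \<Longrightarrow> card V = k \<Longrightarrow> 1 \<in> V \<Longrightarrow>
      a 1 * Z V = (\<Sum>i\<in>{1..q} - V. sgn_pos V i * a i * Z (insert i V - {1}))"
  shows "contr q a Z S = 0"
proof -
  \<comment> \<open>No sign arises in this wedge product because \<open>1\<close> is the least
    index.\<close>
  define Y where "Y X = (if 1 \<in> X then Z (X - {1}) else 0)" for X
  have "a 1 * Z V = contr q a Y V" for V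
  proof (cases "1 \<in> V")
    case True
    have Y: "contr q a Y V = (\<Sum>i\<in>{1..q} - V. sgn_pos V i * a i * Z (insert i V - {1}))"
      unfolding contr_def Y_def using True by simp
    show ?thesis
    proof (cases "V \<subseteq> {1..q} \<and> card V = k")
      case True
      then show ?thesis using red \<open>1 \<in> V\<close> Y by simp
    next
      case False
      have "Z (insert i V - {1}) = 0" if i: "i \<in> {1..q} - V" for i
      proof (rule ccontr)
        assume "Z (insert i V - {1}) \<noteq> 0"
        then have *: "insert i V - {1} \<subseteq> {1..q}" "card (insert i V - {1}) = k"
          using Z unfolding form_def by blast+
        then have "V \<subseteq> {1..q}" using assms(3) by auto
        moreover from this have "finite V" using finite_subset by blast
        then have "card V = k" using *(2) i \<open>1 \<in> V\<close> by (auto simp: card_Diff_singleton)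
        ultimately show False using False by blast
      qed
      moreover have "Z V = 0" using Z False unfolding form_def by blast
      ultimately show ?thesis unfolding Y by simp
    qed
  next
    case False
    show ?thesis
    proof (cases "V \<subseteq> {1..q}")
      case True
      then have s: "sgn_pos V 1 = 1" by (rule sgn_pos_one)
      have "contr q a Y V = (\<Sum>i\<in>{1}. sgn_pos V i * a i * Y (insert i V))"
        unfolding contr_def by (rule sum.mono_neutral_right) (use False assms(3) in \<open>auto simp: Y_def\<close>)
      then show ?thesis using False s by (simp add: Y_def)
    next
      case F: False
      have "Z V = 0" using Z F unfolding form_def by blast
      moreover from this have "Y (insert i V) = 0" for i
        using False by (cases "i = 1") (auto simp: Y_def)
      ultimately show ?thesis unfolding contr_def by simp
    qed
  qed
  then have "(\<lambda>V. a 1 * Z V) = contr q a Y" by blast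
  \<comment> \<open>A second contraction by \<open>a\<close> kills the right-hand side.\<close>
  then have "a 1 * contr q a Z S = 0" using contr_self[of q a Y] contr_scale[of q a "a 1" Z] by metis
  then show ?thesis using assms(2) by simp
qed

lemma card_pivot_cols: "1 \<le> q \<Longrightarrow> card (pivot_cols q p r) = r * ((q - 1) choose p)"
proof -
  assume q: "1 \<le> q"
  let ?K = "{A. A \<subseteq> {2..q} \<and> card A = p}"
  have "pivot_cols q p r = (insert 1 ` ?K) \<times> {1..r}"
  proof (intro equalityI subsetI)
    fix x assume "x \<in> pivot_cols q p r"
    then obtain U l where x: "x = (U, l)" "U \<subseteq> {1..q}" "card U = p + 1" "1 \<in> U" "l \<in> {1..r}"
      by (auto simp: pivot_cols_def subset_idx_def)
    have "finite U" using x(2) finite_subset by blast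
    have "U - {1} \<in> ?K"
    proof -
      have "U - {1} \<subseteq> {2..q}"
      proof
        fix u assume "u \<in> U - {1}"
        then have "u \<in> {1..q}" "u \<noteq> 1" using x(2) by blast+
        then show "u \<in> {2..q}" by simp
      qed
      then show ?thesis using x \<open>finite U\<close> by simp
    qed
    moreover have "U = insert 1 (U - {1})" using x(4) by blast
    ultimately show "x \<in> (insert 1 ` ?K) \<times> {1..r}" using x by blast
  next
    fix x assume "x \<in> (insert 1 ` ?K) \<times> {1..r}"
    then obtain A l where x: "x = (insert 1 A, l)" "A \<subseteq> {2..q}" "card A = p" "l \<in> {1..r}" by auto
    have "finite A" "1 \<notin> A" using x(2) finite_subset by auto
    moreover have "insert 1 A \<subseteq> {1..q}" using x(2) q by auto
    ultimately show "x \<in> pivot_cols q p r" using x by (simp add: pivot_cols_def subset_idx_def)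
  qed
  moreover have "inj_on (insert 1) ?K"
  proof (rule inj_onI)
    fix A B assume AB: "A \<in> ?K" "B \<in> ?K" "insert 1 A = insert 1 B"
    then have "1 \<notin> A" "1 \<notin> B" by auto
    then show "A = B" using AB(3) insert_ident[of 1 A B] by blast
  qed
  ultimately show ?thesis
    by (simp add: card_cartesian_product card_image n_subsets mult.commute)
qed

text \<open>The columns of \<open>M\<close> and the pivot columns \<open>v\<close> span the same
  space. One inclusion rests on \<open>a l 1 \<noteq> 0\<close>; the other solves a linear system on
  the complementary side, which is what \<open>B'\<close> permits. Then \<open>B\<close> gives the
  dimension.\<close>

lemma rank_M_eq:
  assumes "p < q" and p': "p' = q - p - 1" and a1: "\<And>l. l \<in> {1..r} \<Longrightarrow> a l 1 \<noteq> 0"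
    and B: "col_indep (subset_idx q p n2) (pivot_cols q p r) (N_entry a b q)"
    and B': "col_indep (subset_idx q p' n3) (pivot_cols q p' r) (N_entry a c q)"
  shows "mat_rank (subset_idx q p n2) (subset_idx q (p + 1) n3) (M_entry (tensor_sum r a b c) q) =
    r * ((q - 1) choose p)"
proof -
  let ?R = "subset_idx q p n2" and ?C = "subset_idx q (p + 1) n3"
  define v where "v = mat_col ?R (N_entry a b q)"
  define m where "m = mat_col ?R (M_entry (tensor_sum r a b c) q)"
  have q1: "1 \<le> q" using assms(1) by simp
  have v_eq: "v (U, l) = (\<lambda>(S, j). of_bool ((S, j) \<in> ?R) * (b l j * contr q (a l) (delta U) S))"
    if "U \<subseteq> {1..q}" for U l
    by (auto simp: v_def mat_col_def N_entry_def contr_delta_eq_koszul[OF that] fun_eq_iff)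
  have m_eq: "m (U, k) = (\<Sum>l=1..r. (\<lambda>x. c l k * v (U, l) x))" for U k
  proof (rule ext)
    fix x :: "nat set \<times> nat"
    obtain S j where x: "x = (S, j)" by (cases x)
    have "M_entry (tensor_sum r a b c) q (S, j) (U, k) =
        (\<Sum>i=1..q. \<Sum>l=1..r. c l k * (b l j * (koszul_coeff S U i * a l i)))"
      by (simp add: M_entry_def tensor_sum_def sum_distrib_left mult_ac)
    also have "\<dots> = (\<Sum>l=1..r. c l k * N_entry a b q (S, j) (U, l))"
      by (subst sum.swap) (simp add: N_entry_def sum_distrib_left)
    finally show "m (U, k) x = (\<Sum>l=1..r. (\<lambda>x. c l k * v (U, l) x)) x"
      by (simp add: m_def v_def mat_col_def sum_fun_apply x)
  qed
  have indep: "inj_on v (pivot_cols q p r)" "fun_space.independent (v ` pivot_cols q p r)"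
    using lin_indep_family_mat_col[OF finite_pivot_cols B] by (simp_all add: v_def lin_indep_family_def)
  have v_span: "v (U, l) \<in> fun_space.span (v ` pivot_cols q p r)"
    if U: "U \<subseteq> {1..q}" "card U = p + 1" and l: "l \<in> {1..r}" for U l
  proof (cases "1 \<in> U")
    case True
    then have "(U, l) \<in> pivot_cols q p r" using U l by (simp add: pivot_cols_def subset_idx_def)
    then show ?thesis by (intro fun_space.span_base) blast
  next
    case False
    define d where "d i = - (sgn_pos (insert 1 U) i * a l i) / a l 1" for i
    have fin: "finite U" using U(1) finite_subset by blast
    have W: "insert 1 U - {i} \<subseteq> {1..q}" for i using U(1) q1 by auto
    have "v (U, l) = (\<Sum>i\<in>U. (\<lambda>x. d i * v (insert 1 U - {i}, l) x))"
    proof (rule ext)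
      fix x :: "nat set \<times> nat"
      obtain S j where x: "x = (S, j)" by (cases x)
      have "contr q (a l) (delta U) S = (\<Sum>i\<in>U. d i * contr q (a l) (delta (insert 1 U - {i})) S)"
      proof -
        have "a l 1 * (\<Sum>i\<in>U. d i * contr q (a l) (delta (insert 1 U - {i})) S) = a l 1 * contr q (a l) (delta U) S"
          unfolding contr_delta_relation[OF U(1) q1 False, of "a l" S] sum_distrib_left
          by (rule sum.cong) (use a1[OF l] in \<open>auto simp: d_def\<close>)
        then show ?thesis using a1[OF l] by simp
      qed
      then show "v (U, l) x = (\<Sum>i\<in>U. (\<lambda>x. d i * v (insert 1 U - {i}, l) x)) x"
        by (simp add: v_eq[OF U(1)] v_eq[OF W] x sum_fun_apply sum_distrib_left mult_ac del: One_nat_def)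
    qed
    moreover have "v (insert 1 U - {i}, l) \<in> v ` pivot_cols q p r" if i: "i \<in> U" for i
    proof -
      have "i \<noteq> 1" using i False by auto
      then have "(insert 1 U - {i}, l) \<in> pivot_cols q p r"
        using W[of i] U l fin i False by (auto simp: pivot_cols_def subset_idx_def)
      then show ?thesis by blast
    qed
    ultimately show ?thesis
      by (auto intro!: fun_space.span_sum fun_space.span_scale intro: fun_space.span_base)
  qed
  have "m ` ?C \<subseteq> fun_space.span (v ` pivot_cols q p r)"
    using v_span by (auto simp: m_eq subset_idx_def intro!: fun_space.span_sum fun_space.span_scale)
  then have sub1: "fun_space.span (m ` ?C) \<subseteq> fun_space.span (v ` pivot_cols q p r)"
    by (rule fun_space.span_minimal) (rule fun_space.subspace_span)
  have m_span: "v (V0, l0) \<in> fun_space.span (m ` ?C)" if V0l0: "(V0, l0) \<in> pivot_cols q p r" for V0 l0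
  proof -
    have V0: "V0 \<subseteq> {1..q}" "card V0 = p + 1" "1 \<in> V0" and l0: "l0 \<in> {1..r}"
      using V0l0 by (auto simp: pivot_cols_def subset_idx_def)
    \<comment> \<open>The target is supported at the pivot complementary to \<open>(V0, l0)\<close>;
      its value is fitted to the reduced equation at \<open>V0\<close>.\<close>
    define z where "z = (\<lambda>(U', l). of_bool (l = l0 \<and> insert 1 ({1..q} - U') = V0) * (sum_sign V0 * a l 1))"
    obtain w' where w': "\<And>U' l. (U', l) \<in> pivot_cols q p' r \<Longrightarrow>
        (\<Sum>i\<in>subset_idx q p' n3. w' i * N_entry a c q i (U', l)) = z (U', l)"
      using col_indep_solve[OF finite_subset_idx finite_pivot_cols B', of z] by blast
    define W' where "W' l S = (\<Sum>k=1..n3. w' (S, k) * c l k)" for l S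
    let ?Up = "{U. U \<subseteq> {1..q} \<and> card U = p + 1}" and ?Sp = "{S. S \<subseteq> {1..q} \<and> card S = p'}"
    have w'_sum: "(\<Sum>i\<in>U'. sgn_pos U' i * a l i * W' l (U' - {i})) = z (U', l)"
      if U': "U' \<subseteq> {1..q}" "card U' = p' + 1" "1 \<in> U'" and l: "l \<in> {1..r}" for U' l
    proof -
      have fin: "finite U'" using U'(1) finite_subset by blast
      have idx: "subset_idx q p' n3 = ?Sp \<times> {1..n3}" by (auto simp: subset_idx_def)
      have "z (U', l) = (\<Sum>S\<in>?Sp. \<Sum>k=1..n3. w' (S, k) * N_entry a c q (S, k) (U', l))"
        using w'[of U' l] U' l unfolding idx sum.cartesian_product
        by (simp add: pivot_cols_def subset_idx_def case_prod_unfold)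
      also have "\<dots> = (\<Sum>S\<in>?Sp. contr q (a l) (delta U') S * W' l S)"
        by (intro sum.cong refl)
          (simp add: N_entry_def contr_delta_eq_koszul[OF U'(1)] W'_def sum_distrib_left sum_distrib_right mult_ac)
      also have "\<dots> = (\<Sum>S\<in>?Sp. \<Sum>i\<in>U'. (sgn_pos U' i * a l i) * (delta (U' - {i}) S * W' l S))"
        by (simp add: contr_delta[OF U'(1)] sum_distrib_right mult.assoc)
      also have "\<dots> = (\<Sum>i\<in>U'. (sgn_pos U' i * a l i) * (\<Sum>S\<in>?Sp. delta (U' - {i}) S * W' l S))"
        by (subst sum.swap) (simp add: sum_distrib_left)
      also have "\<dots> = (\<Sum>i\<in>U'. sgn_pos U' i * a l i * W' l (U' - {i}))"
      proof (rule sum.cong[OF refl])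
        fix i assume i: "i \<in> U'"
        have "U' - {i} \<in> ?Sp" using U' fin i by auto
        then have "(\<Sum>S\<in>?Sp. delta (U' - {i}) S * W' l S) = (\<Sum>S\<in>{U' - {i}}. delta (U' - {i}) S * W' l S)"
          by (intro sum.mono_neutral_right) (auto simp: delta_def)
        then show "sgn_pos U' i * a l i * (\<Sum>S\<in>?Sp. delta (U' - {i}) S * W' l S) =
            sgn_pos U' i * a l i * W' l (U' - {i})" by (simp add: delta_def)
      qed
      finally show ?thesis by simp
    qed
    \<comment> \<open>Complementing subsets and inserting the sign turns the solution
      \<open>w'\<close> into weights on the columns of \<open>M\<close>.\<close>
    define w where "w = (\<lambda>(U, k). sum_sign U * w' ({1..q} - U, k))"
    define W where "W l U = of_bool (U \<in> ?Up) * (\<Sum>k=1..n3. w (U, k) * c l k)" for l U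
    have W_eq: "W l U = sum_sign U * W' l ({1..q} - U)" if "U \<in> ?Up" for l U
      using that by (simp add: W_def W'_def w_def sum_distrib_left mult.assoc)
    \<comment> \<open>The forms \<open>W l\<close> need to match the desired ones only after
      contraction by \<open>a l\<close>, since that is all the columns \<open>v\<close> see.\<close>
    have key: "contr q (a l) (W l) S = of_bool (l = l0) * contr q (a l) (delta V0) S"
      if l: "l \<in> {1..r}" for l S
    proof -
      define Z where "Z U = W l U - of_bool (l = l0) * delta V0 U" for U
      have "contr q (a l) Z S = 0"
      proof (rule contr_zero_if_reduced_zero[where a = "a l", OF _ a1[OF l] q1])
        show "form q (p + 1) Z"
          using V0 by (auto simp: form_def Z_def W_def delta_def split: if_splits)
        fix V assume V: "V \<subseteq> {1..q}" "card V = p + 1" "1 \<in> V"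
        have finV: "finite V" using V(1) finite_subset by blast
        \<comment> \<open>The reduced equation at \<open>V\<close> is the solved equation at this
          \<open>U'\<close>: the elements of \<open>U' - {1}\<close> are those missing from
          \<open>V\<close>, and the term of index \<open>1\<close> becomes the left-hand
          side.\<close>
        define U' where "U' = insert 1 ({1..q} - V)"
        have U'sub: "U' \<subseteq> {1..q}" "1 \<in> U'" using q1 by (auto simp: U'_def)
        have cU': "card U' = p' + 1"
          using V finV assms(1) by (simp add: U'_def p' card_Diff_subset)
        have compl: "insert 1 ({1..q} - U') = V" using V by (auto simp: U'_def)
        have U1: "U' - {1} = {1..q} - V" using V by (auto simp: U'_def)
        have Zi: "Z (insert i V - {1}) = sum_sign V * (-1) ^ (i - 1) * W' l (U' - {i})"
          if i: "i \<in> {1..q} - V" for i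
        proof -
          have "i \<noteq> 1" using i V by auto
          have mem: "insert i V - {1} \<in> ?Up" using i V finV by auto
          have "delta V0 (insert i V - {1}) = 0" using V0(3) by (auto simp: delta_def)
          moreover have "{1..q} - (insert i V - {1}) = U' - {i}"
            using q1 V i \<open>i \<noteq> 1\<close> by (auto simp: U'_def)
          ultimately show ?thesis
            using W_eq[OF mem, of l] sum_sign_exchange[OF finV V(3), of i] i by (simp add: Z_def)
        qed
        have "(\<Sum>i\<in>{1..q} - V. sgn_pos V i * a l i * Z (insert i V - {1})) =
            (\<Sum>i\<in>{1..q} - V. - sum_sign V * (sgn_pos U' i * a l i * W' l (U' - {i})))"
        proof (rule sum.cong[OF refl])
          fix i assume i: "i \<in> {1..q} - V"
          have sq: "((-1::real) ^ (i - 1)) * (-1) ^ (i - 1) = 1" by (simp flip: power_add mult_2)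
          have "sgn_pos V i = - (sgn_pos U' i * (-1) ^ (i - 1))"
            using sgn_pos_complement[OF V(1,3) i] by (simp add: U'_def)
          then have "sgn_pos V i * (-1) ^ (i - 1) = - (sgn_pos U' i * ((-1) ^ (i - 1) * (-1) ^ (i - 1)))"
            by (simp only: mult_minus_left mult.assoc)
          then have "sgn_pos V i * (-1) ^ (i - 1) = - sgn_pos U' i" by (simp only: sq mult_1_right)
          then have "(sgn_pos V i * (-1) ^ (i - 1)) * (a l i * sum_sign V * W' l (U' - {i})) =
              - sgn_pos U' i * (a l i * sum_sign V * W' l (U' - {i}))" by simp
          then show "sgn_pos V i * a l i * Z (insert i V - {1}) =
              - sum_sign V * (sgn_pos U' i * a l i * W' l (U' - {i}))"
            unfolding Zi[OF i] by (simp only: mult_ac mult_minus_left mult_minus_right)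
        qed
        also have "\<dots> = - sum_sign V * (\<Sum>i\<in>U' - {1}. sgn_pos U' i * a l i * W' l (U' - {i}))"
          unfolding U1 sum_distrib_left ..
        also have "(\<Sum>i\<in>U' - {1}. sgn_pos U' i * a l i * W' l (U' - {i})) =
            z (U', l) - a l 1 * W' l ({1..q} - V)"
        proof -
          have "finite U'" using U'sub(1) finite_subset by blast
          have s1: "sgn_pos U' 1 = 1" using U'sub(1) by (rule sgn_pos_one)
          have "z (U', l) = sgn_pos U' 1 * a l 1 * W' l (U' - {1}) +
              (\<Sum>i\<in>U' - {1}. sgn_pos U' i * a l i * W' l (U' - {i}))"
            using w'_sum[OF U'sub(1) cU' U'sub(2) l] sum.remove[OF \<open>finite U'\<close> U'sub(2)] by metis
          then show ?thesis unfolding s1 U1 by simp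
        qed
        also have "- sum_sign V * (z (U', l) - a l 1 * W' l ({1..q} - V)) = a l 1 * Z V"
        proof -
          have "W l V = sum_sign V * W' l ({1..q} - V)" using V by (intro W_eq) simp
          moreover have "sum_sign V * z (U', l) = of_bool (l = l0) * delta V0 V * a l 1"
            unfolding z_def using compl by (auto simp: delta_def mult.assoc[symmetric])
          ultimately show ?thesis by (simp add: Z_def algebra_simps)
        qed
        finally show "a l 1 * Z V = (\<Sum>i\<in>{1..q} - V. sgn_pos V i * a l i * Z (insert i V - {1}))" by simp
      qed
      then show ?thesis unfolding Z_def by (simp add: contr_diff contr_scale)
    qed
    have "v (V0, l0) = (\<Sum>c\<in>?C. (\<lambda>x. w c * m c x))"
    proof (rule ext)
      fix x :: "nat set \<times> nat"
      obtain S j where x: "x = (S, j)" by (cases x)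
      let ?e = "of_bool ((S, j) \<in> ?R) :: real"
      have idx: "?C = ?Up \<times> {1..n3}" by (auto simp: subset_idx_def)
      have "(\<Sum>c\<in>?C. w c * m c x) = (\<Sum>U\<in>?Up. \<Sum>k=1..n3. w (U, k) * m (U, k) x)"
        unfolding idx sum.cartesian_product by (rule sum.cong) auto
      also have "\<dots> = (\<Sum>U\<in>?Up. \<Sum>k=1..n3. \<Sum>l=1..r. (w (U, k) * c l k) * v (U, l) x)"
        by (simp add: m_eq sum_fun_apply sum_distrib_left mult.assoc)
      also have "\<dots> = (\<Sum>U\<in>?Up. \<Sum>l=1..r. W l U * v (U, l) x)"
        by (rule sum.cong[OF refl], subst sum.swap) (simp add: W_def sum_distrib_right)
      also have "\<dots> = (\<Sum>U\<in>?Up. \<Sum>l=1..r. ?e * b l j * (contr q (a l) (delta U) S * W l U))"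
        by (intro sum.cong refl) (simp add: v_eq x mult_ac)
      also have "\<dots> = (\<Sum>l=1..r. ?e * b l j * (\<Sum>U\<in>?Up. contr q (a l) (delta U) S * W l U))"
        by (subst sum.swap) (simp add: sum_distrib_left)
      also have "\<dots> = (\<Sum>l=1..r. ?e * b l j * contr q (a l) (W l) S)"
      proof (rule sum.cong[OF refl])
        fix l
        have "contr q (a l) (W l) S = (\<Sum>U\<in>Pow {1..q}. (\<Sum>i=1..q. koszul_coeff S U i * a l i) * W l U)"
          by (rule contr_koszul) (auto simp: W_def split: if_splits)
        also have "\<dots> = (\<Sum>U\<in>?Up. contr q (a l) (delta U) S * W l U)"
          by (rule sum.mono_neutral_cong_right) (auto simp: W_def contr_delta_eq_koszul)
        finally show "?e * b l j * (\<Sum>U\<in>?Up. contr q (a l) (delta U) S * W l U) = ?e * b l j * contr q (a l) (W l) S"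
          by simp
      qed
      also have "\<dots> = (\<Sum>l=1..r. if l = l0 then v (V0, l0) x else 0)"
        by (rule sum.cong[OF refl]) (simp add: key v_eq[OF V0(1)] x)
      also have "\<dots> = v (V0, l0) x" using l0 by simp
      finally show "v (V0, l0) x = (\<Sum>c\<in>?C. (\<lambda>x. w c * m c x)) x" by (simp add: sum_fun_apply)
    qed
    then show ?thesis
      by (auto intro!: fun_space.span_sum fun_space.span_scale intro: fun_space.span_base)
  qed
  have "v ` pivot_cols q p r \<subseteq> fun_space.span (m ` ?C)" using m_span by auto
  then have sub2: "fun_space.span (v ` pivot_cols q p r) \<subseteq> fun_space.span (m ` ?C)"
    by (rule fun_space.span_minimal) (rule fun_space.subspace_span)
  have "fun_space.dim (m ` ?C) = card (v ` pivot_cols q p r)"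
    using sub1 sub2 by (intro fun_space.dim_eq_card indep) auto
  then show ?thesis
    using indep(1) card_pivot_cols[OF q1] by (simp add: mat_rank_def m_def card_image)
qed

section \<open>The matrix P and dimension counts\<close>

lemma poly_eq_sum_pred:
  fixes f :: "real poly"
  assumes "degree f < d"
  shows "poly f t = (\<Sum>i=1..d. coeff f (i - 1) * mom t i)"
proof -
  obtain e where e: "d = e + 1" using assms by (cases d) auto
  have "poly f t = (\<Sum>j\<le>e. coeff f j * t ^ j)" using assms e by (intro poly_eq_sum_le) simp
  also have "\<dots> = (\<Sum>i=1..d. coeff f (i - 1) * t ^ (i - 1))"
    unfolding e by (rule sum_shift_pred[symmetric])
  finally show ?thesis by (simp add: mom_def)
qed

text \<open>Combining the equations with the coefficients of the polynomial vanishing on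
  \<open>L - {l}\<close> isolates \<open>y l\<close>; its degree \<open>card L - 1\<close> is below
  \<open>d\<close>.\<close>

lemma vandermonde_dual:
  fixes L :: "nat set"
  assumes "finite L" "card L \<le> d" "\<And>i. i \<in> {1..d} \<Longrightarrow> (\<Sum>l\<in>L. mom (real l) i * y l) = 0" "l \<in> L"
  shows "y l = 0"
proof -
  define f where "f = root_poly (real ` (L - {l}))"
  have fin: "finite (real ` (L - {l}))" using assms(1) by simp
  have "card L > 0" using assms(1,4) card_gt_0_iff by blast
  then have "degree f < d"
    using assms(1,2,4) by (simp add: f_def degree_root_poly[OF fin] card_image)
  have "0 = (\<Sum>i=1..d. coeff f (i - 1) * (\<Sum>l\<in>L. mom (real l) i * y l))"
    using assms(3) by simp
  also have "\<dots> = (\<Sum>k\<in>L. poly f (real k) * y k)"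
    unfolding poly_eq_sum_pred[OF \<open>degree f < d\<close>] sum_distrib_left sum_distrib_right
    by (subst sum.swap) (simp add: mult.assoc)
  also have "\<dots> = (\<Sum>k\<in>{l}. poly f (real k) * y k)"
    by (rule sum.mono_neutral_right) (use assms(1,4) in \<open>auto simp: f_def poly_root_poly_eq_0_iff[OF fin]\<close>)
  finally show ?thesis by (auto simp: f_def poly_root_poly_eq_0_iff[OF fin])
qed

lemma mom_pair_col_indep:
  assumes "2 \<le> d"
  shows "col_indep {1..d} {l, m} (\<lambda>i l. mom (real l) i)"
proof (rule col_indepI)
  fix y j assume "\<And>i. i \<in> {1..d} \<Longrightarrow> (\<Sum>j\<in>{l, m}. mom (real j) i * y j) = 0" "j \<in> {l, m}"
  moreover have "card {l, m} \<le> d" using assms card_insert_le_m1[of 2 "{m}" l] by simp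
  ultimately show "y j = 0" by (intro vandermonde_dual[of "{l, m}" d y]) auto
qed

lemma tensor_col_indep:
  assumes "0 < m" "0 < s" "s \<le> d" "r \<le> s * (n div m)"
  shows "col_indep ({1..d} \<times> {1..n}) {1..r} (\<lambda>(i, j) l. mom (real l) i * block_vec m s l j)"
proof (rule col_indepI)
  fix y l0
  assume rows: "\<And>ij. ij \<in> {1..d} \<times> {1..n} \<Longrightarrow>
      (\<Sum>l=1..r. (case ij of (i, j) \<Rightarrow> \<lambda>l. mom (real l) i * block_vec m s l j) l * y l) = 0"
    and l0: "l0 \<in> {1..r}"
  define g where "g = (l0 - 1) div s"
  have g: "g < n div m" unfolding g_def using l0 assms(4) by (rule block_index_less)
  define L where "L = {l\<in>{1..r}. (l - 1) div s = g}"
  show "y l0 = 0"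
  proof (rule vandermonde_dual[of L d])
    show "finite L" "l0 \<in> L" using l0 by (auto simp: L_def g_def)
    show "card L \<le> d" using card_block_le[OF assms(2), of r g] assms(3) by (simp add: L_def)
    fix i assume i: "i \<in> {1..d}"
    \<comment> \<open>At offset \<open>0\<close> of its run \<open>block_vec\<close> equals
      \<open>1\<close> on the whole block, which leaves a Vandermonde system in
      \<open>a\<close>.\<close>
    let ?j = "g * m + 0 + 1"
    have "(i, ?j) \<in> {1..d} \<times> {1..n}" using block_vec_row(1)[OF assms(1) g] i by blast
    from rows[OF this] have "0 = (\<Sum>l=1..r. mom (real l) i * block_vec m s l ?j * y l)"
      by (simp only: case_prod_conv)
    also have "\<dots> = (\<Sum>l\<in>L. mom (real l) i * y l)"
      unfolding block_vec_row(2)[OF assms(1) g]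
      by (rule sum.mono_neutral_cong_right) (auto simp: L_def)
    finally show "(\<Sum>l\<in>L. mom (real l) i * y l) = 0" by simp
  qed
qed

lemma finite_P_cols [simp]: "finite (P_cols r)"
  by (rule finite_subset[of _ "{1..r} \<times> {1..r}"]) (auto simp: P_cols_def)

text \<open>A column of \<open>P\<close> is the wedge of two \<open>a\<close> vectors tensored with
  the wedge of the two \<open>b\<close> vectors.\<close>

lemma P_entry_eq_minors:
  "P_entry a b (i1, i2, j1, j2) (l, k) =
    (a l i1 * a k i2 - a k i1 * a l i2) * (b l j1 * b k j2 - b l j2 * b k j1)"
  by (simp add: P_entry_def algebra_simps)

text \<open>Wedges of independent vectors are independent; the dual vectors used for testing are the
  coefficients of polynomials vanishing at all but one point of \<open>L\<close>.\<close>

lemma wedge_col_indep: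
  fixes \<beta> :: "nat \<Rightarrow> nat \<Rightarrow> real"
  assumes L: "finite L" "card L \<le> d"
    and \<beta>: "\<And>l k. (l, k) \<in> P_cols r \<Longrightarrow> \<beta> l k \<noteq> 0 \<Longrightarrow> l \<in> L \<and> k \<in> L"
    and rows: "\<And>i1 i2. 1 \<le> i1 \<Longrightarrow> i1 < i2 \<Longrightarrow> i2 \<le> d \<Longrightarrow>
      (\<Sum>(l, k)\<in>P_cols r. (mom (real l) i1 * mom (real k) i2 - mom (real k) i1 * mom (real l) i2) * \<beta> l k) = 0"
    and lk: "(l0, k0) \<in> P_cols r"
  shows "\<beta> l0 k0 = 0"
proof (rule ccontr)
  assume nz: "\<beta> l0 k0 \<noteq> 0"
  then have mem: "l0 \<in> L" "k0 \<in> L" using \<beta> lk by blast+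
  have less: "l0 < k0" using lk by (simp add: P_cols_def)
  define X where "X i1 i2 = (\<Sum>(l, k)\<in>P_cols r.
    (mom (real l) i1 * mom (real k) i2 - mom (real k) i1 * mom (real l) i2) * \<beta> l k)" for i1 i2
  \<comment> \<open>Antisymmetry extends the equations from \<open>i1 < i2\<close> to all pairs, so
    the double sum factors into values of \<open>f\<close> and \<open>h\<close>.\<close>
  have anti: "X i2 i1 = - X i1 i2" for i1 i2
    unfolding X_def sum_negf[symmetric] by (rule sum.cong) (auto simp: algebra_simps)
  have X0: "X i1 i2 = 0" if "i1 \<in> {1..d}" "i2 \<in> {1..d}" for i1 i2
  proof (cases i1 i2 rule: linorder_cases)
    case less
    then show ?thesis using rows[of i1 i2] that by (simp add: X_def)
  next
    case equal
    then show ?thesis using anti[of i1 i1] by simp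
  next
    case greater
    then show ?thesis using rows[of i2 i1] that anti[of i1 i2] by (simp add: X_def)
  qed
  define f h where "f = root_poly (real ` (L - {l0}))" and "h = root_poly (real ` (L - {k0}))"
  have fin: "finite (real ` (L - {x}))" for x using L by simp
  have "card L > 0" using mem L card_gt_0_iff by blast
  then have deg: "degree f < d" "degree h < d"
    using L mem by (simp_all add: f_def h_def degree_root_poly[OF fin] card_image)
  have f0: "poly f (real l) = 0 \<longleftrightarrow> l \<noteq> l0" and h0: "poly h (real l) = 0 \<longleftrightarrow> l \<noteq> k0" if "l \<in> L" for l
    using that by (auto simp: f_def h_def poly_root_poly_eq_0_iff[OF fin])
  have "0 = (\<Sum>i1=1..d. \<Sum>i2=1..d. coeff f (i1 - 1) * coeff h (i2 - 1) * X i1 i2)"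
    using X0 by simp
  also have "\<dots> = (\<Sum>i1=1..d. \<Sum>i2=1..d. \<Sum>(l, k)\<in>P_cols r. \<beta> l k *
      ((coeff f (i1 - 1) * mom (real l) i1) * (coeff h (i2 - 1) * mom (real k) i2) -
       (coeff f (i1 - 1) * mom (real k) i1) * (coeff h (i2 - 1) * mom (real l) i2)))"
    unfolding X_def sum_distrib_left
    by (intro sum.cong refl) (simp add: case_prod_unfold algebra_simps)
  also have "\<dots> = (\<Sum>(l, k)\<in>P_cols r. \<Sum>i1=1..d. \<Sum>i2=1..d. \<beta> l k *
      ((coeff f (i1 - 1) * mom (real l) i1) * (coeff h (i2 - 1) * mom (real k) i2) -
       (coeff f (i1 - 1) * mom (real k) i1) * (coeff h (i2 - 1) * mom (real l) i2)))"
    unfolding case_prod_unfold by (subst (2) sum.swap, subst sum.swap) (rule refl)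
  also have "\<dots> = (\<Sum>(l, k)\<in>P_cols r. \<beta> l k *
      (poly f (real l) * poly h (real k) - poly f (real k) * poly h (real l)))"
    unfolding poly_eq_sum_pred[OF deg(1)] poly_eq_sum_pred[OF deg(2)] sum_product case_prod_unfold
    by (rule sum.cong[OF refl]) (simp add: right_diff_distrib sum_subtractf sum_distrib_left)
  also have "\<dots> = (\<Sum>(l, k)\<in>{(l0, k0)}. \<beta> l k *
      (poly f (real l) * poly h (real k) - poly f (real k) * poly h (real l)))"
  proof (rule sum.mono_neutral_right)
    show "\<forall>x\<in>P_cols r - {(l0, k0)}. (case x of (l, k) \<Rightarrow> \<beta> l k *
        (poly f (real l) * poly h (real k) - poly f (real k) * poly h (real l))) = 0"
    proof
      fix lk assume "lk \<in> P_cols r - {(l0, k0)}"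
      then obtain l k where lk': "lk = (l, k)" and x: "(l, k) \<in> P_cols r" "(l, k) \<noteq> (l0, k0)"
        by (cases lk) auto
      have lt: "l < k" using x by (simp add: P_cols_def)
      have "\<beta> l k * (poly f (real l) * poly h (real k) - poly f (real k) * poly h (real l)) = 0"
      proof (cases "\<beta> l k = 0")
        case False
        then have m: "l \<in> L" "k \<in> L" using \<beta>[OF x(1)] by blast+
        have "poly f (real l) * poly h (real k) = 0" using f0[OF m(1)] h0[OF m(2)] x(2) by auto
        \<comment> \<open>The transposed term could survive only for \<open>k = l0\<close> and
          \<open>l = k0\<close>, against \<open>l < k\<close> and \<open>l0 < k0\<close>.\<close>
        moreover have "poly f (real k) * poly h (real l) = 0"
          using f0[OF m(2)] h0[OF m(1)] lt less by auto
        ultimately show ?thesis by (simp only: diff_zero mult_zero_right)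
      qed simp
      then show "(case lk of (l, k) \<Rightarrow> \<beta> l k *
        (poly f (real l) * poly h (real k) - poly f (real k) * poly h (real l))) = 0"
        by (simp only: lk' case_prod_conv)
    qed
  qed (use lk in auto)
  also have "\<dots> = \<beta> l0 k0 * (poly f (real l0) * poly h (real k0))"
    using f0[OF mem(2)] less by simp
  finally show False using nz f0[OF mem(1)] h0[OF mem(2)] by simp
qed

text \<open>For each pair of indices, two coordinates are chosen whose \<open>b\<close> minor is
  nonzero at this pair and vanishes for pairs not contained in the union of its at most two blocks;
  the wedges of the \<open>a\<close> vectors then separate the remaining pairs.\<close>

lemma P_col_indep:
  assumes "2 \<le> d" "r \<le> (d div 2) * (n div 2)"
  shows "col_indep (P_rows d n) (P_cols r) (P_entry (\<lambda>l. mom (real l)) (block_vec 2 (d div 2)))"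
proof (rule col_indepI)
  let ?s = "d div 2" let ?a = "\<lambda>l. mom (real l)" let ?b = "block_vec 2 ?s"
  fix y c
  assume rows: "\<And>i. i \<in> P_rows d n \<Longrightarrow> (\<Sum>c\<in>P_cols r. P_entry ?a ?b i c * y c) = 0"
    and c: "c \<in> P_cols r"
  obtain l0 k0 where c_eq: "c = (l0, k0)" by (cases c)
  have lk: "1 \<le> l0" "l0 < k0" "k0 \<le> r" using c by (auto simp: P_cols_def c_eq)
  have s: "0 < ?s" using assms(1) by simp
  define g where "g l = (l - 1) div ?s" for l
  have g_less: "g l < n div 2" if "l \<in> {1..r}" for l
    unfolding g_def using that assms(2) by (rule block_index_less)
  have g_mono: "g l \<le> g k" if "l \<le> k" for l k
    unfolding g_def using that by (intro div_le_mono) simp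
  \<comment> \<open>Two indices of one block use both coordinates of its plane, with minor
    \<open>k0 - l0\<close>; indices of different blocks use the first coordinate of each plane, with
    minor \<open>1\<close>.\<close>
  define t where "t = (if g l0 = g k0 then 1 else 0 :: nat)"
  define j1 j2 where "j1 = g l0 * 2 + 0 + 1" and "j2 = g k0 * 2 + t + 1"
  have gl: "g l0 < n div 2" "g k0 < n div 2" using g_less lk by auto
  have t2: "t < 2" by (simp add: t_def)
  have j1: "j1 \<in> {1..n}" "?b l j1 = (if g l = g l0 then 1 else 0)" for l
    using block_vec_row[of 0 2 "g l0" n] gl by (auto simp: j1_def g_def)
  have j2: "j2 \<in> {1..n}" "?b l j2 = (if g l = g k0 then real l ^ t else 0)" for l
    using block_vec_row[OF t2 gl(2)] by (auto simp: j2_def g_def)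
  have j12: "j1 < j2" using g_mono[of l0 k0] lk by (auto simp: j1_def j2_def t_def)
  define \<beta> where "\<beta> l k = (?b l j1 * ?b k j2 - ?b l j2 * ?b k j1) * y (l, k)" for l k
  define L where "L = {l\<in>{1..r}. g l = g l0} \<union> {l\<in>{1..r}. g l = g k0}"
  have "\<beta> l0 k0 = 0"
  proof (rule wedge_col_indep)
    show "finite L" by (simp add: L_def)
    have "card L \<le> card {l\<in>{1..r}. g l = g l0} + card {l\<in>{1..r}. g l = g k0}"
      unfolding L_def by (rule card_Un_le)
    also have "\<dots> \<le> ?s + ?s"
      unfolding g_def by (intro add_mono card_block_le s)
    finally show "card L \<le> d" by simp
    show "(l0, k0) \<in> P_cols r" using c c_eq by simp
    show "l \<in> L \<and> k \<in> L" if "(l, k) \<in> P_cols r" "\<beta> l k \<noteq> 0" for l k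
      using that by (auto simp: \<beta>_def L_def P_cols_def j1 j2 split: if_splits)
    fix i1 i2 :: nat assume i: "1 \<le> i1" "i1 < i2" "i2 \<le> d"
    have "(i1, i2, j1, j2) \<in> P_rows d n" using i j1(1) j2(1) j12 by (simp add: P_rows_def)
    from rows[OF this]
    have "(\<Sum>c\<in>P_cols r. P_entry ?a ?b (i1, i2, j1, j2) c * y c) = 0" .
    also have "(\<Sum>c\<in>P_cols r. P_entry ?a ?b (i1, i2, j1, j2) c * y c) =
      (\<Sum>(l, k)\<in>P_cols r. (mom (real l) i1 * mom (real k) i2 - mom (real k) i1 * mom (real l) i2) * \<beta> l k)"
      by (intro sum.cong refl) (auto simp: P_entry_eq_minors \<beta>_def)
    finally show "(\<Sum>(l, k)\<in>P_cols r.
      (mom (real l) i1 * mom (real k) i2 - mom (real k) i1 * mom (real l) i2) * \<beta> l k) = 0" .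
  qed
  moreover have "?b l0 j1 * ?b k0 j2 - ?b l0 j2 * ?b k0 j1 \<noteq> 0"
    using lk by (auto simp: j1 j2 t_def)
  ultimately show "y c = 0" by (simp add: \<beta>_def c_eq)
qed

text \<open>Writing \<open>l - 1\<close> in base \<open>n3\<close> sends distinct indices to
  distinct matrix units.\<close>

lemma unit_tensor_col_indep:
  assumes "r \<le> n2 * n3"
  shows "col_indep ({1..n2} \<times> {1..n3}) {1..r}
    (\<lambda>(j, k) l. unit_vec ((l - 1) div n3 + 1) j * unit_vec ((l - 1) mod n3 + 1) k)"
proof (rule col_indepI)
  fix y l0
  assume rows: "\<And>jk. jk \<in> {1..n2} \<times> {1..n3} \<Longrightarrow> (\<Sum>l=1..r. (case jk of (j, k) \<Rightarrow>
      \<lambda>l. unit_vec ((l - 1) div n3 + 1) j * unit_vec ((l - 1) mod n3 + 1) k) l * y l) = 0"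
    and l0: "l0 \<in> {1..r}"
  let ?j = "(l0 - 1) div n3 + 1" and ?k = "(l0 - 1) mod n3 + 1"
  have n3: "0 < n3" using l0 assms by (cases n3) auto
  have "?j \<in> {1..n2}" using block_index_less[of l0 r n3 n2] l0 assms by (simp add: mult.commute)
  moreover have "?k \<in> {1..n3}" using n3 mod_less_divisor[OF n3, of "l0 - 1"] by simp
  ultimately have "0 = (\<Sum>l=1..r. unit_vec ((l - 1) div n3 + 1) ?j * unit_vec ((l - 1) mod n3 + 1) ?k * y l)"
    using rows[of "(?j, ?k)"] by simp
  also have "\<dots> = (\<Sum>l=1..r. if l = l0 then y l else 0)"
  proof (rule sum.cong[OF refl])
    fix l assume l: "l \<in> {1..r}"
    have "l = l0" if "(l - 1) div n3 = (l0 - 1) div n3" "(l - 1) mod n3 = (l0 - 1) mod n3"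
    proof -
      have "l - 1 = l0 - 1" using that div_mult_mod_eq[of "l - 1" n3] div_mult_mod_eq[of "l0 - 1" n3] by metis
      then show ?thesis using l l0 by auto
    qed
    then show "unit_vec ((l - 1) div n3 + 1) ?j * unit_vec ((l - 1) mod n3 + 1) ?k * y l = (if l = l0 then y l else 0)"
      by (auto simp: unit_vec_def)
  qed
  also have "\<dots> = y l0" using l0 by simp
  finally show "y l0 = 0" by simp
qed

lemma finite_N_cols [simp]: "finite (N_cols q s r)"
  by (rule finite_subset[OF _ finite_subset_idx[of q "s + 1" r]]) (auto simp: N_cols_def)

lemma N_entry_polyfun:
  assumes "\<And>l i. l \<in> {1..r} \<Longrightarrow> i \<in> {1..q} \<Longrightarrow> polyfun V (\<lambda>x. a x l i)"
    and "\<And>l j. l \<in> {1..r} \<Longrightarrow> j \<in> {1..n} \<Longrightarrow> polyfun V (\<lambda>x. b x l j)"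
    and "R \<in> N_rows q s n" "C \<in> N_cols q s r"
  shows "polyfun V (\<lambda>x. N_entry (a x) (b x) q R C)"
proof -
  obtain S j U l where "R = (S, j)" "C = (U, l)" "j \<in> {1..n}" "l \<in> {1..r}"
    using assms(3,4) by (auto simp: N_rows_def N_cols_def subset_idx_def)
  then show ?thesis
    by (auto simp: N_entry_def intro!: polyfun.mult polyfun_sum polyfun.const assms(1,2))
qed

lemma P_entry_polyfun:
  assumes "\<And>l i. l \<in> {1..r} \<Longrightarrow> i \<in> {1..d} \<Longrightarrow> polyfun V (\<lambda>x. a x l i)"
    and "\<And>l j. l \<in> {1..r} \<Longrightarrow> j \<in> {1..n} \<Longrightarrow> polyfun V (\<lambda>x. b x l j)"
    and "R \<in> P_rows d n" "C \<in> P_cols r"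
  shows "polyfun V (\<lambda>x. P_entry (a x) (b x) R C)"
proof -
  obtain i1 i2 j1 j2 l k where "R = (i1, i2, j1, j2)" "C = (l, k)"
    "i1 \<in> {1..d}" "i2 \<in> {1..d}" "j1 \<in> {1..n}" "j2 \<in> {1..n}" "l \<in> {1..r}" "k \<in> {1..r}"
    using assms(3,4) by (auto simp: P_rows_def P_cols_def)
  then show ?thesis
    by (auto simp: P_entry_eq_minors intro!: polyfun.mult polyfun_diff assms(1,2))
qed

lemma tensor_polyfun:
  assumes "\<And>l i. l \<in> {1..r} \<Longrightarrow> i \<in> {1..d} \<Longrightarrow> polyfun V (\<lambda>x. a x l i)"
    and "\<And>l j. l \<in> {1..r} \<Longrightarrow> j \<in> {1..n} \<Longrightarrow> polyfun V (\<lambda>x. b x l j)"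
    and "R \<in> {1..d} \<times> {1..n}" "l \<in> {1..r}"
  shows "polyfun V (\<lambda>x. (case R of (i, j) \<Rightarrow> \<lambda>l. a x l i * b x l j) l)"
  using assms(3,4) by (auto intro!: polyfun.mult assms(1,2))

lemma first_coords_mat_col: "(\<lambda>l. first_coords n (a l)) = mat_col {1..n} (\<lambda>i l. a l i)"
  by (auto simp: first_coords_def mat_col_def fun_eq_iff)

lemma tensor2_mat_col:
  "(\<lambda>l. tensor2 (first_coords m (a l)) (first_coords n (b l))) =
    mat_col ({1..m} \<times> {1..n}) (\<lambda>(i, j) l. a l i * b l j)"
  by (auto simp: tensor2_def first_coords_def mat_col_def fun_eq_iff)

section \<open>Integer inequalities extracted from the bounds on \<open>q\<close> and
  \<open>r\<close>\<close>

lemma q_bound: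
  fixes n n' q :: nat and \<alpha> :: real
  assumes "n > 0" "n' > 0" "\<alpha> = max (real n / real n') (real n' / real n)"
    "real q \<ge> (4 + 5 * \<alpha>) * (1 + 1 / \<alpha>)"
  shows "real q * (real n * real n') \<ge> (real n + real n') * (4 * (real n + real n') + max (real n) (real n'))"
proof -
  \<comment> \<open>With \<open>\<alpha> = v / u\<close>, the factor \<open>4 + 5 * \<alpha>\<close>
    is \<open>(4 * (u + v) + v) / u\<close> and \<open>1 + 1 / \<alpha>\<close> is
    \<open>(u + v) / v\<close>. Below, \<open>v\<close> is the larger of the two numbers.\<close>
  have bound: "real q * (real u * real v) \<ge> (real u + real v) * (4 * (real u + real v) + real v)"
    if uv: "u > 0" "v > 0" "\<alpha> = real v / real u" for u v :: nat
  proof -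
    have "(4 + 5 * \<alpha>) * (1 + 1 / \<alpha>) * (real u * real v) =
        (real u + real v) * (4 * (real u + real v) + real v)"
      using uv(1,2) unfolding uv(3) by (simp add: field_simps)
    then show ?thesis using mult_right_mono[OF assms(4), of "real u * real v"] by simp
  qed
  show ?thesis
  proof (cases "n \<le> n'")
    case True
    then have "real n / real n' \<le> real n' / real n"
      using assms(1,2) by (simp add: frac_le)
    then have "\<alpha> = real n' / real n" using assms(3) by simp
    from bound[OF assms(1,2) this] True show ?thesis by (simp add: max_def)
  next
    case False
    then have "real n' / real n \<le> real n / real n'"
      using assms(1,2) by (simp add: frac_le)
    then have "\<alpha> = real n / real n'" using assms(3) by simp
    from bound[OF assms(2,1) this] False show ?thesis by (simp add: max_def mult.commute add.commute)
  qed
qed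

text \<open>For \<open>m\<close> equal to \<open>q - p\<close> or \<open>p + 1\<close>, the quotient
  \<open>n / m\<close> is at least \<open>(n + n') / (q + 1 + \<alpha>)\<close>. Rounding down loses
  less than one block of \<open>q - 1\<close> indices, which \<open>q ^ 3 / 4\<close>
  covers.\<close>

lemma N_count:
  fixes n n' q m r :: nat and \<alpha> :: real
  assumes "n > 0" "real n' / real n \<le> \<alpha>" "0 < m" "2 \<le> q"
    and m: "real m \<le> real q * (real n / (real n + real n')) + 1"
    and r: "real r \<le> (real n + real n') * (1 - (3 + \<alpha>) / real q) - real q ^ 3 / 4"
  shows "r \<le> (q - 1) * (n div m)"
proof -
  define s where "s = real n + real n'"
  have s: "s > 0" using assms(1) by (simp add: s_def)
  have \<alpha>: "\<alpha> \<ge> 0" using assms(2) order_trans[of 0 "real n' / real n"] by simp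
  have n': "real n' \<le> \<alpha> * real n" using assms(1,2) by (simp add: field_simps)
  have "real m * s \<le> (real q * (real n / s) + 1) * s"
    using m s by (intro mult_right_mono) (auto simp: s_def)
  also have "\<dots> = real q * real n + s" using s by (simp add: field_simps)
  also have "\<dots> \<le> real n * (real q + 1 + \<alpha>)" using n' by (simp add: s_def algebra_simps)
  finally have "s / (real q + 1 + \<alpha>) \<le> real n / real m"
    using assms(3) \<alpha> by (simp add: field_simps)
  moreover have "real n / real m < real (n div m) + 1"
  proof -
    have "real n < real (m + n div m * m)"
      using dividend_less_div_times[OF assms(3), of n] by (simp only: of_nat_less_iff)
    then show ?thesis using assms(3) by (simp add: divide_less_eq algebra_simps)
  qed
  ultimately have d: "s / (real q + 1 + \<alpha>) - 1 \<le> real (n div m)" by simp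
  have "1 - (3 + \<alpha>) / real q \<le> (real q - 1) / (real q + 1 + \<alpha>)"
  proof -
    have "(real q - (3 + \<alpha>)) * (real q + 1 + \<alpha>) \<le> (real q - 1) * real q"
    proof -
      have "(real q - 1) * real q - (real q - (3 + \<alpha>)) * (real q + 1 + \<alpha>) = real q + (3 + \<alpha>) * (1 + \<alpha>)"
        by (simp add: algebra_simps)
      moreover have "(3 + \<alpha>) * (1 + \<alpha>) \<ge> 0" using \<alpha> by simp
      ultimately show ?thesis by simp
    qed
    then show ?thesis using \<alpha> assms(4) by (simp add: field_simps)
  qed
  then have "s * (1 - (3 + \<alpha>) / real q) \<le> s * ((real q - 1) / (real q + 1 + \<alpha>))"
    using s by (intro mult_left_mono) auto
  also have "\<dots> = (real q - 1) * (s / (real q + 1 + \<alpha>) - 1) + (real q - 1)"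
  proof -
    have "s * (x / D) = x * (s / D - 1) + x" for x D :: real
      by (simp add: right_diff_distrib mult.commute)
    then show ?thesis .
  qed
  also have "\<dots> \<le> (real q - 1) * real (n div m) + (real q - 1)"
    using d assms(4) by (intro add_right_mono mult_left_mono) auto
  finally have "real r \<le> (real q - 1) * real (n div m) + (real q - 1) - real q ^ 3 / 4" using r by (simp add: s_def)
  moreover have "real q - 1 \<le> real q ^ 3 / 4"
  proof -
    have "2 * 2 * real q \<le> real q * real q * real q" using assms(4) by (intro mult_mono) auto
    then show ?thesis by (simp add: power3_eq_cube)
  qed
  ultimately have "real r \<le> (real q - 1) * real (n div m)" by simp
  also have "\<dots> = real ((q - 1) * (n div m))" using assms(4) by (simp add: of_nat_diff)
  finally show ?thesis by (simp only: of_nat_le_iff)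
qed

text \<open>Rounding leaves \<open>(d - 1) * (n - 1) \<le> 4 * (d div 2) * (n div 2)\<close>. The
  bound on \<open>q\<close> yields \<open>4 * (n + n') + n \<le> d * n\<close>, and the missing
  \<open>d \<le> q ^ 3\<close> is paid by four times \<open>q ^ 3 / 4\<close>.\<close>

lemma P_count:
  fixes n n' q d r :: nat
  assumes "n > 0" "d > 0" "d \<le> q"
    and q: "real q * (real n * real n') \<ge> (real n + real n') * (4 * (real n + real n') + max (real n) (real n'))"
    and d: "real q * (real n' / (real n + real n')) \<le> real d"
    and r: "real r \<le> real n + real n' - real q ^ 3 / 4"
  shows "r \<le> (d div 2) * (n div 2)"
proof -
  define s where "s = real n + real n'"
  have s: "s > 0" using assms(1) by (simp add: s_def)
  have "s * (4 * s + real n) \<le> s * (4 * s + max (real n) (real n'))"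
    using s by (intro mult_left_mono) auto
  also have "\<dots> \<le> real q * (real n' / s) * real n * s" using q s by (simp add: s_def[symmetric] field_simps)
  also have "\<dots> \<le> real d * real n * s" using d s by (intro mult_right_mono) (auto simp: s_def)
  finally have "s * (4 * s + real n) \<le> s * (real d * real n)" by (simp only: mult_ac)
  then have dn: "4 * s + real n \<le> real d * real n" using s by (simp only: mult_le_cancel_left_pos)
  have "real q * 1 \<le> real q * (real q * real q)"
    using assms(2,3) by (intro mult_left_mono) (auto simp: mult_ge1_I)
  then have "real d \<le> real q ^ 3" using assms(3) by (simp add: power3_eq_cube)
  moreover have "4 * x \<le> w - y - z + 1" if "y \<le> k" "x \<le> t - k / 4" "4 * t + z \<le> w" for x y z w k t :: real
    using that by linarith
  ultimately have "4 * real r \<le> real d * real n - real d - real n + 1" using r dn unfolding s_def by blast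
  also have "\<dots> = (real d - 1) * (real n - 1)" by (simp add: algebra_simps)
  finally have "4 * real r \<le> (real d - 1) * (real n - 1)" .
  also have "\<dots> \<le> (2 * real (d div 2)) * (2 * real (n div 2))"
  proof (rule mult_mono)
    show "real d - 1 \<le> 2 * real (d div 2)" "real n - 1 \<le> 2 * real (n div 2)" by linarith+
  qed (use assms(1) in auto)
  finally have "real r \<le> real ((d div 2) * (n div 2))" by simp
  then show ?thesis by (simp only: of_nat_le_iff)
qed

text \<open>\<open>n + n' \<le> n * n'\<close> fails only when a factor is \<open>1\<close>; then
  the bound on \<open>q\<close> makes \<open>q ^ 3 / 4\<close> at least \<open>n + n'\<close>, so
  \<open>r = 0\<close>.\<close>

lemma tensor_count:
  fixes n n' q r :: nat
  assumes "n > 0" "n' > 0" "2 \<le> q"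
    and q: "real q * (real n * real n') \<ge> (real n + real n') * (4 * (real n + real n') + max (real n) (real n'))"
    and r: "real r \<le> real n + real n' - real q ^ 3 / 4"
  shows "r \<le> n * n'"
proof (cases "n = 1 \<or> n' = 1")
  case True
  have "n + n' = 1 + n * n'" using True by auto
  then have prod: "real n + real n' = 1 + real n * real n'" by (metis of_nat_1 of_nat_add of_nat_mult)
  have "(real n + real n') * (4 * (real n + real n')) \<le> (real n + real n') * (4 * (real n + real n') + max (real n) (real n'))"
    by (intro mult_left_mono) auto
  also have "\<dots> \<le> real q * (real n * real n')" by (rule q)
  also have "\<dots> \<le> real q * (real n + real n')" unfolding prod by (intro mult_left_mono) auto
  finally have "(real n + real n') * (4 * (real n + real n')) \<le> (real n + real n') * real q"
    by (simp only: mult.commute)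
  then have "4 * (real n + real n') \<le> real q" using assms(1) by (simp only: mult_le_cancel_left_pos of_nat_0_less_iff add_pos_nonneg of_nat_0_le_iff)
  moreover have "real q \<le> real q ^ 3 / 4"
  proof -
    have "2 * 2 * real q \<le> real q * real q * real q" using assms(3) by (intro mult_mono) auto
    then show ?thesis by (simp add: power3_eq_cube)
  qed
  ultimately have "real r \<le> 0" using r by simp
  then show ?thesis by simp
next
  case False
  then have "2 \<le> n" "2 \<le> n'" using assms(1,2) by auto
  then obtain i j where "n = i + 2" "n' = j + 2" by (metis add.commute le_Suc_ex)
  then have "n + n' \<le> n * n'" by simp
  moreover have "real q ^ 3 / 4 \<ge> 0" by simp
  then have "real r \<le> real (n + n')" using r unfolding of_nat_add by linarith
  then have "r \<le> n + n'" by (simp only: of_nat_le_iff)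
  ultimately show ?thesis by simp
qed

text \<open>Exchanging \<open>b\<close> and \<open>c\<close> makes the second flattening an instance
  of the first, so one rank lemma serves both.\<close>

lemma M'_entry_eq_M_entry: "M'_entry (tensor_sum r a b c) q = M_entry (tensor_sum r a c b) q"
  by (intro ext) (auto simp: M'_entry_def M_entry_def tensor_sum_def mult_ac)

theorem theorem2p9:
  fixes n1 n2 n3 q p r :: nat and \<alpha> :: real
  assumes "n1 > 0" and "n2 > 0" and "n3 > 0"
    and "\<alpha> = max (real n2 / real n3) (real n3 / real n2)"
    and "q \<le> n1"
    and "real q \<ge> (4 + 5 * \<alpha>) * (1 + 1 / \<alpha>)"
    and "p = nat \<lfloor>real q * (real n3 / (real n2 + real n3))\<rfloor>"
    and "real r \<le> (real n2 + real n3) * (1 - (3 + \<alpha>) / real q) - real q ^ 3 / 4"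
  shows "min (p + 1) (q - p) \<ge> 2 \<and>
    generically n1 n2 n3 r (\<lambda>a b c.
      (\<forall>l\<in>{1..r}. a l 1 \<noteq> 0) \<and>
      pairwise_lin_indep {1..r} (\<lambda>l. first_coords (min (p + 1) (q - p)) (a l)) \<and>
      lin_indep_family {1..r} (\<lambda>l. tensor2 (first_coords (p + 1) (a l)) (first_coords n2 (b l))) \<and>
      lin_indep_family {1..r} (\<lambda>l. tensor2 (first_coords (q - p) (a l)) (first_coords n3 (c l))) \<and>
      lin_indep_family {1..r} (\<lambda>l. tensor2 (first_coords n2 (b l)) (first_coords n3 (c l))) \<and>
      rank_M n2 n3 (tensor_sum r a b c) p q = r * ((q - 1) choose p) \<and>
      rank_M' n2 n3 (tensor_sum r a b c) p q = r * ((q - 1) choose p) \<and>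
      full_column_rank (N_rows q p n2) (N_cols q p r) (N_entry a b q) \<and>
      full_column_rank (N_rows q (q - p - 1) n3) (N_cols q (q - p - 1) r) (N_entry a c q) \<and>
      full_column_rank (P_rows (p + 1) n2) (P_cols r) (P_entry a b) \<and>
      full_column_rank (P_rows (q - p) n3) (P_cols r) (P_entry a c))"
proof -
  let ?s = "real n2 + real n3"
  let ?y = "real q * (real n3 / ?s)" and ?y' = "real q * (real n2 / ?s)"
  have s: "?s > 0" using assms(2) by simp
  have yy: "?y + ?y' = real q"
  proof -
    have "x * (u / t) + x * (v / t) = x" if "t > 0" "u + v = t" for x t u v :: real
      using that by (simp flip: distrib_left add_divide_distrib)
    then show ?thesis using s add.commute[of "real n3" "real n2"] by blast
  qed
  have bound: "real q * (real n2 * real n3) \<ge> ?s * (4 * ?s + max (real n2) (real n3))"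
    using q_bound[OF assms(2,3,4,6)] .
  then have bound': "real q * (real n3 * real n2) \<ge>
      (real n3 + real n2) * (4 * (real n3 + real n2) + max (real n3) (real n2))"
    by (simp only: add.commute mult.commute max.commute)
  \<comment> \<open>These bounds make both \<open>?y\<close> and \<open>?y'\<close> at least
    \<open>4\<close>, so rounding to \<open>p\<close> leaves enough coordinates on either
    side.\<close>
  have four: "4 * ?s \<le> ?y * real n2" "4 * ?s \<le> ?y' * real n3"
  proof -
    have "?s * (4 * ?s) \<le> ?s * (4 * ?s + max (real n2) (real n3))"
      using s by (intro mult_left_mono) auto
    also have "\<dots> \<le> ?s * (?y * real n2)"
    proof -
      have eq: "t * (x * (u / t) * v) = x * (v * u)" if "t > 0" for x t u v :: real
        using that by (simp add: field_simps)
      show ?thesis using bound by (simp only: eq[OF s])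
    qed
    finally show "4 * ?s \<le> ?y * real n2" using s by (simp only: mult_le_cancel_left_pos)
    also have "\<dots> = ?y' * real n3" by simp
    finally show "4 * ?s \<le> ?y' * real n3" .
  qed
  have y4: "4 \<le> ?y"
  proof -
    have "4 * real n2 \<le> ?y * real n2" using four(1) by simp
    then show ?thesis using assms(2) by (simp only: mult_le_cancel_right_pos of_nat_0_less_iff)
  qed
  have y4': "4 \<le> ?y'"
  proof -
    have "4 * real n3 \<le> ?y' * real n3" using four(2) by simp
    then show ?thesis using assms(3) by (simp only: mult_le_cancel_right_pos of_nat_0_less_iff)
  qed
  have p: "real p \<le> ?y" "?y < real p + 1"
  proof -
    have "real p = of_int \<lfloor>?y\<rfloor>" using y4 unfolding assms(7) by simp
    then show "real p \<le> ?y" "?y < real p + 1" by linarith+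
  qed
  have "real p < real q" using p(1) yy y4' by linarith
  then have pq: "p < q" by simp
  have qp: "real (q - p) = real q - real p" using pq by (simp add: of_nat_diff)
  have qp': "?y' \<le> real (q - p)" "real (q - p) \<le> ?y' + 1" unfolding qp using p yy by linarith+
  have ge2: "2 \<le> p + 1" "2 \<le> q - p" "2 \<le> q"
  proof -
    have "real 2 \<le> real (p + 1)" "real 2 \<le> real (q - p)" "real 2 \<le> real q"
      using p y4 y4' qp' yy by simp_all
    then show "2 \<le> p + 1" "2 \<le> q - p" "2 \<le> q" by (simp_all only: of_nat_le_iff)
  qed
  have \<alpha>: "real n3 / real n2 \<le> \<alpha>" "real n2 / real n3 \<le> \<alpha>" by (simp_all add: assms(4))
  have "0 \<le> \<alpha>" using \<alpha>(1) order_trans[of 0 "real n3 / real n2" \<alpha>] by simp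
  have r: "real r \<le> ?s - real q ^ 3 / 4"
  proof -
    have "?s * (1 - (3 + \<alpha>) / real q) \<le> ?s * 1" using s \<open>0 \<le> \<alpha>\<close> by (intro mult_left_mono) auto
    then show ?thesis using assms(8) order_trans[OF _ diff_right_mono] by (simp only: mult_1_right)
  qed
  have cN: "r \<le> (q - 1) * (n2 div (q - p))"
    using qp' ge2 by (intro N_count[OF assms(2) \<alpha>(1) _ _ _ assms(8)]) auto
  have cN': "r \<le> (q - 1) * (n3 div (p + 1))"
  proof (rule N_count[OF assms(3) \<alpha>(2)])
    show "real (p + 1) \<le> real q * (real n3 / (real n3 + real n2)) + 1" using p by (simp add: add.commute)
    show "real r \<le> (real n3 + real n2) * (1 - (3 + \<alpha>) / real q) - real q ^ 3 / 4"
      using assms(8) by (simp only: add.commute)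
  qed (use ge2 in auto)
  have cP: "r \<le> ((p + 1) div 2) * (n2 div 2)"
    using p pq by (intro P_count[OF assms(2) _ _ bound _ r]) auto
  have cP': "r \<le> ((q - p) div 2) * (n3 div 2)"
  proof (rule P_count[OF assms(3) _ _ bound'])
    show "real q * (real n2 / (real n3 + real n2)) \<le> real (q - p)"
      using qp'(1) by (simp only: add.commute)
    show "real r \<le> real n3 + real n2 - real q ^ 3 / 4" using r by (simp only: add.commute)
  qed (use ge2 in auto)
  have cT: "r \<le> n2 * n3" using tensor_count[OF assms(2,3) ge2(3) bound r] .

  let ?V = "coords n1 n2 n3 r"
  let ?a = "\<lambda>x l i. x (A_coord l i)" and ?b = "\<lambda>x l j. x (B_coord l j)" and ?c = "\<lambda>x l k. x (C_coord l k)"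
  have pa: "polyfun ?V (\<lambda>x. ?a x l i)" if "l \<in> {1..r}" "i \<in> {1..q}" for l i
    using that assms(5) by (intro polyfun.var) (auto simp: coords_def)
  have pb: "polyfun ?V (\<lambda>x. ?b x l j)" if "l \<in> {1..r}" "j \<in> {1..n2}" for l j
    using that by (intro polyfun.var) (auto simp: coords_def)
  have pc: "polyfun ?V (\<lambda>x. ?c x l k)" if "l \<in> {1..r}" "k \<in> {1..n3}" for l k
    using that by (intro polyfun.var) (auto simp: coords_def)
  have pa1: "polyfun ?V (\<lambda>x. ?a x l i)" if "l \<in> {1..r}" "i \<in> {1..p + 1}" for l i
    using that pq by (intro pa) auto
  have pa2: "polyfun ?V (\<lambda>x. ?a x l i)" if "l \<in> {1..r}" "i \<in> {1..q - p}" for l i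
    using that pq by (intro pa) auto
  let ?m = "min (p + 1) (q - p)"
  \<comment> \<open>Three witnesses are needed: \<open>u\<close> with coordinate planes for
    \<open>P\<close>, \<open>P'\<close> and the tensors involving \<open>a\<close>;
    \<open>u'\<close> with long runs for \<open>N\<close> and \<open>N'\<close>; \<open>u''\<close>
    with matrix units for the tensors of \<open>b\<close> and \<open>c\<close>.\<close>
  define u where "u = coord_val (\<lambda>l. mom (real l)) (block_vec 2 ((p + 1) div 2)) (block_vec 2 ((q - p) div 2))"
  define u' where "u' = coord_val (\<lambda>l. mom (real l)) (block_vec (q - p) (q - 1)) (block_vec (p + 1) (q - 1))"
  define u'' where "u'' = coord_val (\<lambda>l. mom (real l))
    (\<lambda>l. unit_vec ((l - 1) div n3 + 1)) (\<lambda>l. unit_vec ((l - 1) mod n3 + 1))"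
  define P1 where "P1 x \<longleftrightarrow> (\<forall>l\<in>{1..r}. ?a x l 1 \<noteq> 0)" for x :: "coord \<Rightarrow> real"
  \<comment> \<open>Pairs with \<open>l = k\<close> are included; the column set is then a
    singleton.\<close>
  define P2 where "P2 x \<longleftrightarrow> (\<forall>(l, k)\<in>{1..r} \<times> {1..r}. col_indep {1..?m} {l, k} (\<lambda>i l. ?a x l i))" for x :: "coord \<Rightarrow> real"
  define P3 where "P3 x \<longleftrightarrow> col_indep ({1..p + 1} \<times> {1..n2}) {1..r} (\<lambda>(i, j) l. ?a x l i * ?b x l j)" for x :: "coord \<Rightarrow> real"
  define P4 where "P4 x \<longleftrightarrow> col_indep ({1..q - p} \<times> {1..n3}) {1..r} (\<lambda>(i, j) l. ?a x l i * ?c x l j)" for x :: "coord \<Rightarrow> real"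
  define P5 where "P5 x \<longleftrightarrow> col_indep ({1..n2} \<times> {1..n3}) {1..r} (\<lambda>(i, j) l. ?b x l i * ?c x l j)" for x :: "coord \<Rightarrow> real"
  define P8 where "P8 x \<longleftrightarrow> col_indep (N_rows q p n2) (N_cols q p r) (N_entry (?a x) (?b x) q)" for x :: "coord \<Rightarrow> real"
  define P9 where "P9 x \<longleftrightarrow> col_indep (N_rows q (q - p - 1) n3) (N_cols q (q - p - 1) r) (N_entry (?a x) (?c x) q)" for x :: "coord \<Rightarrow> real"
  define P10 where "P10 x \<longleftrightarrow> col_indep (P_rows (p + 1) n2) (P_cols r) (P_entry (?a x) (?b x))" for x :: "coord \<Rightarrow> real"
  define P11 where "P11 x \<longleftrightarrow> col_indep (P_rows (q - p) n3) (P_cols r) (P_entry (?a x) (?c x))" for x :: "coord \<Rightarrow> real"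
  have 1: "holds_generically ?V P1"
    unfolding P1_def
  proof (rule holds_generically_ball)
    fix l assume "l \<in> {1..r}"
    then have "polyfun ?V (\<lambda>x. ?a x l 1)" using pq by (intro pa) auto
    then show "holds_generically ?V (\<lambda>x. ?a x l 1 \<noteq> 0)"
      by (rule polyfun_holds_generically[where u = u]) (simp add: u_def mom_def)
  qed simp
  have 2: "holds_generically ?V P2"
    unfolding P2_def
  proof (rule holds_generically_ball)
    fix lk assume "lk \<in> {1..r} \<times> {1..r}"
    then obtain l k where lk: "lk = (l, k)" "l \<in> {1..r}" "k \<in> {1..r}" by blast
    have "holds_generically ?V (\<lambda>x. col_indep {1..?m} {l, k} (\<lambda>i l. ?a x l i))"
    proof (rule col_indep_holds_generically[where u = u])
      show "polyfun ?V (\<lambda>x. ?a x j i)" if "i \<in> {1..?m}" "j \<in> {l, k}" for i j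
        using that lk pq by (intro pa) auto
      show "col_indep {1..?m} {l, k} (\<lambda>i l. ?a u l i)"
        using mom_pair_col_indep[of ?m l k] ge2 by (simp add: u_def)
    qed simp
    then show "holds_generically ?V (\<lambda>x. case lk of (l, k) \<Rightarrow> col_indep {1..?m} {l, k} (\<lambda>i l. ?a x l i))"
      by (simp add: lk(1))
  qed simp
  have 3: "holds_generically ?V P3"
    unfolding P3_def
  proof (rule col_indep_holds_generically[where u = u])
    show "col_indep ({1..p + 1} \<times> {1..n2}) {1..r} (\<lambda>(i, j) l. ?a u l i * ?b u l j)"
      using tensor_col_indep[of 2 "(p + 1) div 2" "p + 1" r n2] cP ge2 by (simp add: u_def)
    show "polyfun ?V (\<lambda>x. (case R of (i, j) \<Rightarrow> \<lambda>l. ?a x l i * ?b x l j) l)"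
      if "R \<in> {1..p + 1} \<times> {1..n2}" "l \<in> {1..r}" for R l
      by (rule tensor_polyfun[where a = ?a and b = ?b, OF pa1 pb that])
  qed simp
  have 4: "holds_generically ?V P4"
    unfolding P4_def
  proof (rule col_indep_holds_generically[where u = u])
    show "col_indep ({1..q - p} \<times> {1..n3}) {1..r} (\<lambda>(i, j) l. ?a u l i * ?c u l j)"
      using tensor_col_indep[of 2 "(q - p) div 2" "q - p" r n3] cP' ge2 by (simp add: u_def)
    show "polyfun ?V (\<lambda>x. (case R of (i, j) \<Rightarrow> \<lambda>l. ?a x l i * ?c x l j) l)"
      if "R \<in> {1..q - p} \<times> {1..n3}" "l \<in> {1..r}" for R l
      by (rule tensor_polyfun[where a = ?a and b = ?c, OF pa2 pc that])
  qed simp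
  have 5: "holds_generically ?V P5"
    unfolding P5_def
  proof (rule col_indep_holds_generically[where u = u''])
    show "col_indep ({1..n2} \<times> {1..n3}) {1..r} (\<lambda>(i, j) l. ?b u'' l i * ?c u'' l j)"
      using unit_tensor_col_indep[OF cT] by (simp add: u''_def)
    show "polyfun ?V (\<lambda>x. (case R of (i, j) \<Rightarrow> \<lambda>l. ?b x l i * ?c x l j) l)"
      if "R \<in> {1..n2} \<times> {1..n3}" "l \<in> {1..r}" for R l
      by (rule tensor_polyfun[where a = ?b and b = ?c, OF pb pc that])
  qed simp
  have 8: "holds_generically ?V P8"
    unfolding P8_def
  proof (rule col_indep_holds_generically[where u = u'])
    show "col_indep (N_rows q p n2) (N_cols q p r) (N_entry (?a u') (?b u') q)"
      using N_col_indep[OF pq ge2(3) cN] by (simp add: u'_def)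
    show "polyfun ?V (\<lambda>x. N_entry (?a x) (?b x) q R C)"
      if "R \<in> N_rows q p n2" "C \<in> N_cols q p r" for R C
      by (rule N_entry_polyfun[where a = ?a and b = ?b, OF pa pb that])
  qed simp
  have 9: "holds_generically ?V P9"
    unfolding P9_def
  proof (rule col_indep_holds_generically[where u = u'])
    have "q - (q - p - 1) = p + 1" "q - p - 1 < q" using pq by auto
    then show "col_indep (N_rows q (q - p - 1) n3) (N_cols q (q - p - 1) r) (N_entry (?a u') (?c u') q)"
      using N_col_indep[of "q - p - 1" q r n3] ge2(3) cN' by (simp add: u'_def)
    show "polyfun ?V (\<lambda>x. N_entry (?a x) (?c x) q R C)"
      if "R \<in> N_rows q (q - p - 1) n3" "C \<in> N_cols q (q - p - 1) r" for R C
      by (rule N_entry_polyfun[where a = ?a and b = ?c, OF pa pc that])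
  qed simp
  have 10: "holds_generically ?V P10"
    unfolding P10_def
  proof (rule col_indep_holds_generically[where u = u])
    show "col_indep (P_rows (p + 1) n2) (P_cols r) (P_entry (?a u) (?b u))"
      using P_col_indep[OF ge2(1) cP] by (simp add: u_def)
    show "polyfun ?V (\<lambda>x. P_entry (?a x) (?b x) R C)"
      if "R \<in> P_rows (p + 1) n2" "C \<in> P_cols r" for R C
      by (rule P_entry_polyfun[where a = ?a and b = ?b, OF pa1 pb that])
  qed simp
  have 11: "holds_generically ?V P11"
    unfolding P11_def
  proof (rule col_indep_holds_generically[where u = u])
    show "col_indep (P_rows (q - p) n3) (P_cols r) (P_entry (?a u) (?c u))"
      using P_col_indep[OF ge2(2) cP'] by (simp add: u_def)
    show "polyfun ?V (\<lambda>x. P_entry (?a x) (?c x) R C)"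
      if "R \<in> P_rows (q - p) n3" "C \<in> P_cols r" for R C
      by (rule P_entry_polyfun[where a = ?a and b = ?c, OF pa2 pc that])
  qed simp
  have "holds_generically ?V (\<lambda>x. P1 x \<and> P2 x \<and> P3 x \<and> P4 x \<and> P5 x \<and> P8 x \<and> P9 x \<and> P10 x \<and> P11 x)"
    using 1 2 3 4 5 8 9 10 11 by (intro holds_generically_conj)
  then have "generically n1 n2 n3 r (\<lambda>a b c.
      (\<forall>l\<in>{1..r}. a l 1 \<noteq> 0) \<and>
      pairwise_lin_indep {1..r} (\<lambda>l. first_coords (min (p + 1) (q - p)) (a l)) \<and>
      lin_indep_family {1..r} (\<lambda>l. tensor2 (first_coords (p + 1) (a l)) (first_coords n2 (b l))) \<and>
      lin_indep_family {1..r} (\<lambda>l. tensor2 (first_coords (q - p) (a l)) (first_coords n3 (c l))) \<and>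
      lin_indep_family {1..r} (\<lambda>l. tensor2 (first_coords n2 (b l)) (first_coords n3 (c l))) \<and>
      rank_M n2 n3 (tensor_sum r a b c) p q = r * ((q - 1) choose p) \<and>
      rank_M' n2 n3 (tensor_sum r a b c) p q = r * ((q - 1) choose p) \<and>
      full_column_rank (N_rows q p n2) (N_cols q p r) (N_entry a b q) \<and>
      full_column_rank (N_rows q (q - p - 1) n3) (N_cols q (q - p - 1) r) (N_entry a c q) \<and>
      full_column_rank (P_rows (p + 1) n2) (P_cols r) (P_entry a b) \<and>
      full_column_rank (P_rows (q - p) n3) (P_cols r) (P_entry a c))" (is "generically _ _ _ _ ?Q")
  proof (rule generically_if_holds_generically)
    fix a b c
    let ?x = "coord_val a b c"
    assume x: "P1 ?x \<and> P2 ?x \<and> P3 ?x \<and> P4 ?x \<and> P5 ?x \<and> P8 ?x \<and> P9 ?x \<and> P10 ?x \<and> P11 ?x"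
    have a1: "\<forall>l\<in>{1..r}. a l 1 \<noteq> 0" using x by (simp add: P1_def)
    have pw: "\<forall>(l, k)\<in>{1..r} \<times> {1..r}. col_indep {1..?m} {l, k} (\<lambda>i l. a l i)"
      using x by (simp add: P2_def)
    have T3: "col_indep ({1..p + 1} \<times> {1..n2}) {1..r} (\<lambda>(i, j) l. a l i * b l j)"
      using x by (simp add: P3_def)
    have T4: "col_indep ({1..q - p} \<times> {1..n3}) {1..r} (\<lambda>(i, j) l. a l i * c l j)"
      using x by (simp add: P4_def)
    have T5: "col_indep ({1..n2} \<times> {1..n3}) {1..r} (\<lambda>(i, j) l. b l i * c l j)"
      using x by (simp add: P5_def)
    have N8: "col_indep (N_rows q p n2) (N_cols q p r) (N_entry a b q)" using x by (simp add: P8_def)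
    have N9: "col_indep (N_rows q (q - p - 1) n3) (N_cols q (q - p - 1) r) (N_entry a c q)"
      using x by (simp add: P9_def)
    have P10: "col_indep (P_rows (p + 1) n2) (P_cols r) (P_entry a b)" using x by (simp add: P10_def)
    have P11: "col_indep (P_rows (q - p) n3) (P_cols r) (P_entry a c)" using x by (simp add: P11_def)
    have p'1: "q - p - 1 + 1 = q - p" "q - p - 1 < q" using pq by auto
    have B: "col_indep (subset_idx q p n2) (pivot_cols q p r) (N_entry a b q)"
      by (rule pivot_col_indep[OF pq N8 T3])
    have B': "col_indep (subset_idx q (q - p - 1) n3) (pivot_cols q (q - p - 1) r) (N_entry a c q)"
      using T4 by (intro pivot_col_indep[OF p'1(2) N9]) (simp only: p'1(1))
    have M: "rank_M n2 n3 (tensor_sum r a b c) p q = r * ((q - 1) choose p)"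
      unfolding rank_M_def using a1 by (intro rank_M_eq[OF pq refl _ B B']) auto
    \<comment> \<open>Passing from \<open>p\<close> to \<open>q - p - 1\<close> is an involution, so
      the same lemma applies with \<open>b\<close>, \<open>c\<close> and the two independence facts
      exchanged.\<close>
    have "p = q - (q - p - 1) - 1" using pq by simp
    from rank_M_eq[where a = a, OF p'1(2) this _ B' B] a1
    have "mat_rank (subset_idx q (q - p - 1) n3) (subset_idx q (q - p) n2) (M_entry (tensor_sum r a c b) q) =
        r * ((q - 1) choose (q - p - 1))"
      unfolding p'1(1) by blast
    moreover have "(q - 1) choose (q - p - 1) = (q - 1) choose p"
      using pq binomial_symmetric[of p "q - 1"] by simp
    ultimately have M': "rank_M' n2 n3 (tensor_sum r a b c) p q = r * ((q - 1) choose p)"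
      unfolding rank_M'_def M'_entry_eq_M_entry by simp
    have pw': "pairwise_lin_indep {1..r} (\<lambda>l. first_coords ?m (a l))"
      unfolding pairwise_lin_indep_def first_coords_mat_col[of ?m a]
      using pw by (auto intro!: lin_indep_family_mat_col)
    show "?Q a b c"
      unfolding tensor2_mat_col[of "p + 1" a n2 b] tensor2_mat_col[of "q - p" a n3 c]
        tensor2_mat_col[of n2 b n3 c]
      using a1 pw' M M' lin_indep_family_mat_col[OF _ T3] lin_indep_family_mat_col[OF _ T4]
        lin_indep_family_mat_col[OF _ T5] full_column_rank_if_col_indep[OF _ N8]
        full_column_rank_if_col_indep[OF _ N9] full_column_rank_if_col_indep[OF _ P10]
        full_column_rank_if_col_indep[OF _ P11]
      by (intro conjI) simp_all
  qed
  with ge2 show ?thesis by simp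
qed

end
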